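(* Let $s,\sigma\in(0,1)$ and let $(u,E)$ be a minimizing cone in $\mathbb R^n$, with $u\in C(\mathbb R^n)$ and $[u]_{C^\gamma(\mathbb R^n)}<+\infty$ for some $\gamma\in(0,1]$. If $E$ is contained in a halfspace then $u\le0$. Similarly, if $E^c$ is contained in a halfspace then $u\ge0$. In particular, if $E$ is a halfspace then $u$ vanishes identically.
   Context: $[u]_{C^\gamma(\mathbb R^n)}=\sup_{x\ne y}|u(x)-u(y)|/|x-y|^\gamma$. $B_r=\{x\in\mathbb R^n:|x|<r\}$; $A^c=\mathbb R^n\setminus A$. For disjoint measurable $A,B\subseteq\mathbb R^n$ let $\mathcal L(A,B)=\iint_{A\times B}\frac{dx\,dy}{|x-y|^{n+\sigma}}$. For a bounded Lipschitz domain $\Omega\subset\mathbb R^n$ and measurable $E\subseteq\mathbb R^n$, $$\mathrm{Per}_\sigma(E,\Omega)=\mathcal L(E\cap\Omega,E^c\cap\Omega)+\mathcal L(E\cap\Omega,E^c\cap\Omega^c)+\mathcal L(E\cap\Omega^c,E^c\cap\Omega),$$ $$\mathcal F(u,E)=\iint_{\mathbb R^{2n}\setminus(\Omega^c)^2}\frac{|u(x)-u(y)|^2}{|x-y|^{n+2s}}\,dx\,dy+\mathrm{Per}_\sigma(E,\Omega).$$ Minimizing pair in $\Omega$: fix external data, i.e. a set $E_0\subseteq\mathbb R^n$ with locally finite $\sigma$-perimeter and $\varphi\in H^s_{\rm loc}(\mathbb R^n)$ with $\varphi\ge0$ a.e. in $E_0$ and $\varphi\le0$ a.e. in $E_0^c$;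 it is assumed that at least one admissible pair has finite energy. A pair $(v,F)$ is admissible if $v-\varphi\in H^s(\mathbb R^n)$, $v=\varphi$ a.e. in $\Omega^c$, $F\subseteq\mathbb R^n$ is measurable with $F\setminus\Omega=E_0\setminus\Omega$, and $v\ge0$ a.e. in $F\cap\Omega$, $v\le0$ a.e. in $F^c\cap\Omega$. A pair $(u,E)$ is a minimizing pair in $\Omega$ if, for some such data, it is admissible and $\mathcal F(u,E)\le\mathcal F(v,F)$ for every admissible $(v,F)$. A minimizing cone is a pair $(u,E)$ that is minimizing in every ball $B_R$, $R>0$, such that $u$ is homogeneous of degree $s-\frac\sigma2$ (i.e. $u(tx)=t^{s-\sigma/2}u(x)$ for $t>0$) and $E$ is a cone (i.e. for any $t>0$, $tx\in E$ if and only if $x\in E$). *)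

theory Defs
  imports "HOL-Analysis.Analysis"
begin

text \<open>Measurability is Lebesgue measurability, and all energies take values in \<open>[0,\<infinity>]\<close>.
  Double integrals are taken with respect to the product of two Lebesgue measures; on the diagonal,
  a null set, the kernels have the junk value \<open>0\<close>.\<close>

definition interaction :: "real \<Rightarrow> (real ^ 'n) set \<Rightarrow> (real ^ 'n) set \<Rightarrow> ennreal" where
  "interaction \<sigma> A B =
     (\<integral>\<^sup>+ (x, y) \<in> A \<times> B. ennreal (1 / norm (x - y) powr (real CARD('n) + \<sigma>))
        \<partial>(lebesgue \<Otimes>\<^sub>M lebesgue))"

definition frac_Per :: "real \<Rightarrow> (real ^ 'n) set \<Rightarrow> (real ^ 'n) set \<Rightarrow> ennreal" where
  "frac_Per \<sigma> E \<Omega> =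
     interaction \<sigma> (E \<inter> \<Omega>) (- E \<inter> \<Omega>) +
     interaction \<sigma> (E \<inter> \<Omega>) (- E \<inter> - \<Omega>) +
     interaction \<sigma> (E \<inter> - \<Omega>) (- E \<inter> \<Omega>)"

definition gagliardo :: "real \<Rightarrow> ((real ^ 'n) \<times> (real ^ 'n)) set \<Rightarrow> (real ^ 'n \<Rightarrow> real) \<Rightarrow> ennreal" where
  "gagliardo s D u =
     (\<integral>\<^sup>+ (x, y) \<in> D. ennreal (\<bar>u x - u y\<bar>\<^sup>2 / norm (x - y) powr (real CARD('n) + 2 * s))
        \<partial>(lebesgue \<Otimes>\<^sub>M lebesgue))"

definition energy ::
  "real \<Rightarrow> real \<Rightarrow> (real ^ 'n) set \<Rightarrow> (real ^ 'n \<Rightarrow> real) \<Rightarrow> (real ^ 'n) set \<Rightarrow> ennreal" where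
  "energy s \<sigma> \<Omega> u E = gagliardo s (UNIV - (- \<Omega>) \<times> (- \<Omega>)) u + frac_Per \<sigma> E \<Omega>"

definition in_Hs :: "real \<Rightarrow> (real ^ 'n) set \<Rightarrow> (real ^ 'n \<Rightarrow> real) \<Rightarrow> bool" where
  "in_Hs s A u \<longleftrightarrow>
     u \<in> borel_measurable (lebesgue_on A) \<and>
     (\<integral>\<^sup>+ x \<in> A. ennreal (\<bar>u x\<bar>\<^sup>2) \<partial>lebesgue) < \<infinity> \<and>
     gagliardo s (A \<times> A) u < \<infinity>"

definition in_Hs_loc :: "real \<Rightarrow> (real ^ 'n \<Rightarrow> real) \<Rightarrow> bool" where
  "in_Hs_loc s u \<longleftrightarrow> (\<forall>R>0. in_Hs s (ball 0 R) u)"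

text \<open>\<open>frac_Per \<sigma> E\<close> is monotone in the domain, so testing on centred balls is the same as testing
  on all bounded Lipschitz domains.\<close>

definition loc_finite_Per :: "real \<Rightarrow> (real ^ 'n) set \<Rightarrow> bool" where
  "loc_finite_Per \<sigma> E \<longleftrightarrow> E \<in> sets lebesgue \<and> (\<forall>R>0. frac_Per \<sigma> E (ball 0 R) < \<infinity>)"

definition external_data ::
  "real \<Rightarrow> real \<Rightarrow> (real ^ 'n \<Rightarrow> real) \<Rightarrow> (real ^ 'n) set \<Rightarrow> bool" where
  "external_data s \<sigma> \<phi> E\<^sub>0 \<longleftrightarrow>
     loc_finite_Per \<sigma> E\<^sub>0 \<and> in_Hs_loc s \<phi> \<and>
     (AE x in lebesgue. x \<in> E\<^sub>0 \<longrightarrow> 0 \<le> \<phi> x) \<and>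
     (AE x in lebesgue. x \<in> - E\<^sub>0 \<longrightarrow> \<phi> x \<le> 0)"

definition admissible ::
  "real \<Rightarrow> (real ^ 'n) set \<Rightarrow> (real ^ 'n \<Rightarrow> real) \<Rightarrow> (real ^ 'n) set \<Rightarrow>
   (real ^ 'n \<Rightarrow> real) \<Rightarrow> (real ^ 'n) set \<Rightarrow> bool" where
  "admissible s \<Omega> \<phi> E\<^sub>0 v F \<longleftrightarrow>
     in_Hs s UNIV (\<lambda>x. v x - \<phi> x) \<and>
     (AE x in lebesgue. x \<in> - \<Omega> \<longrightarrow> v x = \<phi> x) \<and>
     F \<in> sets lebesgue \<and> F - \<Omega> = E\<^sub>0 - \<Omega> \<and>
     (AE x in lebesgue. x \<in> F \<inter> \<Omega> \<longrightarrow> 0 \<le> v x) \<and>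
     (AE x in lebesgue. x \<in> - F \<inter> \<Omega> \<longrightarrow> v x \<le> 0)"

definition minimizing_pair ::
  "real \<Rightarrow> real \<Rightarrow> (real ^ 'n) set \<Rightarrow> (real ^ 'n \<Rightarrow> real) \<Rightarrow> (real ^ 'n) set \<Rightarrow> bool" where
  "minimizing_pair s \<sigma> \<Omega> u E \<longleftrightarrow>
     (\<exists>\<phi> E\<^sub>0. external_data s \<sigma> \<phi> E\<^sub>0 \<and>
        (\<exists>v F. admissible s \<Omega> \<phi> E\<^sub>0 v F \<and> energy s \<sigma> \<Omega> v F < \<infinity>) \<and>
        admissible s \<Omega> \<phi> E\<^sub>0 u E \<and>
        (\<forall>v F. admissible s \<Omega> \<phi> E\<^sub>0 v F \<longrightarrow> energy s \<sigma> \<Omega> u E \<le> energy s \<sigma> \<Omega> v F))"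

definition minimizing_cone ::
  "real \<Rightarrow> real \<Rightarrow> (real ^ 'n \<Rightarrow> real) \<Rightarrow> (real ^ 'n) set \<Rightarrow> bool" where
  "minimizing_cone s \<sigma> u E \<longleftrightarrow>
     (\<forall>R>0. minimizing_pair s \<sigma> (ball 0 R) u E) \<and>
     (\<forall>t>0. \<forall>x. u (t *\<^sub>R x) = t powr (s - \<sigma> / 2) * u x) \<and>
     (\<forall>t>0. \<forall>x. t *\<^sub>R x \<in> E \<longleftrightarrow> x \<in> E)"

definition holder_seminorm :: "real \<Rightarrow> (real ^ 'n \<Rightarrow> real) \<Rightarrow> ennreal" where
  "holder_seminorm \<gamma> u =
     (SUP (x, y) \<in> {(x, y). x \<noteq> y}. ennreal (\<bar>u x - u y\<bar> / norm (x - y) powr \<gamma>))"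

text \<open>Half-spaces may be open or closed, and their boundary need not contain the origin.\<close>

definition halfspace :: "(real ^ 'n) set \<Rightarrow> bool" where
  "halfspace H \<longleftrightarrow> (\<exists>a b. a \<noteq> 0 \<and> (H = {x. a \<bullet> x \<le> b} \<or> H = {x. a \<bullet> x < b}))"

end

theory Submission
  imports Defs
begin

text \<open>Only competitors that keep \<open>E\<close> fixed are needed. Put \<open>\<beta> = s - \<sigma> / 2 < s\<close>. For \<open>\<beta> < 0\<close>, homogeneity and
  continuity at the origin force \<open>u = 0\<close>. Otherwise the cone \<open>E\<close> lies in \<open>{x. 0 \<le> e \<bullet> x}\<close> for a unit
  vector \<open>e\<close>, so \<open>u \<le> 0\<close> where \<open>e \<bullet> x \<le> 0\<close>, and the Hoelder bound makes \<open>M\<close>, the supremum of \<open>u\<close> on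
  \<open>{x. e \<bullet> x = 1}\<close>, finite. If \<open>M > 0\<close>, then homogeneity and Young's inequality
  \<open>t\<^sup>\<beta> \<le> (1 - \<beta>/s) + (\<beta>/s) t\<^sup>s\<close> give \<open>u \<le> M w\<close> with \<open>w = (1 - \<beta>/s) + (\<beta>/s) (e \<bullet> x)\<^sup>s\<close> on the half-space
  and \<open>w = 0\<close> outside. Since \<open>(e \<bullet> x)\<^sub>+\<^sup>s\<close> is \<open>s\<close>-harmonic in the half-space and its indicator function is
  strictly \<open>s\<close>-superharmonic, so is \<open>w\<close>. The bound is almost attained at some \<open>z\<close> with \<open>e \<bullet> z = 1\<close>;
  subtracting from \<open>M w\<close> a small multiple of a semiconvex bump at \<open>z\<close> yields a strict supersolution \<open>g\<close>
  that \<open>u\<close> exceeds only near \<open>z\<close>, and replacing \<open>u\<close> by \<open>min u g\<close> strictly lowers the energy. The case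
  of \<open>- E\<close> is the same argument for \<open>- u\<close>.\<close>

section \<open>The fractional kernel\<close>

text \<open>The sharp bound from homogeneity is \<open>M * (e \<bullet> x) powr \<beta>\<close>. The
  combination that replaces it touches it exactly on \<open>e \<bullet> x = 1\<close>, and both of
  its parts can be computed: the power \<open>s\<close> by an inversion on the half-line, the
  indicator because its fractional Laplacian is the kernel mass of the opposite half-space. The
  assumption \<open>0 < \<sigma>\<close> enters as \<open>\<beta> < s\<close>, which makes the
  weight of the indicator positive; all strictness comes from there.

  Two obstacles shape the rest. The hyperplane \<open>e \<bullet> x = 1\<close> is in general not
  compact, so \<open>M\<close> need not be attained; the bump makes up for the missing touching
  point. And \<open>u\<close> is only continuous with finite energy, so it has no pointwise
  fractional Laplacian: two energies are compared instead, and \<open>g\<close> enters only through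
  its bilinear form against the positive part of \<open>u - g\<close>. That form is estimated by
  pointwise bounds for symmetric truncations of the kernel, which take the place of principal
  values.\<close>

definition frac_kernel :: "real \<Rightarrow> 'a::euclidean_space \<Rightarrow> real" where
  "frac_kernel s h = 1 / norm h powr (real DIM('a) + 2 * s)"

lemma frac_kernel_nonneg: "0 \<le> frac_kernel s h"
  by (simp add: frac_kernel_def)

lemma frac_kernel_minus [simp]: "frac_kernel s (- h) = frac_kernel s h"
  by (simp add: frac_kernel_def)

lemma frac_kernel_commute: "frac_kernel s (x - y) = frac_kernel s (y - x)"
  by (simp add: frac_kernel_def norm_minus_commute)

lemma frac_kernel_scaleR:
  fixes h :: "'a::euclidean_space"
  assumes "r > 0"
  shows "frac_kernel s (r *\<^sub>R h) = r powr - (real DIM('a) + 2 * s) * frac_kernel s h"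
  unfolding frac_kernel_def powr_minus using assms by (simp add: powr_mult divide_simps)

lemma frac_kernel_measurable [measurable]: "frac_kernel s \<in> borel_measurable borel"
  unfolding frac_kernel_def by measurable

section \<open>Integrability of powers of the norm and of the kernel majorant\<close>

text \<open>Layering by balls replaces polar coordinates: \<open>f\<close> is dominated by the sum
  of the heights \<open>b k\<close> on the balls of radius \<open>r k\<close>, whose volumes are
  multiples of \<open>r k ^ DIM('a)\<close>, and the growth condition turns the integral of this sum
  into a geometric series.\<close>

lemma nn_integral_finite_of_balls:
  fixes f :: "'a::euclidean_space \<Rightarrow> real" and b r :: "nat \<Rightarrow> real"
  assumes cover: "\<And>h. f h \<noteq> 0 \<Longrightarrow> \<exists>k. norm h < r k \<and> f h \<le> b k"
    and "\<And>k. 0 \<le> b k" "\<And>k. 0 < r k"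
    and le: "\<And>k. b k * r k ^ DIM('a) \<le> C * \<rho> ^ k" and "0 \<le> \<rho>" "\<rho> < 1"
  shows "(\<integral>\<^sup>+ h. ennreal (f h) \<partial>lborel) < \<infinity>"
proof -
  define V where "V = unit_ball_vol (real DIM('a))"
  have V: "0 \<le> V" unfolding V_def by simp
  have "(\<integral>\<^sup>+ h. ennreal (f h) \<partial>lborel) \<le>
      (\<integral>\<^sup>+ h. (\<Sum>k. ennreal (b k) * indicator (ball (0::'a) (r k)) h) \<partial>lborel)"
  proof (rule nn_integral_mono)
    fix h :: 'a
    show "ennreal (f h) \<le> (\<Sum>k. ennreal (b k) * indicator (ball 0 (r k)) h)"
    proof (cases "f h = 0")
      case False
      then obtain k where k: "norm h < r k" "f h \<le> b k" using cover by blast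
      have "ennreal (f h) \<le> ennreal (b k) * indicator (ball 0 (r k)) h"
        using k by (simp add: ennreal_leI)
      also have "\<dots> = (\<Sum>j\<in>{k}. ennreal (b j) * indicator (ball 0 (r j)) h)"
        by (simp only: sum.insert finite.emptyI empty_iff sum.empty not_False_eq_True add_0_right)
      also have "\<dots> \<le> (\<Sum>j. ennreal (b j) * indicator (ball 0 (r j)) h)"
        by (rule sum_le_suminf) auto
      finally show ?thesis .
    qed simp
  qed
  also have "\<dots> = (\<Sum>k. \<integral>\<^sup>+ h. ennreal (b k) * indicator (ball (0::'a) (r k)) h \<partial>lborel)"
    by (intro nn_integral_suminf borel_measurable_times_ennreal borel_measurable_indicator) auto
  also have "\<dots> = (\<Sum>k. ennreal (b k * (V * r k ^ DIM('a))))"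
    using assms(2,3) V
    by (simp add: nn_integral_cmult_indicator emeasure_ball less_imp_le V_def[symmetric] ennreal_mult)
  also have "\<dots> \<le> (\<Sum>k. ennreal (V * C * \<rho> ^ k))"
  proof (intro suminf_le ennreal_leI)
    fix k show "b k * (V * r k ^ DIM('a)) \<le> V * C * \<rho> ^ k"
      using mult_left_mono[OF le[of k] V] by (simp add: algebra_simps)
  qed auto
  also have "\<dots> < \<infinity>"
  proof -
    have C: "0 \<le> C * \<rho> ^ k" for k
    proof -
      have "0 \<le> b k * r k ^ DIM('a)"
        using assms(2)[of k] assms(3)[of k] by (intro mult_nonneg_nonneg) auto
      then show ?thesis using le[of k] by linarith
    qed
    have "summable (\<lambda>k. V * C * \<rho> ^ k)"
      using assms by (intro summable_mult summable_geometric) auto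
    then have "(\<Sum>k. ennreal (V * C * \<rho> ^ k)) = ennreal (\<Sum>k. V * C * \<rho> ^ k)"
      using C V by (intro suminf_ennreal2) (auto simp: mult.assoc)
    then show ?thesis by simp
  qed
  finally show ?thesis .
qed

lemma nn_integral_norm_powr_outside_finite:
  assumes "p + real DIM('a) < 0"
  shows "(\<integral>\<^sup>+ h. ennreal (norm h powr p * indicator {1..} (norm h)) \<partial>(lborel :: 'a::euclidean_space measure)) < \<infinity>"
proof (rule nn_integral_finite_of_balls[where r = "\<lambda>k. 2 ^ (k + 1)" and b = "\<lambda>k. (2 powr p) ^ k"
        and C = "2 ^ DIM('a)" and \<rho> = "2 powr (p + DIM('a))"])
  fix h :: 'a
  assume "norm h powr p * indicator {1..} (norm h) \<noteq> 0"
  then have h: "1 \<le> norm h" by (auto simp: indicator_def split: if_splits)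
  \<comment> \<open>The dyadic shell of \<open>h\<close>, with
    \<open>2 ^ k \<le> norm h < 2 ^ (k + 1)\<close>. As \<open>p\<close> is negative, the power is
    largest at the inner radius.\<close>
  define k where "k = nat \<lfloor>log 2 (norm h)\<rfloor>"
  have l0: "0 \<le> log 2 (norm h)" using h by (subst zero_le_log_cancel_iff) auto
  have k: "real k \<le> log 2 (norm h)" "log 2 (norm h) < real k + 1"
    unfolding k_def using l0 by (simp_all add: of_nat_nat)
  have nh: "norm h = 2 powr log 2 (norm h)" using h by (subst powr_log_cancel) auto
  have "norm h < 2 powr (real k + 1)" using k nh by (metis powr_less_cancel_iff one_less_numeral_iff semiring_norm(76))
  then have 1: "norm h < 2 ^ (k + 1)" by (simp add: powr_add powr_realpow mult.commute)
  have "2 powr real k \<le> norm h" using k nh by (metis powr_mono one_le_numeral)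
  then have "norm h powr p \<le> (2 powr real k) powr p"
    using assms by (intro powr_mono2') auto
  also have "\<dots> = (2 powr p) ^ k"
    by (simp add: powr_powr mult.commute powr_realpow[symmetric])
  finally show "\<exists>k. norm h < 2 ^ (k + 1) \<and> norm h powr p * indicator {1..} (norm h) \<le> (2 powr p) ^ k"
    using 1 h by (intro exI[of _ k]) simp
next
  fix k
  show "(2 powr p) ^ k * (2 ^ (k + 1)) ^ DIM('a) \<le> 2 ^ DIM('a) * (2 powr (p + real DIM('a))) ^ k"
    by (simp add: powr_add powr_realpow power_mult_distrib power_add power_mult[symmetric] mult.commute)
next
  show "2 powr (p + real DIM('a)) < 1"
    using assms powr_less_mono[of "p + real DIM('a)" 0 2] by simp
qed auto

lemma nn_integral_norm_powr_inside_finite: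
  assumes "0 < p + real DIM('a)"
  shows "(\<integral>\<^sup>+ h. ennreal (norm h powr p * indicator {..<1} (norm h)) \<partial>(lborel :: 'a::euclidean_space measure)) < \<infinity>"
proof (rule nn_integral_finite_of_balls[where r = "\<lambda>k. (1/2) ^ k" and b = "\<lambda>k. 2 powr \<bar>p\<bar> * (2 powr - p) ^ k"
        and C = "2 powr \<bar>p\<bar>" and \<rho> = "2 powr - (p + DIM('a))"])
  fix h :: 'a
  assume "norm h powr p * indicator {..<1} (norm h) \<noteq> 0"
  then have h: "norm h < 1" "0 < norm h" by (auto simp: indicator_def split: if_splits)
  define L where "L = - log 2 (norm h)"
  have L0: "0 < L" using h by (simp add: L_def)
  \<comment> \<open>Ceiling minus one rather than floor: the covering balls are open, so
    \<open>norm h < (1/2) ^ k\<close> needs \<open>k < L\<close> strictly, also for integral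
    \<open>L\<close>.\<close>
  define k where "k = nat (\<lceil>L\<rceil> - 1)"
  have k: "real k < L" "L \<le> real k + 1"
    unfolding k_def using L0 by (simp_all add: of_nat_nat) linarith+
  have nh: "norm h = 2 powr - L" using h by (simp add: L_def)
  have "norm h < 2 powr (- real k)" unfolding nh using k by simp
  then have 1: "norm h < (1/2) ^ k" by (simp add: powr_minus powr_realpow power_one_over divide_simps)
  have "norm h powr p = 2 powr (- L * p)" unfolding nh by (simp add: powr_powr)
  \<comment> \<open>The sign of \<open>p\<close> is free here; \<open>2 powr \<bar>p\<bar>\<close>
    absorbs the variation of the power across one shell in either case.\<close>
  also have "\<dots> \<le> 2 powr (\<bar>p\<bar> + - p * real k)"
  proof (rule powr_mono)
    have "\<bar>L - real k\<bar> * \<bar>p\<bar> \<le> 1 * \<bar>p\<bar>" using k by (intro mult_right_mono) auto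
    then have "\<bar>(L - real k) * p\<bar> \<le> \<bar>p\<bar>" by (simp add: abs_mult)
    then show "- L * p \<le> \<bar>p\<bar> + - p * real k" by (simp add: algebra_simps abs_le_iff)
  qed simp
  also have "\<dots> = 2 powr \<bar>p\<bar> * (2 powr - p) ^ k"
    unfolding powr_add by (simp add: powr_powr powr_realpow[symmetric])
  finally show "\<exists>k. norm h < (1/2) ^ k \<and>
      norm h powr p * indicator {..<1} (norm h) \<le> 2 powr \<bar>p\<bar> * (2 powr - p) ^ k"
    using 1 h by (intro exI[of _ k]) simp
next
  fix k
  show "2 powr \<bar>p\<bar> * (2 powr - p) ^ k * ((1/2) ^ k) ^ DIM('a) \<le> 2 powr \<bar>p\<bar> * (2 powr - (p + real DIM('a))) ^ k"
    by (simp add: powr_add powr_diff powr_minus powr_realpow power_mult_distrib power_divide power_mult[symmetric] mult.commute divide_simps)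
next
  show "2 powr - (p + real DIM('a)) < 1"
    using assms powr_less_mono[of "- (p + real DIM('a))" 0 2] by simp
qed auto

text \<open>Dominates every integrand below: quadratic smallness near the diagonal tames the singularity,
  and growth of order \<open>s\<close> is integrable at infinity.\<close>

definition kern_maj :: "real \<Rightarrow> 'a::euclidean_space \<Rightarrow> real" where
  "kern_maj s h = min ((norm h)\<^sup>2) (norm h powr s) * frac_kernel s h"

lemma kern_maj_nonneg: "0 \<le> kern_maj s h"
  by (simp add: kern_maj_def frac_kernel_nonneg)

lemma kern_maj_measurable [measurable]: "kern_maj s \<in> borel_measurable borel"
  unfolding kern_maj_def by measurable

text \<open>With \<open>n\<close> the dimension, the exponent at the origin exceeds
  \<open>- n\<close> by \<open>2 - 2 * s\<close> and the exponent at infinity lies below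
  \<open>- n\<close> by \<open>s\<close>; this is where \<open>s < 1\<close> and
  \<open>0 < s\<close> enter.\<close>

lemma integrable_kern_maj:
  assumes "0 < s" "s < 1"
  shows "integrable lborel (kern_maj s :: 'a::euclidean_space \<Rightarrow> real)"
proof (rule integrableI_nonneg)
  let ?n = "real DIM('a)"
  have le: "kern_maj s h \<le> norm h powr (2 - 2 * s - ?n) * indicator {..<1} (norm h)
      + norm h powr (- s - ?n) * indicator {1..} (norm h)" for h :: 'a
  proof (cases "h = 0")
    case True then show ?thesis by (simp add: kern_maj_def frac_kernel_def)
  next
    case False
    then have h: "0 < norm h" by simp
    have k: "frac_kernel s h = norm h powr - (?n + 2 * s)"
      unfolding frac_kernel_def powr_minus by (simp add: divide_inverse)
    have 2: "(norm h)\<^sup>2 = norm h powr 2" using h by (simp add: powr_numeral)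
    have a: "(norm h)\<^sup>2 * frac_kernel s h = norm h powr (2 - 2 * s - ?n)"
      unfolding k 2 powr_add[symmetric] by (simp add: algebra_simps)
    have b: "norm h powr s * frac_kernel s h = norm h powr (- s - ?n)"
      unfolding k powr_add[symmetric] by (simp add: algebra_simps)
    have "kern_maj s h \<le> (norm h)\<^sup>2 * frac_kernel s h" "kern_maj s h \<le> norm h powr s * frac_kernel s h"
      unfolding kern_maj_def by (intro mult_right_mono frac_kernel_nonneg; simp)+
    then show ?thesis unfolding a b by (cases "norm h < 1") auto
  qed
  have "(\<integral>\<^sup>+ h. ennreal (kern_maj s h) \<partial>(lborel :: 'a measure)) \<le>
     (\<integral>\<^sup>+ h. ennreal (norm h powr (2 - 2 * s - ?n) * indicator {..<1} (norm h))
      + ennreal (norm h powr (- s - ?n) * indicator {1..} (norm h)) \<partial>(lborel :: 'a measure))"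
    using le by (intro nn_integral_mono) (simp add: ennreal_plus[symmetric] ennreal_leI del: ennreal_plus)
  also have "\<dots> = (\<integral>\<^sup>+ h. ennreal (norm h powr (2 - 2 * s - ?n) * indicator {..<1} (norm h)) \<partial>(lborel :: 'a measure))
      + (\<integral>\<^sup>+ h. ennreal (norm h powr (- s - ?n) * indicator {1..} (norm h)) \<partial>(lborel :: 'a measure))"
    by (rule nn_integral_add) (auto intro!: measurable_compose[OF _ measurable_ennreal])
  also have "\<dots> < \<infinity>"
    using nn_integral_norm_powr_inside_finite[where p = "2 - 2 * s - ?n" and 'a='a]
      nn_integral_norm_powr_outside_finite[where p = "- s - ?n" and 'a='a] assms
    by (simp add: less_top)
  finally show "(\<integral>\<^sup>+ h. ennreal (kern_maj s h) \<partial>(lborel :: 'a measure)) < \<infinity>" .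
qed (auto simp: kern_maj_nonneg)

lemma nn_integral_lborel_scaleR:
  fixes f :: "'a::euclidean_space \<Rightarrow> ennreal"
  assumes [measurable]: "f \<in> borel_measurable borel" and "r > 0"
  shows "(\<integral>\<^sup>+ h. f h \<partial>lborel) = ennreal (r ^ DIM('a)) * (\<integral>\<^sup>+ h. f (r *\<^sub>R h) \<partial>lborel)"
  by (subst lborel_affine[of r 0])
     (use \<open>r > 0\<close> in \<open>auto simp: nn_integral_density nn_integral_distr nn_integral_cmult\<close>)

lemma nn_integral_lborel_reflect:
  fixes f :: "'a::euclidean_space \<Rightarrow> ennreal"
  assumes [measurable]: "f \<in> borel_measurable borel"
  shows "(\<integral>\<^sup>+ y. f (x - y) \<partial>lborel) = (\<integral>\<^sup>+ h. f h \<partial>lborel)"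
  by (subst (2) lborel_affine[of "- 1" x])
     (auto simp: nn_integral_density nn_integral_distr nn_integral_cmult)

lemma nn_integral_lborel_translate:
  fixes f :: "'a::euclidean_space \<Rightarrow> ennreal"
  assumes [measurable]: "f \<in> borel_measurable borel"
  shows "(\<integral>\<^sup>+ y. f (y - x) \<partial>lborel) = (\<integral>\<^sup>+ h. f h \<partial>lborel)"
  by (subst (2) lborel_affine[of "1" "- x"])
     (auto simp: nn_integral_density nn_integral_distr nn_integral_cmult)

lemma frac_kernel_le_kern_maj:
  assumes "0 < s" "0 < c" "c \<le> norm h"
  shows "frac_kernel s h \<le> kern_maj s h / min (c\<^sup>2) (c powr s)"
proof -
  have m: "0 < min (c\<^sup>2) (c powr s)" using assms by simp
  have "min (c\<^sup>2) (c powr s) \<le> min ((norm h)\<^sup>2) (norm h powr s)"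
    using assms by (intro min.mono power_mono powr_mono2) auto
  then have "min (c\<^sup>2) (c powr s) * frac_kernel s h \<le> kern_maj s h"
    unfolding kern_maj_def by (intro mult_right_mono frac_kernel_nonneg)
  then show ?thesis using m by (simp add: field_simps)
qed

section \<open>Half-space tails and the one-dimensional marginal of the kernel\<close>

text \<open>Seen from a point at height \<open>r\<close>, this is the kernel mass of the opposite
  half-space, that is, up to normalization the fractional Laplacian of the half-space indicator at
  that point.\<close>

definition frac_kernel_tail :: "real \<Rightarrow> 'a::euclidean_space \<Rightarrow> real \<Rightarrow> ennreal" where
  "frac_kernel_tail s e r = (\<integral>\<^sup>+ h. ennreal (frac_kernel s h) * indicator {r<..} (e \<bullet> h) \<partial>lborel)"

lemma frac_kernel_tail_scale:
  fixes e :: "'a::euclidean_space"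
  assumes "r > 0"
  shows "frac_kernel_tail s e r = ennreal (r powr (- 2 * s)) * frac_kernel_tail s e 1"
proof -
  have "frac_kernel_tail s e r = ennreal (r ^ DIM('a)) *
     (\<integral>\<^sup>+ h. ennreal (frac_kernel s (r *\<^sub>R h)) * indicator {r<..} (e \<bullet> (r *\<^sub>R h)) \<partial>(lborel :: 'a measure))"
    unfolding frac_kernel_tail_def by (rule nn_integral_lborel_scaleR) (use assms in auto)
  also have "(\<lambda>h :: 'a. ennreal (frac_kernel s (r *\<^sub>R h)) * indicator {r<..} (e \<bullet> (r *\<^sub>R h)))
     = (\<lambda>h. ennreal (r powr - (real DIM('a) + 2 * s)) * (ennreal (frac_kernel s h) * indicator {1<..} (e \<bullet> h)))"
    using assms by (auto simp: fun_eq_iff frac_kernel_scaleR ennreal_mult frac_kernel_nonneg indicator_def mult.assoc)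
  also have "(\<integral>\<^sup>+ h. ennreal (r powr - (real DIM('a) + 2 * s)) * (ennreal (frac_kernel s h) * indicator {1<..} (e \<bullet> h)) \<partial>lborel)
     = ennreal (r powr - (real DIM('a) + 2 * s)) * frac_kernel_tail s e 1"
    unfolding frac_kernel_tail_def by (rule nn_integral_cmult) auto
  also have "ennreal (r ^ DIM('a)) * (ennreal (r powr - (real DIM('a) + 2 * s)) * frac_kernel_tail s e 1)
     = ennreal (r powr (- 2 * s)) * frac_kernel_tail s e 1"
  proof -
    have "r ^ DIM('a) * r powr - (real DIM('a) + 2 * s) = r powr (- 2 * s)"
      using assms by (simp add: powr_realpow[symmetric] powr_add[symmetric])
    then show ?thesis using assms by (simp add: ennreal_mult[symmetric] mult.assoc[symmetric])
  qed
  finally show ?thesis .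
qed

lemma nn_integral_kernel_far_finite:
  assumes "0 < s" "s < 1" "0 < c"
  shows "(\<integral>\<^sup>+ h. ennreal (frac_kernel s h) * indicator {c..} (norm h) \<partial>(lborel :: 'a::euclidean_space measure)) < \<infinity>"
proof -
  define m where "m = min (c\<^sup>2) (c powr s)"
  have "(\<integral>\<^sup>+ h. ennreal (frac_kernel s h) * indicator {c..} (norm h) \<partial>(lborel :: 'a measure))
      \<le> (\<integral>\<^sup>+ h. ennreal (kern_maj s h / m) \<partial>(lborel :: 'a measure))"
    using frac_kernel_le_kern_maj[where s=s and c=c and 'a='a] assms
    by (intro nn_integral_mono) (auto simp: indicator_def m_def intro!: ennreal_leI)
  also have "\<dots> < \<infinity>"
  proof -
    have "integrable lborel (\<lambda>h::'a. kern_maj s h / m)"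
      using integrable_kern_maj[OF assms(1,2), where 'a='a] by simp
    then show ?thesis
      using assms by (subst nn_integral_eq_integral) (auto simp: kern_maj_nonneg m_def)
  qed
  finally show ?thesis .
qed

lemma frac_kernel_tail_finite:
  fixes e :: "'a::euclidean_space"
  assumes "0 < s" "s < 1" "0 < r"
  shows "frac_kernel_tail s e r < \<infinity>"
proof (cases "e = 0")
  case True then show ?thesis using assms by (simp add: frac_kernel_tail_def)
next
  case False
  then have e: "0 < norm e" by simp
  have "frac_kernel_tail s e r \<le>
      (\<integral>\<^sup>+ h. ennreal (frac_kernel s h) * indicator {r / norm e..} (norm h) \<partial>(lborel :: 'a measure))"
    unfolding frac_kernel_tail_def
  proof (intro nn_integral_mono mult_left_mono)
    fix h :: 'a
    have "e \<bullet> h \<le> norm e * norm h" by (rule norm_cauchy_schwarz)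
    then show "indicator {r<..} (e \<bullet> h) \<le> (indicator {r / norm e..} (norm h) :: ennreal)"
      using e by (auto simp: indicator_def field_simps)
  qed auto
  also have "\<dots> < \<infinity>"
    using assms e by (intro nn_integral_kernel_far_finite) auto
  finally show ?thesis .
qed

text \<open>The factor \<open>2 * s\<close> normalizes the density so that its tail follows the
  scaling law of \<open>frac_kernel_tail\<close> with constant one; the constant relating the two
  measures is then the tail at \<open>1\<close>.\<close>

lemma nn_integral_powr_tail:
  fixes s r :: real
  assumes "0 < s" "0 < r"
  shows "(\<integral>\<^sup>+ t. ennreal (2 * s * t powr (- 1 - 2 * s)) * indicator {r<..} t \<partial>lborel) = ennreal (r powr (- 2 * s))"
proof -
  have "(\<integral>\<^sup>+ t. ennreal (2 * s * t powr (- 1 - 2 * s)) * indicator {r<..} t \<partial>lborel)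
     = (\<integral>\<^sup>+ t. ennreal (2 * s * t powr (- 1 - 2 * s)) * indicator {r..} t \<partial>lborel)"
    by (intro nn_integral_cong_AE eventually_mono[OF AE_lborel_singleton[of r]]) (auto simp: indicator_def)
  also have "\<dots> = ennreal (0 - - (r powr (- 2 * s)))"
  proof (rule nn_integral_FTC_atLeast)
    show "((\<lambda>t. - (t powr (- 2 * s))) has_real_derivative 2 * s * t powr (- 1 - 2 * s)) (at t)"
      if "r \<le> t" for t
      using that assms by (auto intro!: derivative_eq_intros simp: algebra_simps minus_diff_commute)
    show "((\<lambda>t. - (t powr (- 2 * s))) \<longlongrightarrow> 0) at_top"
      using assms by real_asymp
  qed (use assms in auto)
  finally show ?thesis by simp
qed

text \<open>The one-dimensional marginal of \<open>frac_kernel s\<close> is a multiple of \<open>t powr (-1 - 2 * s)\<close>: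
  by scaling, both measures have the same tails up to a constant.\<close>

lemma nn_integral_kernel_inner:
  fixes e :: "'a::euclidean_space"
  assumes [measurable]: "f \<in> borel_measurable borel" and s: "0 < s" "s < 1" and \<delta>: "0 < \<delta>"
  shows "(\<integral>\<^sup>+ h. f (e \<bullet> h) * indicator {\<delta><..} (e \<bullet> h) * ennreal (frac_kernel s h) \<partial>lborel) =
    frac_kernel_tail s e 1 * (\<integral>\<^sup>+ t. f t * indicator {\<delta><..} t * ennreal (2 * s * t powr (- 1 - 2 * s)) \<partial>lborel)"
proof -
  let ?C = "frac_kernel_tail s e 1"
  \<comment> \<open>The cut at \<open>\<delta>\<close> removes the singularity at height zero, so
    that all upper tails are finite and determine the measure.\<close>
  define M where "M = distr (density lborel (\<lambda>h. ennreal (frac_kernel s h) * indicator {\<delta><..} (e \<bullet> h))) borel (\<lambda>h. e \<bullet> h)"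
  define N where "N = density lborel (\<lambda>t. ?C * (indicator {\<delta><..} t * ennreal (2 * s * t powr (- 1 - 2 * s))))"
  have M: "emeasure M {x<..} = frac_kernel_tail s e (max x \<delta>)" for x
  proof -
    have "emeasure M {x<..} = (\<integral>\<^sup>+ h. ennreal (frac_kernel s h) * indicator {\<delta><..} (e \<bullet> h) * indicator {h. x < e \<bullet> h} h \<partial>lborel)"
      unfolding M_def by (subst emeasure_distr) (auto simp: emeasure_density vimage_def)
    also have "\<dots> = frac_kernel_tail s e (max x \<delta>)"
      unfolding frac_kernel_tail_def by (intro nn_integral_cong) (auto simp: indicator_def)
    finally show ?thesis .
  qed
  have N: "emeasure N {x<..} = ?C * ennreal (max x \<delta> powr (- 2 * s))" for x
  proof -
    have "emeasure N {x<..} = (\<integral>\<^sup>+ t. ?C * (ennreal (2 * s * t powr (- 1 - 2 * s)) * indicator {max x \<delta><..} t) \<partial>lborel)"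
      unfolding N_def by (subst emeasure_density) (auto intro!: nn_integral_cong simp: indicator_def)
    also have "\<dots> = ?C * ennreal (max x \<delta> powr (- 2 * s))"
      using s \<delta> by (subst nn_integral_cmult) (auto simp: nn_integral_powr_tail)
    finally show ?thesis .
  qed
  have eq: "M = N"
  proof (rule measure_eqI_lessThan)
    show "emeasure M {x<..} < \<infinity>" for x
      unfolding M using s \<delta> by (intro frac_kernel_tail_finite) auto
    show "emeasure M {x<..} = emeasure N {x<..}" for x
      unfolding M N using \<delta> by (subst frac_kernel_tail_scale) (auto simp: mult.commute)
  qed (auto simp: M_def N_def)
  have "(\<integral>\<^sup>+ h. f (e \<bullet> h) * indicator {\<delta><..} (e \<bullet> h) * ennreal (frac_kernel s h) \<partial>lborel) = (\<integral>\<^sup>+ t. f t \<partial>M)"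
    unfolding M_def by (simp add: nn_integral_distr nn_integral_density mult_ac)
  also have "\<dots> = (\<integral>\<^sup>+ t. ?C * (f t * indicator {\<delta><..} t * ennreal (2 * s * t powr (- 1 - 2 * s))) \<partial>lborel)"
    unfolding eq N_def by (simp add: nn_integral_density mult_ac)
  also have "\<dots> = ?C * (\<integral>\<^sup>+ t. f t * indicator {\<delta><..} t * ennreal (2 * s * t powr (- 1 - 2 * s)) \<partial>lborel)"
    by (rule nn_integral_cmult) auto
  finally show ?thesis .
qed

section \<open>Superharmonicity of the half-space barrier\<close>

text \<open>This expresses that \<open>x\<^sub>+\<^sup>s\<close> is \<open>s\<close>-harmonic at \<open>1\<close>. The substitution \<open>t = q / (1 - q)\<close> (inversion at \<open>1\<close>)
  turns the outer integrand into the inner one plus the derivative of \<open>(1 - (1 - q)\<^sup>s)\<^sup>2 / q\<^bsup>2 s\<^esup>\<close>, which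
  increases by at most 1; the final 1 is the contribution of the negative half-line.\<close>

lemma half_line_power_balance:
  fixes s \<epsilon> :: real
  assumes s: "0 < s" "s < 1" and \<epsilon>: "0 < \<epsilon>" "\<epsilon> < 1 / 2"
  shows "(\<integral>\<^sup>+ t. ennreal ((1 + t) powr s - 1) * indicator {\<epsilon> / (1 - \<epsilon>)..(1 - \<epsilon>) / \<epsilon>} t
            * ennreal (2 * s * t powr (- 1 - 2 * s)) \<partial>lborel)
     \<le> (\<integral>\<^sup>+ t. ennreal (1 - (1 - t) powr s) * indicator {\<epsilon>..1 - \<epsilon>} t
            * ennreal (2 * s * t powr (- 1 - 2 * s)) \<partial>lborel) + 1"
proof -
  define g where "g = (\<lambda>q::real. q / (1 - q))"
  define f where "f = (\<lambda>t. ((1 + t) powr s - 1) * (2 * s * t powr (- 1 - 2 * s)))"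
  define fin where "fin = (\<lambda>q. (1 - (1 - q) powr s) * (2 * s * q powr (- 1 - 2 * s)))"
  define G where "G = (\<lambda>q. (1 - (1 - q) powr s)\<^sup>2 * q powr (- 2 * s))"
  define G' where "G' = (\<lambda>q. (1 - (1 - q) powr s) * ((1 - q) powr (s - 1) - 1) * (2 * s * q powr (- 1 - 2 * s)))"
  have g: "g \<epsilon> = \<epsilon> / (1 - \<epsilon>)" "g (1 - \<epsilon>) = (1 - \<epsilon>) / \<epsilon>" by (auto simp: g_def)
  have ab: "\<epsilon> \<le> 1 - \<epsilon>" using \<epsilon> by simp
  have "(\<integral>\<^sup>+ t. ennreal ((1 + t) powr s - 1) * indicator {\<epsilon> / (1 - \<epsilon>)..(1 - \<epsilon>) / \<epsilon>} t
            * ennreal (2 * s * t powr (- 1 - 2 * s)) \<partial>lborel)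
     = (\<integral>\<^sup>+ t. f t * indicator {g \<epsilon>..g (1 - \<epsilon>)} t \<partial>lborel)"
  proof (intro nn_integral_cong)
    fix t
    have "0 \<le> t" "1 \<le> (1 + t) powr s" if "\<epsilon> / (1 - \<epsilon>) \<le> t"
    proof -
      have "0 < \<epsilon> / (1 - \<epsilon>)" using \<epsilon> by simp
      then show "0 \<le> t" using that by linarith
      then show "1 \<le> (1 + t) powr s" using s by (intro ge_one_powr_ge_zero) auto
    qed
    then show "ennreal ((1 + t) powr s - 1) * indicator {\<epsilon> / (1 - \<epsilon>)..(1 - \<epsilon>) / \<epsilon>} t
            * ennreal (2 * s * t powr (- 1 - 2 * s)) = ennreal (f t * indicator {g \<epsilon>..g (1 - \<epsilon>)} t)"
      using s unfolding g f_def by (auto simp: indicator_def ennreal_mult)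
  qed
  also have "\<dots> = (\<integral>\<^sup>+ q. f (g q) * (1 / (1 - q)\<^sup>2) * indicator {\<epsilon>..1 - \<epsilon>} q \<partial>lborel)"
  proof (rule nn_integral_substitution)
    show "(g has_real_derivative 1 / (1 - q)\<^sup>2) (at q)" if "q \<in> {\<epsilon>..1 - \<epsilon>}" for q
      unfolding g_def using that \<epsilon> by (auto intro!: derivative_eq_intros simp: power2_eq_square)
    show "continuous_on {\<epsilon>..1 - \<epsilon>} (\<lambda>q. 1 / (1 - q)\<^sup>2)"
      using \<epsilon> by (intro continuous_intros) auto
    show "set_borel_measurable borel {g \<epsilon>..g (1 - \<epsilon>)} f"
      unfolding set_borel_measurable_def f_def by measurable
  qed (use ab in auto)
  also have "\<dots> = (\<integral>\<^sup>+ q. ennreal (fin q) * indicator {\<epsilon>..1 - \<epsilon>} q + ennreal (G' q) * indicator {\<epsilon>..1 - \<epsilon>} q \<partial>lborel)"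
  proof (intro nn_integral_cong)
    fix q
    have "f (g q) * (1 / (1 - q)\<^sup>2) = fin q + G' q \<and> 0 \<le> fin q \<and> 0 \<le> G' q" if q: "q \<in> {\<epsilon>..1 - \<epsilon>}"
    proof (intro conjI)
      have q01: "0 < q" "0 < 1 - q" using q \<epsilon> by auto
      define p where "p = 1 - q"
      have p: "0 < p" "p < 1" using q01 by (auto simp: p_def)
      have 1: "1 + g q = inverse p" unfolding g_def p_def using q01 by (simp add: field_simps)
      have gq: "g q = q * inverse p" unfolding g_def p_def by (simp add: field_simps)
      have ps: "p powr s \<le> 1" using p s by (simp add: powr_le1)
      have ps1: "1 \<le> p powr (s - 1)"
        using powr_mono2'[of "s - 1" p 1] p s by simp
      show "0 \<le> fin q" using ps s unfolding fin_def p_def by simp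
      show "0 \<le> G' q" using ps ps1 s unfolding G'_def p_def by simp
      have inv: "inverse p = p powr (- 1)" using p by (simp add: powr_minus)
      have A: "(1 + g q) powr s = p powr - s"
        unfolding 1 inv powr_powr by simp
      have B: "g q powr (- 1 - 2 * s) = q powr (- 1 - 2 * s) * p powr (1 + 2 * s)"
      proof -
        have "inverse p powr (- 1 - 2 * s) = p powr (1 + 2 * s)"
          unfolding inv powr_powr by (simp add: add.commute)
        then show ?thesis unfolding gq using p q01 by (simp add: powr_mult)
      qed
      have C: "1 / (1 - q)\<^sup>2 = p powr (- 2)"
        using p by (simp add: p_def powr_minus powr_numeral divide_inverse)
      have D: "p powr (1 + 2 * s) * p powr (- 2) = p powr (2 * s - 1)"
        by (simp add: powr_add[symmetric])
      have E: "p powr - s * p powr (2 * s - 1) = p powr (s - 1)" by (simp add: powr_add[symmetric])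
      have F: "p powr s * p powr (s - 1) = p powr (2 * s - 1)" by (simp add: powr_add[symmetric])
      have "f (g q) * (1 / (1 - q)\<^sup>2) = (p powr - s - 1) * (2 * s * q powr (- 1 - 2 * s)) * (p powr (1 + 2 * s) * p powr (- 2))"
        unfolding f_def A B C by (simp add: mult_ac)
      also have "\<dots> = (p powr (s - 1) - p powr (2 * s - 1)) * (2 * s * q powr (- 1 - 2 * s))"
        unfolding D using E by (simp add: algebra_simps)
      also have "\<dots> = fin q + G' q"
        unfolding fin_def G'_def p_def[symmetric] F[symmetric] by (simp add: algebra_simps)
      finally show "f (g q) * (1 / (1 - q)\<^sup>2) = fin q + G' q" .
    qed
    then show "ennreal (f (g q) * (1 / (1 - q)\<^sup>2) * indicator {\<epsilon>..1 - \<epsilon>} q)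
        = ennreal (fin q) * indicator {\<epsilon>..1 - \<epsilon>} q + ennreal (G' q) * indicator {\<epsilon>..1 - \<epsilon>} q"
      by (auto simp: indicator_def)
  qed
  also have "\<dots> = (\<integral>\<^sup>+ q. ennreal (fin q) * indicator {\<epsilon>..1 - \<epsilon>} q \<partial>lborel)
      + (\<integral>\<^sup>+ q. ennreal (G' q) * indicator {\<epsilon>..1 - \<epsilon>} q \<partial>lborel)"
    unfolding fin_def G'_def by (rule nn_integral_add) auto
  also have "(\<integral>\<^sup>+ q. ennreal (G' q) * indicator {\<epsilon>..1 - \<epsilon>} q \<partial>lborel) = ennreal (G (1 - \<epsilon>) - G \<epsilon>)"
  proof (rule nn_integral_FTC_Icc)
    show "G' \<in> borel_measurable borel" unfolding G'_def by measurable
    fix q assume "q \<in> {\<epsilon>..1 - \<epsilon>}"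
    then have q01: "0 < q" "0 < 1 - q" using \<epsilon> by auto
    have ps: "(1 - q) powr s \<le> 1" using q01 s by (simp add: powr_le1)
    have ps1: "1 \<le> (1 - q) powr (s - 1)"
      using powr_mono2'[of "s - 1" "1 - q" 1] q01 s by simp
    show "0 \<le> G' q" using ps ps1 s unfolding G'_def by simp
    have e1: "q powr (- 2 * s) = q * q powr (- 1 - 2 * s)"
      using q01 powr_add[of q 1 "- 1 - 2 * s"] by simp
    have e2: "(1 - q) powr s = (1 - q) * (1 - q) powr (s - 1)"
      using q01 powr_add[of "1 - q" 1 "s - 1"] by simp
    have "(G has_real_derivative
        2 * (1 - (1 - q) powr s) * (s * (1 - q) powr (s - 1)) * q powr (- 2 * s)
        + (1 - (1 - q) powr s)\<^sup>2 * ((- 2 * s) * q powr (- 2 * s - 1))) (at q)"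
      unfolding G_def using q01 by (auto intro!: derivative_eq_intros)
    also have "2 * (1 - (1 - q) powr s) * (s * (1 - q) powr (s - 1)) * q powr (- 2 * s)
        + (1 - (1 - q) powr s)\<^sup>2 * ((- 2 * s) * q powr (- 2 * s - 1)) = G' q"
    proof -
      have e3: "- 2 * s - 1 = - 1 - 2 * s" by simp
      define X where "X = q powr (- 1 - 2 * s)"
      define Y where "Y = (1 - q) powr (s - 1)"
      show ?thesis unfolding G'_def e3 e1 e2 X_def[symmetric] Y_def[symmetric]
        by (simp add: algebra_simps power2_eq_square)
    qed
    finally show "(G has_real_derivative G' q) (at q)" .
  qed (use ab in auto)
  also have "ennreal (G (1 - \<epsilon>) - G \<epsilon>) \<le> 1"
  proof -
    \<comment> \<open>Since \<open>s < 1\<close>, powers of numbers in the unit interval increase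
      when the exponent drops from 1 to \<open>s\<close>. Hence \<open>1 - \<epsilon> powr s \<le> 1
      - \<epsilon> \<le> (1 - \<epsilon>) powr s\<close>, so \<open>G (1 - \<epsilon>)\<close> is at
      most 1, while \<open>G \<epsilon>\<close> is nonnegative.\<close>
    have "\<epsilon> powr s \<le> 1" "\<epsilon> \<le> \<epsilon> powr s" "1 - \<epsilon> \<le> (1 - \<epsilon>) powr s"
      using \<epsilon> s powr_mono'[of s 1 \<epsilon>] powr_mono'[of s 1 "1 - \<epsilon>"] by (auto intro: powr_le1)
    then have "0 \<le> 1 - \<epsilon> powr s" "1 - \<epsilon> powr s \<le> (1 - \<epsilon>) powr s" using \<epsilon> by auto
    then have "(1 - \<epsilon> powr s)\<^sup>2 \<le> ((1 - \<epsilon>) powr s)\<^sup>2" by (rule power_mono[rotated])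
    also have "\<dots> = (1 - \<epsilon>) powr (2 * s)" by (simp add: power2_eq_square powr_add[symmetric])
    finally have "G (1 - \<epsilon>) \<le> (1 - \<epsilon>) powr (2 * s) * (1 - \<epsilon>) powr (- 2 * s)"
      unfolding G_def by (auto intro: mult_right_mono)
    also have "\<dots> = 1" using \<epsilon> by (simp add: powr_add[symmetric])
    finally have "G (1 - \<epsilon>) - G \<epsilon> \<le> 1" by (simp add: G_def add_increasing2 algebra_simps)
    then show ?thesis by (simp add: ennreal_le_1)
  qed
  also have "(\<integral>\<^sup>+ q. ennreal (fin q) * indicator {\<epsilon>..1 - \<epsilon>} q \<partial>lborel)
     = (\<integral>\<^sup>+ t. ennreal (1 - (1 - t) powr s) * indicator {\<epsilon>..1 - \<epsilon>} t
            * ennreal (2 * s * t powr (- 1 - 2 * s)) \<partial>lborel)"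
  proof (intro nn_integral_cong)
    fix t
    have "(1 - t) powr s \<le> 1" if "t \<in> {\<epsilon>..1 - \<epsilon>}" using that \<epsilon> s by (intro powr_le1) auto
    then show "ennreal (fin t) * indicator {\<epsilon>..1 - \<epsilon>} t = ennreal (1 - (1 - t) powr s) * indicator {\<epsilon>..1 - \<epsilon>} t
            * ennreal (2 * s * t powr (- 1 - 2 * s))"
      using s unfolding fin_def by (auto simp: indicator_def ennreal_mult)
  qed
  finally show ?thesis by (simp add: add_left_mono)
qed

text \<open>Both integrands depend on \<open>h\<close> through \<open>e \<bullet> h\<close> and the
  kernel only, so the marginal formula multiplies the half-line balance by
  \<open>frac_kernel_tail s e 1\<close>. The vector \<open>e\<close> is not normalized, because the
  lemma is applied to a unit vector divided by the height of the base point.\<close>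

lemma half_space_power_balance:
  fixes e :: "'a::euclidean_space"
  assumes s: "0 < s" "s < 1" and \<epsilon>: "0 < \<epsilon>" "\<epsilon> < 1 / 2"
  shows "(\<integral>\<^sup>+ h. ennreal ((1 + e \<bullet> h) powr s - 1) * indicator {\<epsilon> / (1 - \<epsilon>)..(1 - \<epsilon>) / \<epsilon>} (e \<bullet> h)
            * ennreal (frac_kernel s h) \<partial>lborel)
     \<le> (\<integral>\<^sup>+ h. ennreal (1 - (1 - e \<bullet> h) powr s) * indicator {\<epsilon>..1 - \<epsilon>} (e \<bullet> h)
            * ennreal (frac_kernel s h) \<partial>lborel) + frac_kernel_tail s e 1" (is "?L \<le> ?R + _")
proof -
  \<comment> \<open>Both ranges of integration start at or above \<open>\<epsilon>\<close>, so the
    cut of the marginal formula at \<open>\<epsilon> / 2\<close> does not change the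
    integrals.\<close>
  have \<delta>: "0 < \<epsilon> / 2" "\<epsilon> \<le> \<epsilon> / (1 - \<epsilon>)" using \<epsilon> by (auto simp: field_simps)
  have drop: "indicator {\<epsilon> / 2<..} t * indicator A t = (indicator A t :: ennreal)"
    if "A \<subseteq> {\<epsilon>..}" for A and t :: real
    using that \<epsilon> by (auto simp: indicator_def)
  have push: "(\<integral>\<^sup>+ h. f (e \<bullet> h) * indicator A (e \<bullet> h) * ennreal (frac_kernel s h) \<partial>lborel)
      = frac_kernel_tail s e 1 * (\<integral>\<^sup>+ t. f t * indicator A t * ennreal (2 * s * t powr (- 1 - 2 * s)) \<partial>lborel)"
    if [measurable]: "f \<in> borel_measurable borel" "A \<in> sets borel" and A: "A \<subseteq> {\<epsilon>..}" for f A
  proof -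
    have eq: "f t * indicator A t * indicator {\<epsilon> / 2<..} t = f t * indicator A t" for t
      using drop[OF A, of t] by (simp add: mult.assoc mult.commute)
    show ?thesis
      using nn_integral_kernel_inner[of "\<lambda>t. f t * indicator A t" s "\<epsilon> / 2" e] s \<delta>
      unfolding eq by simp
  qed
  have "?L = frac_kernel_tail s e 1 * (\<integral>\<^sup>+ t. ennreal ((1 + t) powr s - 1) * indicator {\<epsilon> / (1 - \<epsilon>)..(1 - \<epsilon>) / \<epsilon>} t
            * ennreal (2 * s * t powr (- 1 - 2 * s)) \<partial>lborel)"
    by (rule push) (use \<delta> in auto)
  also have "\<dots> \<le> frac_kernel_tail s e 1 * ((\<integral>\<^sup>+ t. ennreal (1 - (1 - t) powr s) * indicator {\<epsilon>..1 - \<epsilon>} t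
            * ennreal (2 * s * t powr (- 1 - 2 * s)) \<partial>lborel) + 1)"
    by (intro mult_left_mono half_line_power_balance assms) auto
  also have "\<dots> = ?R + frac_kernel_tail s e 1"
    unfolding distrib_left by (subst push[symmetric]) auto
  finally show ?thesis .
qed

section \<open>From pointwise bounds on truncations to the bilinear form\<close>

text \<open>Exchanging \<open>x\<close> and \<open>y\<close> turns the \<open>\<phi> y\<close> half
  of the form into the \<open>\<phi> x\<close> half, because each \<open>S m\<close> is symmetric
  and \<open>k\<close> is even. So the form restricted to \<open>S m\<close> is twice an integral
  against \<open>\<phi> x\<close>, to which the pointwise bound applies; the full form follows by
  dominated convergence. The sign of \<open>c\<close> is free: the barrier is used with a
  nonnegative one, the bump with a nonpositive one.\<close>

lemma weak_form_ge:
  fixes w \<phi> k :: "'a::euclidean_space \<Rightarrow> real" and S :: "nat \<Rightarrow> ('a \<times> 'a) set"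
  assumes [measurable]: "w \<in> borel_measurable borel" "\<phi> \<in> borel_measurable borel" "k \<in> borel_measurable borel"
    and [measurable]: "\<And>m. S m \<in> sets borel"
    and k_even: "\<And>h. k (- h) = k h"
    and \<phi>: "integrable lborel \<phi>" "\<And>x. 0 \<le> \<phi> x"
    and S_sym: "\<And>m x y. (x, y) \<in> S m \<Longrightarrow> (y, x) \<in> S m"
    and cover: "\<And>x y. (w x - w y) * (\<phi> x - \<phi> y) \<noteq> 0 \<Longrightarrow> \<forall>\<^sub>F m in sequentially. (x, y) \<in> S m"
    and form: "integrable (lborel \<Otimes>\<^sub>M lborel) (\<lambda>(x, y). (w x - w y) * (\<phi> x - \<phi> y) * k (x - y))"
    and trunc: "\<And>m. integrable (lborel \<Otimes>\<^sub>M lborel) (\<lambda>(x, y). indicator (S m) (x, y) * (w x - w y) * \<phi> x * k (x - y))"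
    and pointwise: "\<And>m x. 0 < \<phi> x \<Longrightarrow> c \<le> (\<integral>y. indicator (S m) (x, y) * (w x - w y) * k (x - y) \<partial>lborel)"
  shows "2 * c * (\<integral>x. \<phi> x \<partial>lborel)
    \<le> (\<integral>(x, y). (w x - w y) * (\<phi> x - \<phi> y) * k (x - y) \<partial>(lborel \<Otimes>\<^sub>M lborel))"
proof -
  let ?LL = "lborel \<Otimes>\<^sub>M lborel :: ('a \<times> 'a) measure"
  define F where "F = (\<lambda>(x, y). (w x - w y) * (\<phi> x - \<phi> y) * k (x - y))"
  define T where "T = (\<lambda>m (x, y). indicator (S m) (x, y) * (w x - w y) * \<phi> x * k (x - y) :: real)"
  have kc: "k (x - y) = k (y - x)" for x y using k_even[of "x - y"] by simp
  have T: "integrable ?LL (T m)" for m using trunc unfolding T_def .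
  have T': "integrable ?LL (\<lambda>(x, y). T m (y, x))" for m
    by (rule lborel_pair.integrable_product_swap[OF T])
  have split: "indicator (S m) z * F z = T m z + (case z of (x, y) \<Rightarrow> T m (y, x))" for m z
  proof (cases z)
    case (Pair x y)
    have "(x, y) \<in> S m \<longleftrightarrow> (y, x) \<in> S m" using S_sym by blast
    then show ?thesis unfolding Pair F_def T_def using kc[of x y]
      by (auto simp: indicator_def algebra_simps)
  qed
  have lower: "2 * c * (\<integral>x. \<phi> x \<partial>lborel) \<le> (\<integral>z. indicator (S m) z * F z \<partial>?LL)" for m
  proof -
    have "(\<integral>z. indicator (S m) z * F z \<partial>?LL) = (\<integral>z. T m z \<partial>?LL) + (\<integral>z. (case z of (x, y) \<Rightarrow> T m (y, x)) \<partial>?LL)"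
      unfolding split using T T' by (rule Bochner_Integration.integral_add)
    also have "(\<integral>z. (case z of (x, y) \<Rightarrow> T m (y, x)) \<partial>?LL) = (\<integral>z. T m z \<partial>?LL)"
      by (rule lborel_pair.integral_product_swap) (use T in auto)
    also have "(\<integral>z. T m z \<partial>?LL) = (\<integral>x. \<integral>y. T m (x, y) \<partial>lborel \<partial>lborel)"
      by (rule lborel_pair.integral_fst'[symmetric]) (rule T)
    finally have eq: "(\<integral>z. indicator (S m) z * F z \<partial>?LL) = 2 * (\<integral>x. \<integral>y. T m (x, y) \<partial>lborel \<partial>lborel)"
      by simp
    have "(\<integral>x. c * \<phi> x \<partial>lborel) \<le> (\<integral>x. \<integral>y. T m (x, y) \<partial>lborel \<partial>lborel)"
    proof (rule integral_mono)
      show "integrable lborel (\<lambda>x. c * \<phi> x)" using \<phi> by simp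
      show "integrable lborel (\<lambda>x. \<integral>y. T m (x, y) \<partial>lborel)"
        by (rule lborel_pair.integrable_fst'[OF T])
      fix x
      have "(\<integral>y. T m (x, y) \<partial>lborel) = (\<integral>y. \<phi> x * (indicator (S m) (x, y) * (w x - w y) * k (x - y)) \<partial>lborel)"
        unfolding T_def by (intro Bochner_Integration.integral_cong) auto
      also have "\<dots> = \<phi> x * (\<integral>y. indicator (S m) (x, y) * (w x - w y) * k (x - y) \<partial>lborel)"
        by simp
      finally have e: "(\<integral>y. T m (x, y) \<partial>lborel) = \<dots>" .
      show "c * \<phi> x \<le> (\<integral>y. T m (x, y) \<partial>lborel)"
      proof (cases "\<phi> x = 0")
        case False
        then have "0 < \<phi> x" using \<phi>(2)[of x] by simp
        then show ?thesis unfolding e mult.commute[of c] by (intro mult_left_mono pointwise) auto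
      qed (simp add: e)
    qed
    then show ?thesis unfolding eq by simp
  qed
  have "(\<lambda>m. \<integral>z. indicator (S m) z * F z \<partial>?LL) \<longlonglongrightarrow> (\<integral>z. F z \<partial>?LL)"
  proof (rule integral_dominated_convergence[where w = "\<lambda>z. norm (F z)"])
    show "integrable ?LL (\<lambda>z. norm (F z))" using form unfolding F_def by (rule integrable_norm)
    show "AE z in ?LL. (\<lambda>m. indicator (S m) z * F z) \<longlonglongrightarrow> F z"
    proof (rule AE_I2)
      fix z :: "'a \<times> 'a"
      obtain x y where z: "z = (x, y)" by (cases z)
      show "(\<lambda>m. indicator (S m) z * F z) \<longlonglongrightarrow> F z"
      proof (cases "F z = 0")
        case False
        then have "\<forall>\<^sub>F m in sequentially. z \<in> S m"
          unfolding z by (intro cover) (auto simp: F_def)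
        then show ?thesis by (rule tendsto_eventually[OF eventually_mono]) simp
      qed simp
    qed
    show "F \<in> borel_measurable ?LL" unfolding F_def by measurable
    have "S m \<in> sets ?LL" for m using assms(4)[of m] unfolding lborel_prod by simp
    then show "(\<lambda>z. indicator (S m) z * F z) \<in> borel_measurable ?LL" for m
      using \<open>F \<in> borel_measurable ?LL\<close> by (intro borel_measurable_times borel_measurable_indicator)
    show "AE z in ?LL. norm (indicator (S m) z * F z) \<le> norm (F z)" for m
      by (rule AE_I2) (auto simp: indicator_def)
  qed
  then have "2 * c * (\<integral>x. \<phi> x \<partial>lborel) \<le> (\<integral>z. F z \<partial>?LL)"
    by (rule LIMSEQ_le_const) (use lower in auto)
  then show ?thesis unfolding F_def .
qed

lemma integrable_pair_times_diff:
  fixes f g :: "'a::euclidean_space \<Rightarrow> real"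
  assumes f: "integrable lborel f" and g: "integrable lborel g"
  shows "integrable (lborel \<Otimes>\<^sub>M lborel) (\<lambda>(x, y). f x * g (x - y))"
proof -
  have [measurable]: "f \<in> borel_measurable borel" "g \<in> borel_measurable borel"
    using assms by auto
  show ?thesis
  proof (rule integrableI_bounded)
    have "(\<integral>\<^sup>+ z. ennreal (norm (case z of (x, y) \<Rightarrow> f x * g (x - y))) \<partial>(lborel \<Otimes>\<^sub>M lborel))
       = (\<integral>\<^sup>+ x. \<integral>\<^sup>+ y. ennreal \<bar>f x\<bar> * ennreal \<bar>g (x - y)\<bar> \<partial>lborel \<partial>lborel)"
      by (subst lborel.nn_integral_fst[symmetric]) (auto simp: abs_mult ennreal_mult)
    also have "\<dots> = (\<integral>\<^sup>+ x. ennreal \<bar>f x\<bar> * (\<integral>\<^sup>+ h. ennreal \<bar>g h\<bar> \<partial>lborel) \<partial>lborel)"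
    proof (intro nn_integral_cong)
      fix x
      have "(\<integral>\<^sup>+ y. ennreal \<bar>f x\<bar> * ennreal \<bar>g (x - y)\<bar> \<partial>lborel) = ennreal \<bar>f x\<bar> * (\<integral>\<^sup>+ y. ennreal \<bar>g (x - y)\<bar> \<partial>lborel)"
        by (rule nn_integral_cmult) auto
      then show "(\<integral>\<^sup>+ y. ennreal \<bar>f x\<bar> * ennreal \<bar>g (x - y)\<bar> \<partial>lborel) = ennreal \<bar>f x\<bar> * (\<integral>\<^sup>+ h. ennreal \<bar>g h\<bar> \<partial>lborel)"
        using nn_integral_lborel_reflect[of "\<lambda>h. ennreal \<bar>g h\<bar>" x] by simp
    qed
    also have "\<dots> = (\<integral>\<^sup>+ x. ennreal \<bar>f x\<bar> \<partial>lborel) * (\<integral>\<^sup>+ h. ennreal \<bar>g h\<bar> \<partial>lborel)"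
      by (rule nn_integral_multc) auto
    also have "\<dots> < \<infinity>"
      using f g unfolding integrable_iff_bounded by (simp add: ennreal_mult_less_top)
    finally show "(\<integral>\<^sup>+ z. ennreal (norm (case z of (x, y) \<Rightarrow> f x * g (x - y))) \<partial>(lborel \<Otimes>\<^sub>M lborel)) < \<infinity>" .
  qed auto
qed

lemma sigma_finite_lebesgue: "sigma_finite_measure (lebesgue :: 'a::euclidean_space measure)"
proof
  obtain A :: "'a set set" where A: "countable A" "A \<subseteq> sets lborel" "\<Union> A = space lborel" "\<forall>a\<in>A. emeasure lborel a \<noteq> \<infinity>"
    using lborel.sigma_finite_countable by blast
  have "\<forall>a\<in>A. emeasure lebesgue a \<noteq> \<infinity>" using A(2,4) by auto
  then show "\<exists>A::'a set set. countable A \<and> A \<subseteq> sets lebesgue \<and> \<Union> A = space lebesgue \<and> (\<forall>a\<in>A. emeasure lebesgue a \<noteq> \<infinity>)"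
    using A by (intro exI[of _ A]) auto
qed

lemma measurable_id_lebesgue_borel: "(\<lambda>x. x) \<in> measurable lebesgue borel"
  by (rule measurable_completion) auto

text \<open>The energies live on the product of two completed measures. For a Borel integrand
  Tonelli reduces both sides to iterated integrals, and in each single integral the completion makes
  no difference.\<close>

lemma nn_integral_lebesgue_pair:
  fixes f :: "'a::euclidean_space \<times> 'b::euclidean_space \<Rightarrow> ennreal"
  assumes [measurable]: "f \<in> borel_measurable (borel \<Otimes>\<^sub>M borel)"
  shows "(\<integral>\<^sup>+ z. f z \<partial>(lebesgue \<Otimes>\<^sub>M lebesgue)) = (\<integral>\<^sup>+ z. f z \<partial>(lborel \<Otimes>\<^sub>M lborel))"
proof -
  interpret sigma_finite_measure "lebesgue :: 'b measure" by (rule sigma_finite_lebesgue)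
  have "fst \<in> (lebesgue :: 'a measure) \<Otimes>\<^sub>M (lebesgue :: 'b measure) \<rightarrow>\<^sub>M borel"
     "snd \<in> (lebesgue :: 'a measure) \<Otimes>\<^sub>M (lebesgue :: 'b measure) \<rightarrow>\<^sub>M borel"
    by (rule measurable_compose[OF measurable_fst measurable_id_lebesgue_borel],
        rule measurable_compose[OF measurable_snd measurable_id_lebesgue_borel])
  then have "(\<lambda>z. (fst z, snd z)) \<in> (lebesgue :: 'a measure) \<Otimes>\<^sub>M (lebesgue :: 'b measure) \<rightarrow>\<^sub>M borel \<Otimes>\<^sub>M borel"
    by (rule measurable_Pair)
  then have "f \<in> borel_measurable (lebesgue \<Otimes>\<^sub>M lebesgue)"
    using measurable_compose[OF _ assms] by simp
  then have "(\<integral>\<^sup>+ z. f z \<partial>(lebesgue \<Otimes>\<^sub>M lebesgue)) = (\<integral>\<^sup>+ x. \<integral>\<^sup>+ y. f (x, y) \<partial>lebesgue \<partial>lebesgue)"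
    by (rule nn_integral_fst[symmetric])
  also have "\<dots> = (\<integral>\<^sup>+ x. \<integral>\<^sup>+ y. f (x, y) \<partial>lborel \<partial>lborel)"
    by (simp add: nn_integral_completion)
  also have "\<dots> = (\<integral>\<^sup>+ z. f z \<partial>(lborel \<Otimes>\<^sub>M lborel))"
    by (rule lborel.nn_integral_fst) auto
  finally show ?thesis .
qed

lemma integrable_lborel_reflect:
  fixes f :: "'a::euclidean_space \<Rightarrow> real"
  assumes f: "integrable lborel f"
  shows "integrable lborel (\<lambda>y. f (x - y))"
proof -
  have [measurable]: "f \<in> borel_measurable borel" using f by auto
  show ?thesis
    using f nn_integral_lborel_reflect[of "\<lambda>h. ennreal (norm (f h))" x]
    unfolding integrable_iff_bounded by simp
qed

lemma integrable_times_kernel_far: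
  fixes f :: "'a::euclidean_space \<Rightarrow> real"
  assumes s: "0 < s" "s < 1" and [measurable]: "f \<in> borel_measurable borel"
    and bound: "\<And>y. \<bar>f y\<bar> \<le> D" and "0 < c" and far: "\<And>y. f y \<noteq> 0 \<Longrightarrow> c \<le> norm (x - y)"
  shows "integrable lborel (\<lambda>y. f y * frac_kernel s (x - y))"
proof (rule Bochner_Integration.integrable_bound)
  show "integrable lborel (\<lambda>y. D / min (c\<^sup>2) (c powr s) * kern_maj s (x - y))"
    using integrable_lborel_reflect[OF integrable_kern_maj[OF s], of x] by simp
  have D: "0 \<le> D" using bound[of x] by simp
  show "AE y in lborel. norm (f y * frac_kernel s (x - y)) \<le> norm (D / min (c\<^sup>2) (c powr s) * kern_maj s (x - y))"
  proof (rule AE_I2)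
    fix y
    show "norm (f y * frac_kernel s (x - y)) \<le> norm (D / min (c\<^sup>2) (c powr s) * kern_maj s (x - y))"
    proof (cases "f y = 0")
      case False
      have "norm (f y * frac_kernel s (x - y)) = \<bar>f y\<bar> * frac_kernel s (x - y)"
        by (simp add: abs_mult frac_kernel_nonneg)
      also have "\<dots> \<le> D * (kern_maj s (x - y) / min (c\<^sup>2) (c powr s))"
        using far[OF False] s \<open>0 < c\<close> D
        by (intro mult_mono bound frac_kernel_le_kern_maj frac_kernel_nonneg) auto
      also have "\<dots> \<le> norm (D / min (c\<^sup>2) (c powr s) * kern_maj s (x - y))"
        using D by (simp add: kern_maj_nonneg)
      finally show ?thesis .
    qed simp
  qed
qed measurable

section \<open>The barrier and its truncated fractional Laplacian\<close>

definition half_space_barrier :: "'a::euclidean_space \<Rightarrow> real \<Rightarrow> real \<Rightarrow> real \<Rightarrow> 'a \<Rightarrow> real" where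
  "half_space_barrier e a b s x = (if 0 < e \<bullet> x then a + b * (e \<bullet> x) powr s else 0)"

lemma half_space_barrier_measurable [measurable]: "half_space_barrier e a b s \<in> borel_measurable borel"
  unfolding half_space_barrier_def by measurable

text \<open>Cutting off the ratio of the heights instead of the distance keeps the truncation symmetric in \<open>x\<close> and \<open>y\<close>
  and makes it invariant under inversion of the ratio, so that the truncated fractional Laplacian of the
  barrier has a sign for every \<open>\<epsilon>\<close>, with no error term.\<close>

definition ratio_cutoff :: "'a::euclidean_space \<Rightarrow> real \<Rightarrow> ('a \<times> 'a) set" where
  "ratio_cutoff e \<epsilon> = {(x, y). e \<bullet> x \<le> 0 \<or> e \<bullet> y \<le> 0 \<or>
      \<epsilon> * (e \<bullet> x) \<le> e \<bullet> y \<and> e \<bullet> y \<le> (1 - \<epsilon>) * (e \<bullet> x) \<or>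
      \<epsilon> * (e \<bullet> y) \<le> e \<bullet> x \<and> e \<bullet> x \<le> (1 - \<epsilon>) * (e \<bullet> y)}"

lemma ratio_cutoff_measurable [measurable]: "ratio_cutoff e \<epsilon> \<in> sets borel"
proof -
  have "closed (ratio_cutoff e \<epsilon>)"
    unfolding ratio_cutoff_def case_prod_beta
    by (intro closed_Collect_disj closed_Collect_conj closed_Collect_le continuous_intros)
  then show ?thesis by (rule borel_closed)
qed

text \<open>Let \<open>T\<close> be the tail at the height \<open>\<tau>\<close> of
  \<open>x\<close>. Points outside the half-space contribute at least
  \<open>(a + b * \<tau> powr s) * T\<close>; by the power balance the points inside cost at most
  \<open>b * \<tau> powr s * T\<close>, since the constant \<open>a\<close> cancels there. What
  remains is \<open>a * T\<close>.\<close>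

lemma half_space_barrier_ratio_cutoff_ge:
  fixes e x :: "'a::euclidean_space"
  assumes s: "0 < s" "s < 1" and e: "norm e = 1" and ab: "0 \<le> a" "0 \<le> b"
    and \<epsilon>: "0 < \<epsilon>" "\<epsilon> < 1 / 2" and x: "0 < e \<bullet> x"
  shows "a * enn2real (frac_kernel_tail s e (e \<bullet> x)) \<le>
    (\<integral>y. indicator (ratio_cutoff e \<epsilon>) (x, y)
        * (half_space_barrier e a b s x - half_space_barrier e a b s y) * frac_kernel s (x - y) \<partial>lborel)"
proof -
  define \<tau> where "\<tau> = e \<bullet> x"
  have \<tau>: "0 < \<tau>" using x by (simp add: \<tau>_def)
  define T where "T = frac_kernel_tail s e \<tau>"
  have Tfin: "T < \<infinity>" unfolding T_def using s \<tau> by (rule frac_kernel_tail_finite)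
  have e_le: "\<bar>\<tau> - e \<bullet> y\<bar> \<le> norm (x - y)" for y
    using Cauchy_Schwarz_ineq2[of e "x - y"] e by (simp add: \<tau>_def inner_diff_right)
  have e0: "\<tau> * \<epsilon> > 0" "\<tau> / \<epsilon> > 0" using \<tau> \<epsilon> by auto
  \<comment> \<open>\<open>A\<close> collects the points outside the half-space, \<open>B\<close>
    the lower points inside, where the barrier is at most its value at \<open>x\<close>, and
    \<open>C\<close> the higher ones, where it is at least that value; only \<open>C\<close> enters
    with a minus sign.\<close>
  define A where "A = (\<lambda>y. indicator {..0} (e \<bullet> y) * (a + b * \<tau> powr s))"
  define B where "B = (\<lambda>y. indicator {\<epsilon> * \<tau>..(1 - \<epsilon>) * \<tau>} (e \<bullet> y) * (b * (\<tau> powr s - (e \<bullet> y) powr s)))"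
  define C where "C = (\<lambda>y. indicator {\<tau> / (1 - \<epsilon>)..\<tau> / \<epsilon>} (e \<bullet> y) * (b * ((e \<bullet> y) powr s - \<tau> powr s)))"
  have [measurable]: "A \<in> borel_measurable borel" "B \<in> borel_measurable borel" "C \<in> borel_measurable borel"
    unfolding A_def B_def C_def by measurable
  have ineq: "(1 - \<epsilon>) * \<tau> < \<tau>" "\<tau> < \<tau> / (1 - \<epsilon>)" using \<tau> \<epsilon> by (auto simp: field_simps)
  have A0: "0 \<le> A y" for y using ab \<tau> by (auto simp: A_def indicator_def)
  have B0: "0 \<le> B y" for y
  proof (cases "B y = 0")
    case False
    then have y: "\<epsilon> * \<tau> \<le> e \<bullet> y" "e \<bullet> y \<le> (1 - \<epsilon>) * \<tau>" by (auto simp: B_def indicator_def split: if_splits)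
    moreover have "0 \<le> \<epsilon> * \<tau>" using e0 by (simp add: mult.commute)
    ultimately have "(e \<bullet> y) powr s \<le> \<tau> powr s" using ineq s by (intro powr_mono2) auto
    then show ?thesis using ab by (simp add: B_def)
  qed simp
  have C0: "0 \<le> C y" for y
    using ab \<tau> s ineq by (auto simp: C_def indicator_def intro!: mult_nonneg_nonneg powr_mono2)
  have decomp: "indicator (ratio_cutoff e \<epsilon>) (x, y)
        * (half_space_barrier e a b s x - half_space_barrier e a b s y) = A y + B y - C y" for y
  proof -
    define t where "t = e \<bullet> y"
    let ?I = "{\<epsilon> * \<tau>..(1 - \<epsilon>) * \<tau>}" and ?J = "{\<tau> / (1 - \<epsilon>)..\<tau> / \<epsilon>}"
    have c1: "\<epsilon> * t \<le> \<tau> \<longleftrightarrow> t \<le> \<tau> / \<epsilon>" "\<tau> \<le> (1 - \<epsilon>) * t \<longleftrightarrow> \<tau> / (1 - \<epsilon>) \<le> t"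
      using \<epsilon> by (simp_all add: pos_le_divide_eq pos_divide_le_eq mult.commute)
    have I: "0 < t \<and> t < \<tau>" if "t \<in> ?I"
    proof -
      have "0 < \<epsilon> * \<tau>" using e0 by (simp add: mult.commute)
      then show ?thesis using that ineq by (simp only: atLeastAtMost_iff) linarith
    qed
    have J: "\<tau> < t" if "t \<in> ?J" using that ineq unfolding atLeastAtMost_iff by linarith
    have mem: "(x, y) \<in> ratio_cutoff e \<epsilon> \<longleftrightarrow> t \<le> 0 \<or> t \<in> ?I \<or> t \<in> ?J"
      unfolding ratio_cutoff_def mem_Collect_eq case_prod_conv t_def[symmetric] \<tau>_def[symmetric] c1 atLeastAtMost_iff
      using \<tau> by linarith
    have ind: "indicator {..0} t = (if t \<le> 0 then 1 else 0 :: real)" by simp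
    show ?thesis
    proof (cases "(x, y) \<in> ratio_cutoff e \<epsilon>")
      case True
      then consider "t \<le> 0" "t \<notin> ?I" "t \<notin> ?J" | "t > 0" "t \<in> ?I" "t \<notin> ?J" | "t > 0" "t \<notin> ?I" "t \<in> ?J"
      proof -
        have "t \<in> ?I \<longrightarrow> 0 < t \<and> t \<notin> ?J" "t \<in> ?J \<longrightarrow> 0 < t"
          using I J less_asym less_trans[OF \<tau>] by blast+
        then show thesis using True that unfolding mem by (meson not_le)
      qed
      then show ?thesis
        using \<tau> True unfolding A_def B_def C_def half_space_barrier_def t_def[symmetric] \<tau>_def[symmetric] ind
        by cases (simp_all add: indicator_simps right_diff_distrib del: atLeastAtMost_iff)
    next
      case False
      then have "\<not> t \<le> 0" "t \<notin> ?I" "t \<notin> ?J" unfolding mem by auto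
      then show ?thesis using False
        unfolding A_def B_def C_def t_def[symmetric] ind by (simp add: indicator_simps del: atLeastAtMost_iff)
    qed
  qed
  have intA: "integrable lborel (\<lambda>y. A y * frac_kernel s (x - y))"
  proof (rule integrable_times_kernel_far[OF s, where c = \<tau> and D = "a + b * \<tau> powr s"])
    show "\<bar>A y\<bar> \<le> a + b * \<tau> powr s" for y using ab by (auto simp: A_def indicator_def)
    show "\<tau> \<le> norm (x - y)" if "A y \<noteq> 0" for y
      using that e_le[of y] by (auto simp: A_def indicator_def split: if_splits)
  qed (use \<tau> in auto)
  have intB: "integrable lborel (\<lambda>y. B y * frac_kernel s (x - y))"
  proof (rule integrable_times_kernel_far[OF s, where c = "\<tau> * \<epsilon>" and D = "b * \<tau> powr s"])
    show "\<bar>B y\<bar> \<le> b * \<tau> powr s" for y using ab B0[of y] by (simp add: B_def indicator_def right_diff_distrib)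
    show "\<tau> * \<epsilon> \<le> norm (x - y)" if "B y \<noteq> 0" for y
    proof -
      have "e \<bullet> y \<le> (1 - \<epsilon>) * \<tau>" using that by (auto simp: B_def indicator_def split: if_splits)
      then show ?thesis using e_le[of y] by (simp add: algebra_simps)
    qed
  qed (use e0 in auto)
  have intC: "integrable lborel (\<lambda>y. C y * frac_kernel s (x - y))"
  proof (rule integrable_times_kernel_far[OF s, where c = "\<tau> / (1 - \<epsilon>) - \<tau>" and D = "b * (\<tau> / \<epsilon>) powr s"])
    show "\<bar>C y\<bar> \<le> b * (\<tau> / \<epsilon>) powr s" for y
    proof (cases "C y = 0")
      case False
      then have y: "\<tau> / (1 - \<epsilon>) \<le> e \<bullet> y" "e \<bullet> y \<le> \<tau> / \<epsilon>" by (auto simp: C_def indicator_def split: if_splits)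
      have "C y \<le> b * (e \<bullet> y) powr s" using ab by (auto simp: C_def indicator_def algebra_simps)
      also have "\<dots> \<le> b * (\<tau> / \<epsilon>) powr s"
        using y ineq \<tau> s ab by (intro mult_left_mono powr_mono2) auto
      finally show ?thesis using C0[of y] by simp
    qed (use ab in simp)
    show "\<tau> / (1 - \<epsilon>) - \<tau> \<le> norm (x - y)" if "C y \<noteq> 0" for y
      using that e_le[of y] by (auto simp: C_def indicator_def split: if_splits)
  qed (use ineq in auto)
  have nnI: "(\<integral>\<^sup>+ y. ennreal (f y * frac_kernel s (x - y)) \<partial>lborel) = ennreal (\<integral>y. f y * frac_kernel s (x - y) \<partial>lborel)"
    "0 \<le> (\<integral>y. f y * frac_kernel s (x - y) \<partial>lborel)"
    if "integrable lborel (\<lambda>y. f y * frac_kernel s (x - y))" "\<And>y. 0 \<le> f y" for f :: "'a \<Rightarrow> real"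
    using that by (auto intro!: nn_integral_eq_integral Bochner_Integration.integral_nonneg mult_nonneg_nonneg frac_kernel_nonneg)
  \<comment> \<open>Dividing by the height moves \<open>x\<close> to height one, where the power
    balance is stated; the tail of \<open>e'\<close> at \<open>1\<close> is the tail of
    \<open>e\<close> at \<open>\<tau>\<close>.\<close>
  define e' where "e' = (1 / \<tau>) *\<^sub>R e"
  have tail': "frac_kernel_tail s e' 1 = T"
    unfolding frac_kernel_tail_def T_def e'_def using \<tau>
    by (intro nn_integral_cong) (auto simp: indicator_def field_simps)
  have nnC: "(\<integral>\<^sup>+ y. ennreal (C y * frac_kernel s (x - y)) \<partial>lborel) =
    ennreal (b * \<tau> powr s) * (\<integral>\<^sup>+ h. ennreal ((1 + e' \<bullet> h) powr s - 1) * indicator {\<epsilon> / (1 - \<epsilon>)..(1 - \<epsilon>) / \<epsilon>} (e' \<bullet> h)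
            * ennreal (frac_kernel s h) \<partial>lborel)" (is "_ = _ * (\<integral>\<^sup>+ h. ?fC h \<partial>lborel)")
  proof -
    have "(\<integral>\<^sup>+ y. ennreal (C y * frac_kernel s (x - y)) \<partial>lborel) = (\<integral>\<^sup>+ y. ennreal (b * \<tau> powr s) * ?fC (y - x) \<partial>lborel)"
    proof (intro nn_integral_cong)
      fix y
      define t where "t = (e \<bullet> y) / \<tau>"
      have t: "e' \<bullet> (y - x) = t - 1" unfolding e'_def t_def using \<tau> by (simp add: inner_diff_right \<tau>_def[symmetric] field_simps)
      have ey: "e \<bullet> y = \<tau> * t" unfolding t_def using \<tau> by simp
      have ind: "indicator {\<epsilon> / (1 - \<epsilon>)..(1 - \<epsilon>) / \<epsilon>} (t - 1) = (indicator {\<tau> / (1 - \<epsilon>)..\<tau> / \<epsilon>} (\<tau> * t) :: 'b::zero_neq_one)"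
      proof -
        have "\<epsilon> / (1 - \<epsilon>) = 1 / (1 - \<epsilon>) - 1" "(1 - \<epsilon>) / \<epsilon> = 1 / \<epsilon> - 1"
          using \<epsilon> by (simp_all add: field_simps)
        moreover have "\<tau> / (1 - \<epsilon>) = \<tau> * (1 / (1 - \<epsilon>))" "\<tau> / \<epsilon> = \<tau> * (1 / \<epsilon>)" by simp_all
        ultimately show ?thesis
          using \<tau> by (simp only: indicator_def atLeastAtMost_iff mult_le_cancel_left_pos) simp
      qed
      show "ennreal (C y * frac_kernel s (x - y)) = ennreal (b * \<tau> powr s) * ?fC (y - x)"
      proof (cases "\<tau> * t \<in> {\<tau> / (1 - \<epsilon>)..\<tau> / \<epsilon>}")
        case True
        then have t1: "1 \<le> t" using ineq \<tau> by (auto dest: less_le_trans)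
        have "C y = (b * \<tau> powr s) * (t powr s - 1)"
          unfolding C_def ey using True \<tau> t1 by (simp add: powr_mult algebra_simps)
        moreover have "1 \<le> t powr s" using t1 s by (intro ge_one_powr_ge_zero) auto
        ultimately show ?thesis unfolding t ind frac_kernel_commute[of s x y]
          using True ab by (simp add: ennreal_mult[symmetric] frac_kernel_nonneg mult.assoc)
      qed (simp add: t ind, simp add: C_def ey)
    qed
    also have "\<dots> = ennreal (b * \<tau> powr s) * (\<integral>\<^sup>+ y. ?fC (y - x) \<partial>lborel)"
      by (rule nn_integral_cmult) auto
    also have "(\<integral>\<^sup>+ y. ?fC (y - x) \<partial>lborel) = (\<integral>\<^sup>+ h. ?fC h \<partial>lborel)"
      by (rule nn_integral_lborel_translate) auto
    finally show ?thesis .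
  qed
  have nnB: "(\<integral>\<^sup>+ y. ennreal (B y * frac_kernel s (x - y)) \<partial>lborel) =
    ennreal (b * \<tau> powr s) * (\<integral>\<^sup>+ h. ennreal (1 - (1 - e' \<bullet> h) powr s) * indicator {\<epsilon>..1 - \<epsilon>} (e' \<bullet> h)
            * ennreal (frac_kernel s h) \<partial>lborel)" (is "_ = _ * (\<integral>\<^sup>+ h. ?fB h \<partial>lborel)")
  proof -
    have "(\<integral>\<^sup>+ y. ennreal (B y * frac_kernel s (x - y)) \<partial>lborel) = (\<integral>\<^sup>+ y. ennreal (b * \<tau> powr s) * ?fB (x - y) \<partial>lborel)"
    proof (intro nn_integral_cong)
      fix y
      define t where "t = (e \<bullet> y) / \<tau>"
      have t: "e' \<bullet> (x - y) = 1 - t" unfolding e'_def t_def using \<tau> by (simp add: inner_diff_right \<tau>_def[symmetric] field_simps)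
      have ey: "e \<bullet> y = \<tau> * t" unfolding t_def using \<tau> by simp
      have ind: "indicator {\<epsilon>..1 - \<epsilon>} (1 - t) = (indicator {\<epsilon> * \<tau>..(1 - \<epsilon>) * \<tau>} (\<tau> * t) :: 'b::zero_neq_one)"
        using \<epsilon> \<tau> by (auto simp: indicator_def mult.commute[of _ \<tau>])
      show "ennreal (B y * frac_kernel s (x - y)) = ennreal (b * \<tau> powr s) * ?fB (x - y)"
      proof (cases "\<tau> * t \<in> {\<epsilon> * \<tau>..(1 - \<epsilon>) * \<tau>}")
        case True
        then have t1: "0 < t" "t \<le> 1"
          using \<tau> \<epsilon> by (auto simp: mult.commute[of _ \<tau>])
        have "B y = (b * \<tau> powr s) * (1 - t powr s)"
          unfolding B_def ey using True \<tau> t1 by (simp add: powr_mult algebra_simps)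
        moreover have "t powr s \<le> 1" using t1 s by (intro powr_le1) auto
        ultimately show ?thesis unfolding t ind
          using True ab by (simp add: ennreal_mult[symmetric] frac_kernel_nonneg mult.assoc)
      qed (simp add: t ind, simp add: B_def ey)
    qed
    also have "\<dots> = ennreal (b * \<tau> powr s) * (\<integral>\<^sup>+ y. ?fB (x - y) \<partial>lborel)"
      by (rule nn_integral_cmult) auto
    also have "(\<integral>\<^sup>+ y. ?fB (x - y) \<partial>lborel) = (\<integral>\<^sup>+ h. ?fB h \<partial>lborel)"
      by (rule nn_integral_lborel_reflect) auto
    finally show ?thesis .
  qed
  have nnA: "ennreal (a + b * \<tau> powr s) * T \<le> (\<integral>\<^sup>+ y. ennreal (A y * frac_kernel s (x - y)) \<partial>lborel)"
  proof -
    have "ennreal (a + b * \<tau> powr s) * T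
      = ennreal (a + b * \<tau> powr s) * (\<integral>\<^sup>+ y. ennreal (frac_kernel s (x - y)) * indicator {\<tau><..} (e \<bullet> (x - y)) \<partial>lborel)"
      unfolding T_def frac_kernel_tail_def by (subst nn_integral_lborel_reflect) auto
    also have "\<dots> = (\<integral>\<^sup>+ y. ennreal (a + b * \<tau> powr s) * (ennreal (frac_kernel s (x - y)) * indicator {\<tau><..} (e \<bullet> (x - y))) \<partial>lborel)"
      by (rule nn_integral_cmult[symmetric]) auto
    also have "\<dots> \<le> (\<integral>\<^sup>+ y. ennreal (A y * frac_kernel s (x - y)) \<partial>lborel)"
      using ab by (intro nn_integral_mono)
        (auto simp: A_def indicator_def inner_diff_right \<tau>_def ennreal_mult frac_kernel_nonneg)
    finally show ?thesis .
  qed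
  let ?IA = "\<integral>y. A y * frac_kernel s (x - y) \<partial>lborel" and ?IB = "\<integral>y. B y * frac_kernel s (x - y) \<partial>lborel"
    and ?IC = "\<integral>y. C y * frac_kernel s (x - y) \<partial>lborel"
  obtain T' where T': "T = ennreal T'" "0 \<le> T'" using Tfin by (cases T) auto
  have CB: "?IC \<le> ?IB + b * \<tau> powr s * T'"
  proof -
    have "ennreal ?IC \<le> ennreal ?IB + ennreal (b * \<tau> powr s) * T"
      unfolding nnI(1)[OF intC C0, symmetric] nnI(1)[OF intB B0, symmetric] nnB nnC tail'[symmetric] distrib_left[symmetric]
      by (intro mult_left_mono half_space_power_balance s \<epsilon>) auto
    then have "ennreal ?IC \<le> ennreal (?IB + b * \<tau> powr s * T')"
      using ab T' nnI(2)[OF intB B0] by (simp add: ennreal_mult)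
    then show ?thesis
      using ab T' nnI(2)[OF intB B0] by (subst (asm) ennreal_le_iff) (auto intro!: add_nonneg_nonneg mult_nonneg_nonneg)
  qed
  have "ennreal ((a + b * \<tau> powr s) * T') \<le> ennreal ?IA"
    using nnA unfolding nnI(1)[OF intA A0] T'(1) using T'(2) ab by (simp add: ennreal_mult)
  then have "(a + b * \<tau> powr s) * T' \<le> ?IA"
    using nnI(2)[OF intA A0] by (subst (asm) ennreal_le_iff) auto
  then have "a * T' \<le> ?IA + ?IB - ?IC" using CB by (simp add: algebra_simps)
  also have "\<dots> = (\<integral>y. A y * frac_kernel s (x - y) + B y * frac_kernel s (x - y) - C y * frac_kernel s (x - y) \<partial>lborel)"
    using intA intB intC by simp
  also have "\<dots> = (\<integral>y. indicator (ratio_cutoff e \<epsilon>) (x, y)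
        * (half_space_barrier e a b s x - half_space_barrier e a b s y) * frac_kernel s (x - y) \<partial>lborel)"
    unfolding decomp by (simp add: algebra_simps)
  also have "a * T' = a * enn2real (frac_kernel_tail s e (e \<bullet> x))"
    using T' by (simp add: T_def \<tau>_def)
  finally show ?thesis .
qed

section \<open>Truncated bilinear forms\<close>

lemma integral_lborel_reflect:
  fixes f :: "'a::euclidean_space \<Rightarrow> real"
  assumes [measurable]: "f \<in> borel_measurable borel"
  shows "(\<integral>y. f (x - y) \<partial>lborel) = (\<integral>h. f h \<partial>lborel)"
proof -
  have "lborel = distr lborel borel (\<lambda>y. x - y)"
    using lborel_affine[of "- 1" x] by (simp add: density_1 one_ennreal_def[symmetric])
  then have "(\<integral>h. f h \<partial>lborel) = (\<integral>h. f h \<partial>distr lborel borel (\<lambda>y. x - y))" by simp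
  also have "\<dots> = (\<integral>y. f (x - y) \<partial>lborel)" by (rule integral_distr) auto
  finally show ?thesis by simp
qed

text \<open>Pairing \<open>h\<close> with \<open>- h\<close> cancels the first-order term, which is
  too singular for the kernel once \<open>s\<close> reaches 1/2, and leaves the second difference,
  bounded below by semiconvexity. The resulting bound does not involve \<open>c\<close>, as the
  passage to the limit in \<open>weak_form_ge\<close> requires.\<close>

lemma semiconvex_cutoff_ge:
  fixes \<eta> :: "'a::euclidean_space \<Rightarrow> real"
  assumes s: "0 < s" "s < 1" and [measurable]: "\<eta> \<in> borel_measurable borel"
    and bound: "\<And>y. \<bar>\<eta> y\<bar> \<le> D" and "0 < c" "0 \<le> K"
    and semiconvex: "\<And>h. - (K * min ((norm h)\<^sup>2) (norm h powr s)) \<le> \<eta> (x + h) + \<eta> (x - h) - 2 * \<eta> x"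
  shows "- (K / 2 * (\<integral>h. kern_maj s h \<partial>(lborel :: 'a measure)))
    \<le> (\<integral>y. indicator {(x, y). c \<le> norm (x - y)} (x, y) * (\<eta> y - \<eta> x) * frac_kernel s (x - y) \<partial>lborel)"
proof -
  define f where "f = (\<lambda>h. indicator {c..} (norm h) * (\<eta> (x - h) - \<eta> x) * frac_kernel s h)"
  have [measurable]: "f \<in> borel_measurable borel" unfolding f_def by measurable
  have "integrable lborel (\<lambda>h. indicator {c..} (norm h) * (\<eta> (x - h) - \<eta> x) * frac_kernel s (0 - h))"
  proof (rule integrable_times_kernel_far[OF s, where c = c and D = "2 * D"])
    fix h :: 'a
    have "\<bar>\<eta> (x - h) - \<eta> x\<bar> \<le> 2 * D" using bound[of "x - h"] bound[of x] by linarith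
    then show "\<bar>indicator {c..} (norm h) * (\<eta> (x - h) - \<eta> x)\<bar> \<le> 2 * D"
      by (auto simp: indicator_def)
  qed (use \<open>0 < c\<close> in \<open>auto simp: indicator_def split: if_splits\<close>)
  then have f: "integrable lborel f" unfolding f_def by simp
  have f': "integrable lborel (\<lambda>h. f (- h))"
    using integrable_lborel_reflect[OF f, of 0] by simp
  have "- (K * (\<integral>h. kern_maj s h \<partial>(lborel :: 'a measure))) = (\<integral>h. - (K * kern_maj s h) \<partial>(lborel :: 'a measure))"
    by simp
  also have "\<dots> \<le> (\<integral>h. f h + f (- h) \<partial>lborel)"
  proof (rule integral_mono)
    show "integrable lborel (\<lambda>h::'a. - (K * kern_maj s h))"
      using integrable_kern_maj[OF s, where 'a='a] by simp
    show "integrable lborel (\<lambda>h. f h + f (- h))" using f f' by simp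
    fix h :: 'a
    let ?d = "\<eta> (x + h) + \<eta> (x - h) - 2 * \<eta> x"
    have K: "0 \<le> K * min ((norm h)\<^sup>2) (norm h powr s)" using \<open>0 \<le> K\<close> by simp
    have "f h + f (- h) = indicator {c..} (norm h) * ?d * frac_kernel s h"
      unfolding f_def by (simp add: algebra_simps)
    moreover have "- (K * min ((norm h)\<^sup>2) (norm h powr s)) \<le> indicator {c..} (norm h) * ?d"
      using semiconvex[of h] K by (auto simp: indicator_def)
    from mult_right_mono[OF this frac_kernel_nonneg[of s h]]
    have "- (K * kern_maj s h) \<le> indicator {c..} (norm h) * ?d * frac_kernel s h"
      unfolding kern_maj_def by (simp add: mult.assoc)
    ultimately show "- (K * kern_maj s h) \<le> f h + f (- h)" by simp
  qed
  also have "\<dots> = (\<integral>h. f h \<partial>lborel) + (\<integral>h. f (- h) \<partial>lborel)" using f f' by simp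
  also have "(\<integral>h. f (- h) \<partial>lborel) = (\<integral>h. f h \<partial>lborel)"
    using integral_lborel_reflect[of f 0] by simp
  finally have "- (K / 2 * (\<integral>h. kern_maj s h \<partial>(lborel :: 'a measure))) \<le> (\<integral>h. f h \<partial>lborel)" by simp
  also have "\<dots> = (\<integral>y. f (x - y) \<partial>lborel)" by (rule integral_lborel_reflect[symmetric]) measurable
  also have "\<dots> = (\<integral>y. indicator {(x, y). c \<le> norm (x - y)} (x, y) * (\<eta> y - \<eta> x) * frac_kernel s (x - y) \<partial>lborel)"
    unfolding f_def by (intro Bochner_Integration.integral_cong) (auto simp: indicator_def)
  finally show ?thesis .
qed

section \<open>Absolute convergence of the forms\<close>

text \<open>Near the diagonal Young's inequality splits the product into the energy density of
  \<open>\<phi>\<close> and the squared increment of \<open>w\<close>, which is quadratically small;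
  away from it \<open>\<phi>\<close> is bounded and \<open>w\<close> grows at most like the power
  \<open>s\<close>. The integrand vanishes unless one of the two points lies in \<open>B\<close>, so
  by symmetry it suffices to control \<open>w\<close> as seen from \<open>B\<close>.\<close>

lemma integrable_weak_form:
  fixes w \<phi> :: "'a::euclidean_space \<Rightarrow> real"
  assumes s: "0 < s" "s < 1"
    and [measurable]: "w \<in> borel_measurable borel" "\<phi> \<in> borel_measurable borel" "B \<in> sets borel"
    and B: "emeasure lborel B < \<infinity>"
    and \<phi>: "\<And>x. \<bar>\<phi> x\<bar> \<le> \<Phi>" "\<And>x. x \<notin> B \<Longrightarrow> \<phi> x = 0"
    and w: "\<And>x y. x \<in> B \<Longrightarrow> \<bar>w x - w y\<bar> \<le> L * min (norm (x - y)) (norm (x - y) powr s)"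
    and energy: "integrable (lborel \<Otimes>\<^sub>M lborel) (\<lambda>(x, y). (\<phi> x - \<phi> y)\<^sup>2 * frac_kernel s (x - y))"
  shows "integrable (lborel \<Otimes>\<^sub>M lborel) (\<lambda>(x, y). (w x - w y) * (\<phi> x - \<phi> y) * frac_kernel s (x - y))"
proof (rule Bochner_Integration.integrable_bound)
  \<comment> \<open>The square of \<open>L\<close> comes from the near part. In the far part
    \<open>min r (r powr s) \<le> 16 * \<mu>\<close> and \<open>\<phi>\<close> varies by at most
    \<open>2 * \<Phi>\<close>, which gives the 32.\<close>
  let ?C = "L\<^sup>2 + 32 * \<bar>L\<bar> * \<Phi>"
  have iB: "integrable lborel (indicator B :: 'a \<Rightarrow> real)" using B by simp
  have b1: "integrable (lborel \<Otimes>\<^sub>M lborel) (\<lambda>(x, y). indicator B x * kern_maj s (x - y) :: real)"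
    by (rule integrable_pair_times_diff[OF iB integrable_kern_maj[OF s]])
  have b2: "integrable (lborel \<Otimes>\<^sub>M lborel) (\<lambda>(x, y). indicator B y * kern_maj s (y - x) :: real)"
    using lborel_pair.integrable_product_swap[OF b1] by simp
  show "integrable (lborel \<Otimes>\<^sub>M lborel) (\<lambda>z. ?C * (case z of (x, y) \<Rightarrow> indicator B x * kern_maj s (x - y))
      + ?C * (case z of (x, y) \<Rightarrow> indicator B y * kern_maj s (y - x))
      + (case z of (x, y) \<Rightarrow> (\<phi> x - \<phi> y)\<^sup>2 * frac_kernel s (x - y)))"
    using b1 b2 energy by simp
  have \<Phi>: "0 \<le> \<Phi>" using \<phi>(1)[of undefined] by simp
  have C0: "0 \<le> ?C" using \<Phi> by simp
  have key: "\<bar>(w x - w y) * (\<phi> x - \<phi> y) * frac_kernel s (x - y)\<bar>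
      \<le> ?C * kern_maj s (x - y) + (\<phi> x - \<phi> y)\<^sup>2 * frac_kernel s (x - y)" if x: "x \<in> B" for x y
  proof -
    define r where "r = norm (x - y)"
    define \<mu> where "\<mu> = min (r\<^sup>2) (r powr s)"
    have \<mu>: "0 \<le> \<mu>" by (simp add: \<mu>_def)
    have wL: "\<bar>w x - w y\<bar> \<le> \<bar>L\<bar> * min r (r powr s)"
      using w[OF x, of y] unfolding r_def[symmetric]
      by (rule order_trans) (intro mult_right_mono, auto simp: r_def)
    have "\<bar>(w x - w y) * (\<phi> x - \<phi> y)\<bar> \<le> ?C * \<mu> + (\<phi> x - \<phi> y)\<^sup>2"
    proof (cases "r < 1 / 4")
      case True
      have "r\<^sup>2 \<le> r powr s"
        using True s powr_mono'[of s 2 r] by (simp add: powr_numeral r_def)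
      then have \<mu>r: "\<mu> = r\<^sup>2" by (simp add: \<mu>_def)
      have "\<bar>w x - w y\<bar> \<le> \<bar>L\<bar> * r" using wL by (rule order_trans) (auto intro: mult_left_mono)
      then have "\<bar>w x - w y\<bar>\<^sup>2 \<le> (\<bar>L\<bar> * r)\<^sup>2" by (rule power_mono) simp
      then have 1: "(w x - w y)\<^sup>2 \<le> L\<^sup>2 * \<mu>" unfolding \<mu>r by (simp add: power_mult_distrib)
      have "2 * (\<bar>w x - w y\<bar> * \<bar>\<phi> x - \<phi> y\<bar>) \<le> (w x - w y)\<^sup>2 + (\<phi> x - \<phi> y)\<^sup>2"
        using sum_squares_bound[of "\<bar>w x - w y\<bar>" "\<bar>\<phi> x - \<phi> y\<bar>"] by (simp add: mult.assoc)
      moreover have "0 \<le> \<bar>w x - w y\<bar> * \<bar>\<phi> x - \<phi> y\<bar>" by simp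
      ultimately have "\<bar>w x - w y\<bar> * \<bar>\<phi> x - \<phi> y\<bar> \<le> L\<^sup>2 * \<mu> + (\<phi> x - \<phi> y)\<^sup>2" using 1 by linarith
      moreover have "0 \<le> (32 * \<bar>L\<bar> * \<Phi>) * \<mu>" using \<Phi> \<mu> by simp
      ultimately show ?thesis unfolding abs_mult distrib_right by linarith
    next
      case False
      have "min r (r powr s) \<le> 16 * \<mu>"
      proof (cases "r < 1")
        case True
        have "r\<^sup>2 \<le> r powr s"
          using True s powr_mono'[of s 2 r] by (simp add: powr_numeral r_def)
        moreover have "r * (1/4) \<le> r * r" using False by (intro mult_left_mono) auto
        ultimately have "min r (r powr s) \<le> 16 * r\<^sup>2" "\<mu> = r\<^sup>2"
          using zero_le_square[of r] unfolding \<mu>_def power2_eq_square min_le_iff_disj by (linarith, simp)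
        then show ?thesis by simp
      next
        case F: False
        have "r powr s \<le> r\<^sup>2" using F s powr_mono[of s 2 r] by (simp add: powr_numeral)
        then have "\<mu> = r powr s" by (simp add: \<mu>_def)
        then show ?thesis using powr_ge_zero[of r s] min.cobounded2[of r "r powr s"] by linarith
      qed
      then have "\<bar>w x - w y\<bar> \<le> \<bar>L\<bar> * (16 * \<mu>)"
        using wL by (meson mult_left_mono abs_ge_zero order_trans)
      moreover have "\<bar>\<phi> x - \<phi> y\<bar> \<le> 2 * \<Phi>" using \<phi>(1)[of x] \<phi>(1)[of y] by linarith
      ultimately have "\<bar>w x - w y\<bar> * \<bar>\<phi> x - \<phi> y\<bar> \<le> \<bar>L\<bar> * (16 * \<mu>) * (2 * \<Phi>)"
        using \<mu> by (intro mult_mono) auto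
      also have "\<dots> = (32 * \<bar>L\<bar> * \<Phi>) * \<mu>" by simp
      also have "\<dots> \<le> ?C * \<mu>" using \<mu> by (intro mult_right_mono) auto
      finally show ?thesis by (simp add: abs_mult add_increasing2)
    qed
    from mult_right_mono[OF this frac_kernel_nonneg[of s "x - y"]]
    show ?thesis by (simp add: abs_mult frac_kernel_nonneg kern_maj_def \<mu>_def r_def distrib_right mult.assoc)
  qed
  show "AE z in lborel \<Otimes>\<^sub>M lborel. norm (case z of (x, y) \<Rightarrow> (w x - w y) * (\<phi> x - \<phi> y) * frac_kernel s (x - y))
    \<le> norm (?C * (case z of (x, y) \<Rightarrow> indicator B x * kern_maj s (x - y))
      + ?C * (case z of (x, y) \<Rightarrow> indicator B y * kern_maj s (y - x))
      + (case z of (x, y) \<Rightarrow> (\<phi> x - \<phi> y)\<^sup>2 * frac_kernel s (x - y)))"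
  proof (rule AE_I2)
    fix z :: "'a \<times> 'a"
    obtain x y where z: "z = (x, y)" by (cases z)
    let ?lhs = "\<bar>(w x - w y) * (\<phi> x - \<phi> y) * frac_kernel s (x - y)\<bar>"
    have nn: "0 \<le> ?C * (indicator B x * kern_maj s (x - y))" "0 \<le> ?C * (indicator B y * kern_maj s (y - x))"
      "0 \<le> (\<phi> x - \<phi> y)\<^sup>2 * frac_kernel s (x - y)"
      using C0 by (auto intro!: mult_nonneg_nonneg simp: kern_maj_nonneg frac_kernel_nonneg)
    have sym: "?lhs = \<bar>(w y - w x) * (\<phi> y - \<phi> x) * frac_kernel s (y - x)\<bar>"
      "(\<phi> x - \<phi> y)\<^sup>2 * frac_kernel s (x - y) = (\<phi> y - \<phi> x)\<^sup>2 * frac_kernel s (y - x)"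
      by (simp_all add: frac_kernel_commute[of s x y] abs_mult abs_minus_commute power2_commute)
    have "?lhs \<le> ?C * (indicator B x * kern_maj s (x - y)) + ?C * (indicator B y * kern_maj s (y - x))
        + (\<phi> x - \<phi> y)\<^sup>2 * frac_kernel s (x - y)"
    proof -
      consider "x \<in> B" | "y \<in> B" | "x \<notin> B" "y \<notin> B" by blast
      then show ?thesis
      proof cases
        case 1 then show ?thesis using key[OF 1, of y] nn by simp
      next
        case 2 then show ?thesis using key[OF 2, of x] nn unfolding sym by simp
      next
        case 3 then show ?thesis using \<phi>(2) by simp
      qed
    qed
    then show "norm (case z of (x, y) \<Rightarrow> (w x - w y) * (\<phi> x - \<phi> y) * frac_kernel s (x - y))
      \<le> norm (?C * (case z of (x, y) \<Rightarrow> indicator B x * kern_maj s (x - y))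
      + ?C * (case z of (x, y) \<Rightarrow> indicator B y * kern_maj s (y - x))
      + (case z of (x, y) \<Rightarrow> (\<phi> x - \<phi> y)\<^sup>2 * frac_kernel s (x - y)))"
      using nn unfolding z by simp
  qed
qed measurable

text \<open>Once the form is split, \<open>\<phi> x\<close> stands alone and the increment of
  \<open>\<phi>\<close> no longer helps near the diagonal. The distance \<open>c\<close> takes its
  place: beyond it, linear smallness is quadratic smallness up to the factor
  \<open>1 + 1 / c\<^sup>2\<close>.\<close>

lemma integrable_truncated_weak_form:
  fixes w \<phi> :: "'a::euclidean_space \<Rightarrow> real"
  assumes s: "0 < s" "s < 1"
    and [measurable]: "w \<in> borel_measurable borel" "\<phi> \<in> borel_measurable borel" "B \<in> sets borel" "S \<in> sets borel"
    and B: "emeasure lborel B < \<infinity>"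
    and \<phi>: "\<And>x. \<bar>\<phi> x\<bar> \<le> \<Phi>" "\<And>x. x \<notin> B \<Longrightarrow> \<phi> x = 0"
    and w: "\<And>x y. x \<in> B \<Longrightarrow> \<bar>w x - w y\<bar> \<le> L * min (norm (x - y)) (norm (x - y) powr s)"
    and "0 < c" and far: "\<And>x y. x \<in> B \<Longrightarrow> (x, y) \<in> S \<Longrightarrow> c \<le> norm (x - y)"
  shows "integrable (lborel \<Otimes>\<^sub>M lborel) (\<lambda>(x, y). indicator S (x, y) * (w x - w y) * \<phi> x * frac_kernel s (x - y))"
proof (rule Bochner_Integration.integrable_bound)
  let ?C = "\<bar>L\<bar> * \<Phi> * (1 + 1 / c\<^sup>2)"
  have iB: "integrable lborel (indicator B :: 'a \<Rightarrow> real)" using B by simp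
  have b1: "integrable (lborel \<Otimes>\<^sub>M lborel) (\<lambda>(x, y). indicator B x * kern_maj s (x - y) :: real)"
    by (rule integrable_pair_times_diff[OF iB integrable_kern_maj[OF s]])
  show "integrable (lborel \<Otimes>\<^sub>M lborel) (\<lambda>z. ?C * (case z of (x, y) \<Rightarrow> indicator B x * kern_maj s (x - y)))"
    using b1 by simp
  have [measurable]: "S \<in> sets (lborel \<Otimes>\<^sub>M lborel)" using assms(6) unfolding lborel_prod by simp
  have "(\<lambda>z. indicator S z * ((w (fst z) - w (snd z)) * \<phi> (fst z) * frac_kernel s (fst z - snd z))) \<in> borel_measurable (lborel \<Otimes>\<^sub>M lborel)"
    by (intro borel_measurable_times borel_measurable_indicator) measurable
  then show "(\<lambda>(x, y). indicator S (x, y) * (w x - w y) * \<phi> x * frac_kernel s (x - y)) \<in> borel_measurable (lborel \<Otimes>\<^sub>M lborel)"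
    by (simp add: case_prod_beta mult.assoc)
  have \<Phi>: "0 \<le> \<Phi>" using \<phi>(1)[of undefined] by simp
  have C0: "0 \<le> ?C" using \<Phi> by simp
  show "AE z in lborel \<Otimes>\<^sub>M lborel. norm (case z of (x, y) \<Rightarrow> indicator S (x, y) * (w x - w y) * \<phi> x * frac_kernel s (x - y))
    \<le> norm (?C * (case z of (x, y) \<Rightarrow> indicator B x * kern_maj s (x - y)))"
  proof (rule AE_I2)
    fix z :: "'a \<times> 'a"
    obtain x y where z: "z = (x, y)" by (cases z)
    show "norm (case z of (x, y) \<Rightarrow> indicator S (x, y) * (w x - w y) * \<phi> x * frac_kernel s (x - y))
      \<le> norm (?C * (case z of (x, y) \<Rightarrow> indicator B x * kern_maj s (x - y)))"
    proof (cases "x \<in> B \<and> (x, y) \<in> S")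
      case True
      define r where "r = norm (x - y)"
      define \<mu> where "\<mu> = min (r\<^sup>2) (r powr s)"
      have r: "c \<le> r" "0 < r" using far[of x y] True \<open>0 < c\<close> by (auto simp: r_def)
      have "min r (r powr s) \<le> (1 + 1 / c\<^sup>2) * \<mu>"
      proof (cases "r < 1")
        case True
        have "r\<^sup>2 \<le> r powr s"
          using True s powr_mono'[of s 2 r] by (simp add: powr_numeral r_def)
        then have \<mu>: "\<mu> = r\<^sup>2" by (simp add: \<mu>_def)
        have "c\<^sup>2 \<le> r\<^sup>2" using r \<open>0 < c\<close> by (intro power_mono) auto
        then have "1 \<le> 1 / c\<^sup>2 * r\<^sup>2" using \<open>0 < c\<close> by (simp add: field_simps)
        then show ?thesis using True unfolding \<mu> distrib_right by (auto simp: min_le_iff_disj intro: add_increasing)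
      next
        case F: False
        have "r powr s \<le> r\<^sup>2" using F s powr_mono[of s 2 r] by (simp add: powr_numeral)
        then have \<mu>: "\<mu> = r powr s" by (auto simp: \<mu>_def)
        show ?thesis unfolding \<mu> distrib_right by (auto simp: min_le_iff_disj)
      qed
      then have 1: "\<bar>w x - w y\<bar> \<le> \<bar>L\<bar> * ((1 + 1 / c\<^sup>2) * \<mu>)"
        using w[of x y] True unfolding r_def[symmetric]
        by (smt (verit, ccfv_SIG) abs_ge_self mult_left_mono mult_right_mono r(2) powr_ge_zero)
      have "\<bar>w x - w y\<bar> * \<bar>\<phi> x\<bar> \<le> \<bar>L\<bar> * ((1 + 1 / c\<^sup>2) * \<mu>) * \<Phi>"
        by (rule mult_mono[OF 1 \<phi>(1)]) (auto simp: \<mu>_def)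
      from mult_right_mono[OF this frac_kernel_nonneg[of s "x - y"]]
      have "\<bar>w x - w y\<bar> * \<bar>\<phi> x\<bar> * frac_kernel s (x - y) \<le> ?C * kern_maj s (x - y)"
        by (simp add: kern_maj_def \<mu>_def r_def mult_ac)
      then show ?thesis using True C0 unfolding z
        using \<Phi> by (simp add: abs_mult frac_kernel_nonneg kern_maj_nonneg)
    qed (use \<phi>(2)[of x] in \<open>auto simp: z\<close>)
  qed
qed

lemma powr_le_min_quarter:
  fixes r s :: real
  assumes "0 < s" "s < 1" "1 / 4 \<le> r"
  shows "r powr s \<le> 4 * min r (r powr s)"
proof (cases "r < 1")
  case True
  have "r powr s \<le> 1" using assms True by (intro powr_le1) auto
  then show ?thesis using assms(3) powr_ge_zero[of r s] unfolding min_def by (auto simp del: powr_ge_zero)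
next
  case False
  have "r powr s \<le> r" using powr_mono[of s 1 r] assms False by simp
  then show ?thesis using powr_ge_zero[of r s] unfolding min_def by (auto simp del: powr_ge_zero)
qed

lemma powr_lipschitz_half:
  fixes p q s :: real
  assumes s: "0 < s" "s < 1" and "1 / 2 \<le> p" "1 / 2 \<le> q"
  shows "\<bar>p powr s - q powr s\<bar> \<le> 2 * \<bar>p - q\<bar>"
proof -
  have main: "q powr s - p powr s \<le> 2 * (q - p) \<and> p powr s \<le> q powr s" if pq: "1 / 2 \<le> p" "p < q" for p q :: real
  proof -
    have "\<exists>z. p < z \<and> z < q \<and> q powr s - p powr s = (q - p) * (s * z powr (s - 1))"
      using pq by (intro MVT2) (auto intro!: derivative_eq_intros)
    then obtain z where z: "p < z" and eq: "q powr s - p powr s = (q - p) * (s * z powr (s - 1))" by blast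
    have "z powr (s - 1) \<le> (1 / 2) powr (s - 1)" using z pq s by (intro powr_mono2') auto
    also have "\<dots> = 2 powr (1 - s)" by (simp add: powr_divide powr_minus_divide[symmetric])
    also have "\<dots> \<le> 2" using powr_mono[of "1 - s" 1 2] s by simp
    finally have "s * z powr (s - 1) \<le> 1 * 2" using s by (intro mult_mono) auto
    then have "(q - p) * (s * z powr (s - 1)) \<le> (q - p) * 2" using pq by (intro mult_left_mono) auto
    then show ?thesis using eq pq s by (auto intro: powr_mono2)
  qed
  show ?thesis
    using main[of p q] main[of q p] assms by (cases p q rule: linorder_cases) auto
qed

text \<open>For positive \<open>a\<close> the barrier jumps across the hyperplane, so such a bound
  fails close to it. With the height of \<open>x\<close> at least 3/4, points nearer than 1/4 have
  height at least 1/2, where the power is Lipschitz; for all other points the growth of order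
  \<open>s\<close> suffices.\<close>

lemma half_space_barrier_lipschitz:
  fixes e x y :: "'a::euclidean_space"
  assumes s: "0 < s" "s < 1" and e: "norm e = 1" and ab: "0 \<le> a" "0 \<le> b"
    and x: "3 / 4 \<le> e \<bullet> x" "e \<bullet> x \<le> 5 / 4"
  shows "\<bar>half_space_barrier e a b s x - half_space_barrier e a b s y\<bar>
      \<le> 100 * (a + b) * min (norm (x - y)) (norm (x - y) powr s)"
proof -
  define r where "r = norm (x - y)"
  define \<tau> t where "\<tau> = e \<bullet> x" and "t = e \<bullet> y"
  let ?w = "half_space_barrier e a b s"
  have rt: "\<bar>\<tau> - t\<bar> \<le> r"
    using Cauchy_Schwarz_ineq2[of e "x - y"] e by (simp add: \<tau>_def t_def r_def inner_diff_right)
  have \<tau>: "3 / 4 \<le> \<tau>" "\<tau> \<le> 5 / 4" using x by (auto simp: \<tau>_def)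
  have wx: "?w x = a + b * \<tau> powr s" using \<tau> by (simp add: half_space_barrier_def \<tau>_def[symmetric])
  show ?thesis unfolding r_def[symmetric]
  proof (cases "r < 1 / 4")
    case True
    then have t: "1 / 2 \<le> t" using rt \<tau> by linarith
    then have wy: "?w y = a + b * t powr s" by (simp add: half_space_barrier_def t_def[symmetric])
    have "\<bar>?w x - ?w y\<bar> = b * \<bar>\<tau> powr s - t powr s\<bar>"
      unfolding wx wy using ab by (simp add: right_diff_distrib[symmetric] abs_mult)
    also have "\<dots> \<le> b * (2 * r)"
      using powr_lipschitz_half[OF s, of \<tau> t] \<tau> t rt ab by (intro mult_left_mono) auto
    also have "\<dots> \<le> 100 * (a + b) * r"
      using ab by (simp add: algebra_simps r_def add_increasing mult_nonneg_nonneg)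
    also have "r = min r (r powr s)"
      using True powr_mono'[of s 1 r] s by (simp add: r_def)
    finally show "\<bar>?w x - ?w y\<bar> \<le> 100 * (a + b) * min r (r powr s)" .
  next
    case False
    then have r: "1 / 4 \<le> r" by simp
    define P where "P = r powr s"
    have P: "1 \<le> 4 * P"
    proof -
      have "(1 / 4 :: real) = (1 / 4) powr 1" by simp
      also have "\<dots> \<le> (1 / 4) powr s" using s by (intro powr_mono') auto
      also have "\<dots> \<le> P" unfolding P_def using r s by (intro powr_mono2) auto
      finally show ?thesis by simp
    qed
    have six: "(6 * r) powr s \<le> 6 * P"
    proof -
      have "(6 * r) powr s = 6 powr s * P" unfolding P_def using r by (simp add: powr_mult)
      also have "\<dots> \<le> 6 * P" using powr_mono[of s 1 "6::real"] s by (intro mult_right_mono) (auto simp: P_def)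
      finally show ?thesis .
    qed
    \<comment> \<open>The height bound \<open>6 * r\<close> comes from
      \<open>\<tau> \<le> 5 / 4 \<le> 5 * r\<close> and \<open>t \<le> \<tau> + r\<close>. The final
      100 is 25, a common bound for 4 and 6, times the 4 of
      \<open>powr_le_min_quarter\<close>.\<close>
    have w_le: "0 \<le> ?w y' \<and> ?w y' \<le> a * (4 * P) + b * (6 * P)" if "e \<bullet> y' \<le> 6 * r" for y'
    proof (cases "0 < e \<bullet> y'")
      case True
      have "(e \<bullet> y') powr s \<le> (6 * r) powr s" using that True s by (intro powr_mono2) auto
      then have "b * (e \<bullet> y') powr s \<le> b * (6 * P)" using six ab by (intro mult_left_mono) auto
      moreover have "a * 1 \<le> a * (4 * P)" using P ab by (intro mult_left_mono) auto
      ultimately show ?thesis using True ab by (simp add: half_space_barrier_def)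
    qed (use ab in \<open>simp add: half_space_barrier_def P_def\<close>)
    have "e \<bullet> x \<le> 6 * r" using \<tau> r by (simp add: \<tau>_def)
    moreover have "e \<bullet> y \<le> 6 * r" using \<tau> r rt unfolding t_def[symmetric] by linarith
    ultimately have "\<bar>?w x - ?w y\<bar> \<le> a * (4 * P) + b * (6 * P)"
      using w_le[of x] w_le[of y] by linarith
    also have "\<dots> \<le> 25 * (a + b) * P"
      using ab by (simp add: algebra_simps P_def add_mono mult_mono)
    also have "\<dots> \<le> 25 * (a + b) * (4 * min r P)"
      unfolding P_def using powr_le_min_quarter[OF s r] ab by (intro mult_left_mono) auto
    also have "\<dots> = 100 * (a + b) * min r (r powr s)" by (simp add: P_def algebra_simps)
    finally show "\<bar>?w x - ?w y\<bar> \<le> 100 * (a + b) * min r (r powr s)" .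
  qed
qed

section \<open>The bump and the two form estimates\<close>

text \<open>The factor 16 makes the support a ball of radius 1/4, so that around a point of height
  one it stays in the strip where the barrier is Lipschitz. Cutting the paraboloid off at zero
  creates only a convex kink, which keeps second differences bounded below.\<close>

definition bump :: "'a::euclidean_space \<Rightarrow> 'a \<Rightarrow> real" where
  "bump z x = max 0 (1 - 16 * (norm (x - z))\<^sup>2)"

lemma bump_measurable [measurable]: "bump z \<in> borel_measurable borel"
  unfolding bump_def by measurable

lemma bump_range: "0 \<le> bump z x" "bump z x \<le> 1"
  by (auto simp: bump_def)

lemma bump_outside: "x \<notin> ball z (1 / 4) \<Longrightarrow> bump z x = 0"
proof -
  assume "x \<notin> ball z (1 / 4)"
  then have "1 / 4 \<le> norm (x - z)" by (simp add: dist_norm norm_minus_commute)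
  then have "(1 / 4)\<^sup>2 \<le> (norm (x - z))\<^sup>2" by (intro power_mono) auto
  then show ?thesis by (simp add: bump_def power2_eq_square)
qed

lemma bump_inside: "x \<in> ball z (1 / 4) \<Longrightarrow> bump z x = 1 - 16 * (norm (x - z))\<^sup>2"
proof -
  assume "x \<in> ball z (1 / 4)"
  then have "norm (x - z) \<le> 1 / 4" by (simp add: dist_norm norm_minus_commute)
  then have "(norm (x - z))\<^sup>2 \<le> (1 / 4)\<^sup>2" by (intro power_mono) auto
  then show ?thesis by (simp add: bump_def power2_eq_square)
qed

lemma bump_lipschitz:
  fixes x y z :: "'a::euclidean_space"
  assumes s: "0 < s" "s < 1" and x: "x \<in> ball z (1 / 4)"
  shows "\<bar>bump z x - bump z y\<bar> \<le> 16 * min (norm (x - y)) (norm (x - y) powr s)"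
proof (cases "norm (x - y) < 1 / 4")
  case True
  define p q where "p = norm (x - z)" and "q = norm (y - z)"
  have p: "0 \<le> p" "p \<le> 1 / 4" using x by (auto simp: p_def dist_norm norm_minus_commute)
  have pq: "\<bar>p - q\<bar> \<le> norm (x - y)" unfolding p_def q_def using norm_triangle_ineq3[of "x - z" "y - z"] by simp
  have q: "0 \<le> q" "q \<le> 1 / 2" using pq p True by (auto simp: q_def)
  have "\<bar>bump z x - bump z y\<bar> \<le> \<bar>16 * p\<^sup>2 - 16 * q\<^sup>2\<bar>"
    unfolding bump_def p_def q_def by linarith
  also have "16 * p\<^sup>2 - 16 * q\<^sup>2 = 16 * ((p - q) * (p + q))"
    by (simp add: power2_eq_square algebra_simps)
  also have "\<bar>16 * ((p - q) * (p + q))\<bar> = 16 * (\<bar>p - q\<bar> * (p + q))"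
    using p q by (simp add: abs_mult)
  also have "\<dots> \<le> 16 * (norm (x - y) * 1)"
    using p q pq by (intro mult_left_mono mult_mono) auto
  also have "norm (x - y) * 1 = min (norm (x - y)) (norm (x - y) powr s)"
    using True powr_mono'[of s 1 "norm (x - y)"] s by simp
  finally show ?thesis .
next
  case False
  then have r: "1 / 4 \<le> norm (x - y)" by simp
  have "(1 / 4 :: real) = (1 / 4) powr 1" by simp
  also have "\<dots> \<le> (1 / 4) powr s" using s by (intro powr_mono') auto
  also have "\<dots> \<le> norm (x - y) powr s" using r s by (intro powr_mono2) auto
  finally have "1 \<le> 16 * min (norm (x - y)) (norm (x - y) powr s)"
    using powr_le_min_quarter[OF s r] by linarith
  moreover have "\<bar>bump z x - bump z y\<bar> \<le> 1" using bump_range[of z x] bump_range[of z y] by linarith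
  ultimately show ?thesis by linarith
qed

text \<open>At \<open>x\<close> the bump equals the paraboloid and elsewhere it lies on or above it,
  so its second difference is at least that of the paraboloid, which the parallelogram law evaluates
  as \<open>- 32\<close> times the squared norm of \<open>h\<close>. For long \<open>h\<close> the
  range of the bump already gives \<open>- 2\<close>.\<close>

lemma bump_semiconvex:
  fixes x h z :: "'a::euclidean_space"
  assumes s: "0 < s" "s < 1" and x: "x \<in> ball z (1 / 4)"
  shows "- (32 * min ((norm h)\<^sup>2) (norm h powr s)) \<le> bump z (x + h) + bump z (x - h) - 2 * bump z x"
proof (cases "norm h < 1")
  case True
  have "(norm h)\<^sup>2 \<le> norm h powr s" using True s powr_mono'[of s 2 "norm h"] by (simp add: powr_numeral)
  then have m: "min ((norm h)\<^sup>2) (norm h powr s) = (norm h)\<^sup>2" by simp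
  define p q where "p = (norm (x + h - z))\<^sup>2" and "q = (norm (x - h - z))\<^sup>2"
  have "p + q = 2 * (norm (x - z))\<^sup>2 + 2 * (norm h)\<^sup>2"
    unfolding p_def q_def
    by (simp add: power2_norm_eq_inner inner_diff_left inner_diff_right inner_add_left inner_add_right inner_commute)
  moreover have "1 - 16 * p \<le> bump z (x + h)" "1 - 16 * q \<le> bump z (x - h)"
    by (auto simp: bump_def p_def q_def)
  ultimately have "- (32 * (norm h)\<^sup>2) \<le> bump z (x + h) + bump z (x - h) - 2 * (1 - 16 * (norm (x - z))\<^sup>2)"
    by argo
  then show ?thesis unfolding m bump_inside[OF x] .
next
  case False
  have "1 \<le> norm h powr s" using False s by (intro ge_one_powr_ge_zero) auto
  moreover have "1 \<le> (norm h)\<^sup>2" using False by simp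
  ultimately have "1 \<le> min ((norm h)\<^sup>2) (norm h powr s)" by simp
  then show ?thesis using bump_range[of z x] bump_range[of z "x + h"] bump_range[of z "x - h"] by linarith
qed

text \<open>The support of \<open>\<phi>\<close> lies at heights below 2 and the tail decreases with
  the height, so \<open>a\<close> times the tail at 2 bounds the truncated fractional Laplacian from
  below at every point that \<open>\<phi>\<close> sees.\<close>

lemma half_space_barrier_weak_form_ge:
  fixes e z :: "'a::euclidean_space"
  assumes s: "0 < s" "s < 1" and e: "norm e = 1" and ab: "0 \<le> a" "0 \<le> b" and z: "e \<bullet> z = 1"
    and [measurable]: "\<phi> \<in> borel_measurable borel"
    and \<phi>: "integrable lborel \<phi>" "\<And>x. 0 \<le> \<phi> x" "\<And>x. \<phi> x \<le> \<Phi>" "\<And>x. x \<notin> ball z (1 / 4) \<Longrightarrow> \<phi> x = 0"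
    and energy: "integrable (lborel \<Otimes>\<^sub>M lborel) (\<lambda>(x, y). (\<phi> x - \<phi> y)\<^sup>2 * frac_kernel s (x - y))"
  defines "w \<equiv> half_space_barrier e a b s"
  shows "integrable (lborel \<Otimes>\<^sub>M lborel) (\<lambda>(x, y). (w x - w y) * (\<phi> x - \<phi> y) * frac_kernel s (x - y))"
    and "2 * (a * enn2real (frac_kernel_tail s e 2)) * (\<integral>x. \<phi> x \<partial>lborel)
      \<le> (\<integral>(x, y). (w x - w y) * (\<phi> x - \<phi> y) * frac_kernel s (x - y) \<partial>(lborel \<Otimes>\<^sub>M lborel))"
proof -
  let ?B = "ball z (1 / 4)"
  have wm [measurable]: "w \<in> borel_measurable borel" unfolding w_def by measurable
  have Bfin: "emeasure lborel ?B < \<infinity>" by (rule emeasure_lborel_ball_finite)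
  have \<phi>abs: "\<bar>\<phi> x\<bar> \<le> \<Phi>" for x using \<phi>(2,3)[of x] by simp
  have \<tau>: "3 / 4 \<le> e \<bullet> x \<and> e \<bullet> x \<le> 5 / 4" if "x \<in> ?B" for x
  proof -
    have "\<bar>e \<bullet> x - 1\<bar> \<le> norm (x - z)"
      using Cauchy_Schwarz_ineq2[of e "x - z"] e z by (simp add: inner_diff_right)
    moreover have "norm (x - z) < 1 / 4" using that by (simp add: dist_norm norm_minus_commute)
    ultimately show ?thesis by (simp add: abs_le_iff)
  qed
  have lip: "\<bar>w x - w y\<bar> \<le> (100 * (a + b)) * min (norm (x - y)) (norm (x - y) powr s)" if "x \<in> ?B" for x y
    unfolding w_def using \<tau>[OF that] half_space_barrier_lipschitz[OF s e ab, of x y] by simp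
  show form: "integrable (lborel \<Otimes>\<^sub>M lborel) (\<lambda>(x, y). (w x - w y) * (\<phi> x - \<phi> y) * frac_kernel s (x - y))"
    by (rule integrable_weak_form[where B = ?B, OF s _ _ _ Bfin \<phi>abs \<phi>(4) lip energy]) auto
  \<comment> \<open>Starting at \<open>1 / 3\<close> keeps every \<open>\<epsilon> m\<close> below
    \<open>1 / 2\<close>, as the power balance demands.\<close>
  define \<epsilon> where "\<epsilon> = (\<lambda>m::nat. 1 / (real m + 3))"
  have \<epsilon>: "0 < \<epsilon> m" "\<epsilon> m < 1 / 2" for m by (auto simp: \<epsilon>_def field_simps)
  have \<epsilon>0: "\<epsilon> \<longlonglongrightarrow> 0" unfolding \<epsilon>_def by real_asymp
  have cover_pos: "\<forall>\<^sub>F m in sequentially. \<epsilon> m * p \<le> q \<and> q \<le> (1 - \<epsilon> m) * p" if "0 < q" "q < p" for p q :: real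
  proof -
    have "(\<lambda>m. \<epsilon> m * p) \<longlonglongrightarrow> 0 * p" by (intro tendsto_intros \<epsilon>0)
    then have "\<forall>\<^sub>F m in sequentially. \<epsilon> m * p < q" using that by (intro order_tendstoD) auto
    moreover have "(\<lambda>m. (1 - \<epsilon> m) * p) \<longlonglongrightarrow> (1 - 0) * p" by (intro tendsto_intros \<epsilon>0)
    then have "\<forall>\<^sub>F m in sequentially. q < (1 - \<epsilon> m) * p" using that by (intro order_tendstoD) auto
    ultimately show ?thesis by eventually_elim auto
  qed
  show "2 * (a * enn2real (frac_kernel_tail s e 2)) * (\<integral>x. \<phi> x \<partial>lborel)
      \<le> (\<integral>(x, y). (w x - w y) * (\<phi> x - \<phi> y) * frac_kernel s (x - y) \<partial>(lborel \<Otimes>\<^sub>M lborel))"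
  proof (rule weak_form_ge[where S = "\<lambda>m. ratio_cutoff e (\<epsilon> m)", OF _ _ _ _ _ \<phi>(1,2) _ _ form])
    show "(y, x) \<in> ratio_cutoff e (\<epsilon> m)" if "(x, y) \<in> ratio_cutoff e (\<epsilon> m)" for m x y
      using that by (auto simp: ratio_cutoff_def)
    show "\<forall>\<^sub>F m in sequentially. (x, y) \<in> ratio_cutoff e (\<epsilon> m)" if "(w x - w y) * (\<phi> x - \<phi> y) \<noteq> 0" for x y
    proof -
      \<comment> \<open>No cutoff contains a pair of equal positive heights, but the barrier takes
        equal values there, so such pairs do not contribute to the form.\<close>
      have ne: "e \<bullet> x \<noteq> e \<bullet> y"
      proof
        assume "e \<bullet> x = e \<bullet> y"
        then have "w x = w y" unfolding w_def half_space_barrier_def by (simp only:)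
        then show False using that by simp
      qed
      consider "e \<bullet> x \<le> 0 \<or> e \<bullet> y \<le> 0" | "0 < e \<bullet> y" "e \<bullet> y < e \<bullet> x" | "0 < e \<bullet> x" "e \<bullet> x < e \<bullet> y"
        using ne by linarith
      then show ?thesis
      proof cases
        case 2 from cover_pos[OF this] show ?thesis by eventually_elim (simp add: ratio_cutoff_def)
      next
        case 3 from cover_pos[OF this] show ?thesis by eventually_elim (simp add: ratio_cutoff_def)
      qed (auto simp: ratio_cutoff_def)
    qed
    show "integrable (lborel \<Otimes>\<^sub>M lborel) (\<lambda>(x, y). indicator (ratio_cutoff e (\<epsilon> m)) (x, y) * (w x - w y) * \<phi> x * frac_kernel s (x - y))" for m
    proof (rule integrable_truncated_weak_form[where B = ?B and c = "\<epsilon> m * (3 / 4)", OF s _ _ _ _ Bfin \<phi>abs \<phi>(4) lip])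
      \<comment> \<open>On the support of \<open>\<phi>\<close> a cutoff in the ratio is also a
        cutoff in the distance, because the heights there are at least 3/4.\<close>
      fix x y assume x: "x \<in> ?B" and xy: "(x, y) \<in> ratio_cutoff e (\<epsilon> m)"
      define p q where "p = e \<bullet> x" and "q = e \<bullet> y"
      have p: "3 / 4 \<le> p" using \<tau>[OF x] by (simp add: p_def)
      have "\<bar>p - q\<bar> \<le> norm (x - y)"
        using Cauchy_Schwarz_ineq2[of e "x - y"] e by (simp add: inner_diff_right p_def q_def)
      moreover have "\<epsilon> m * (3 / 4) \<le> \<bar>p - q\<bar>"
      proof -
        have le: "\<epsilon> m * (3 / 4) \<le> \<epsilon> m * p" using p \<epsilon>[of m] by (intro mult_left_mono) auto
        have le1: "\<epsilon> m * (3 / 4) \<le> 3 / 4" using \<epsilon>[of m] by simp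
        consider "q \<le> 0" | "q \<le> (1 - \<epsilon> m) * p" | "p \<le> (1 - \<epsilon> m) * q"
          using xy p unfolding ratio_cutoff_def p_def q_def by auto
        then show ?thesis
        proof cases
          case 1 then show ?thesis using p le1 by linarith
        next
          case 2
          then have "\<epsilon> m * p \<le> p - q" by (simp add: algebra_simps)
          then show ?thesis using le by linarith
        next
          case 3
          have "0 < q" 
          proof (rule ccontr)
            assume "\<not> 0 < q"
            then have "(1 - \<epsilon> m) * q \<le> 0" using \<epsilon>[of m] by (intro mult_nonneg_nonpos) auto
            then show False using 3 p by linarith
          qed
          then have "0 \<le> \<epsilon> m * q" using \<epsilon>[of m] by simp
          then have "p \<le> q" using 3 by (simp add: algebra_simps)
          then have "\<epsilon> m * p \<le> \<epsilon> m * q" using \<epsilon>[of m] by (intro mult_left_mono) auto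
          moreover have "\<epsilon> m * q \<le> q - p" using 3 by (simp add: algebra_simps)
          ultimately show ?thesis using le by linarith
        qed
      qed
      ultimately show "\<epsilon> m * (3 / 4) \<le> norm (x - y)" by linarith
    qed (use \<epsilon>[of m] in auto)
    show "a * enn2real (frac_kernel_tail s e 2) \<le>
       (\<integral>y. indicator (ratio_cutoff e (\<epsilon> m)) (x, y) * (w x - w y) * frac_kernel s (x - y) \<partial>lborel)" if "0 < \<phi> x" for m x
    proof -
      have "x \<in> ?B" using that \<phi>(4)[of x] by (cases "x \<in> ?B") auto
      note t = \<tau>[OF this]
      have "frac_kernel_tail s e 2 \<le> frac_kernel_tail s e (e \<bullet> x)"
        unfolding frac_kernel_tail_def using t by (intro nn_integral_mono mult_left_mono) (auto simp: indicator_def)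
      then have "enn2real (frac_kernel_tail s e 2) \<le> enn2real (frac_kernel_tail s e (e \<bullet> x))"
        using frac_kernel_tail_finite[OF s, of "e \<bullet> x" e] t by (intro enn2real_mono) auto
      then have "a * enn2real (frac_kernel_tail s e 2) \<le> a * enn2real (frac_kernel_tail s e (e \<bullet> x))"
        using ab by (intro mult_left_mono)
      also have "\<dots> \<le> (\<integral>y. indicator (ratio_cutoff e (\<epsilon> m)) (x, y) * (w x - w y) * frac_kernel s (x - y) \<partial>lborel)"
        unfolding w_def using t by (intro half_space_barrier_ratio_cutoff_ge s e ab \<epsilon>) auto
      finally show ?thesis .
    qed
  qed auto
qed

text \<open>An upper bound is wanted, so \<open>weak_form_ge\<close> is applied to
  \<open>- bump z\<close>. Plain truncation by distance works, since the semiconvexity estimate is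
  the same for every truncation radius.\<close>

lemma bump_weak_form_le:
  fixes z :: "'a::euclidean_space"
  assumes s: "0 < s" "s < 1"
    and [measurable]: "\<phi> \<in> borel_measurable borel"
    and \<phi>: "integrable lborel \<phi>" "\<And>x. 0 \<le> \<phi> x" "\<And>x. \<phi> x \<le> \<Phi>" "\<And>x. x \<notin> ball z (1 / 4) \<Longrightarrow> \<phi> x = 0"
    and energy: "integrable (lborel \<Otimes>\<^sub>M lborel) (\<lambda>(x, y). (\<phi> x - \<phi> y)\<^sup>2 * frac_kernel s (x - y))"
  shows "integrable (lborel \<Otimes>\<^sub>M lborel) (\<lambda>(x, y). (bump z x - bump z y) * (\<phi> x - \<phi> y) * frac_kernel s (x - y))"
    and "(\<integral>(x, y). (bump z x - bump z y) * (\<phi> x - \<phi> y) * frac_kernel s (x - y) \<partial>(lborel \<Otimes>\<^sub>M lborel))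
      \<le> 32 * (\<integral>h. kern_maj s h \<partial>(lborel :: 'a measure)) * (\<integral>x. \<phi> x \<partial>lborel)"
proof -
  let ?B = "ball z (1 / 4)"
  define w where "w = (\<lambda>x. - bump z x)"
  have wm [measurable]: "w \<in> borel_measurable borel" unfolding w_def by measurable
  have Bfin: "emeasure lborel ?B < \<infinity>" by (rule emeasure_lborel_ball_finite)
  have \<phi>abs: "\<bar>\<phi> x\<bar> \<le> \<Phi>" for x using \<phi>(2,3)[of x] by simp
  have lip: "\<bar>w x - w y\<bar> \<le> 16 * min (norm (x - y)) (norm (x - y) powr s)" if "x \<in> ?B" for x y
    using bump_lipschitz[OF s that, of y] unfolding w_def by linarith
  have form: "integrable (lborel \<Otimes>\<^sub>M lborel) (\<lambda>(x, y). (w x - w y) * (\<phi> x - \<phi> y) * frac_kernel s (x - y))"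
    by (rule integrable_weak_form[where B = ?B, OF s _ _ _ Bfin \<phi>abs \<phi>(4) lip energy]) auto
  have minus: "(\<lambda>(x, y). (bump z x - bump z y) * (\<phi> x - \<phi> y) * frac_kernel s (x - y))
     = (\<lambda>p. - (case p of (x, y) \<Rightarrow> (w x - w y) * (\<phi> x - \<phi> y) * frac_kernel s (x - y)))"
    by (auto simp: fun_eq_iff w_def algebra_simps)
  show "integrable (lborel \<Otimes>\<^sub>M lborel) (\<lambda>(x, y). (bump z x - bump z y) * (\<phi> x - \<phi> y) * frac_kernel s (x - y))"
    unfolding minus using form by simp
  define c where "c = (\<lambda>m::nat. 1 / (real m + 1))"
  have c: "0 < c m" for m by (auto simp: c_def)
  have c0: "c \<longlonglongrightarrow> 0" unfolding c_def by real_asymp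
  have closed_S: "closed {(x::'a, y). c m \<le> norm (x - y)}" for m
    unfolding case_prod_beta by (intro closed_Collect_le continuous_intros)
  have "2 * (- (32 / 2 * (\<integral>h. kern_maj s h \<partial>(lborel :: 'a measure)))) * (\<integral>x. \<phi> x \<partial>lborel)
      \<le> (\<integral>(x, y). (w x - w y) * (\<phi> x - \<phi> y) * frac_kernel s (x - y) \<partial>(lborel \<Otimes>\<^sub>M lborel))"
  proof (rule weak_form_ge[where S = "\<lambda>m. {(x, y). c m \<le> norm (x - y)}", OF _ _ _ _ _ \<phi>(1,2) _ _ form])
    show "{(x::'a, y). c m \<le> norm (x - y)} \<in> sets borel" for m by (rule borel_closed[OF closed_S])
    show "(y, x) \<in> {(x, y). c m \<le> norm (x - y)}" if "(x, y) \<in> {(x, y). c m \<le> norm (x - y)}" for m and x y :: 'a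
      using that by (simp add: norm_minus_commute)
    show "\<forall>\<^sub>F m in sequentially. (x, y) \<in> {(x, y). c m \<le> norm (x - y)}" if "(w x - w y) * (\<phi> x - \<phi> y) \<noteq> 0" for x y
    proof -
      have "0 < norm (x - y)" using that by auto
      from order_tendstoD(2)[OF c0 this] show ?thesis by eventually_elim auto
    qed
    show "integrable (lborel \<Otimes>\<^sub>M lborel) (\<lambda>(x, y). indicator {(x, y). c m \<le> norm (x - y)} (x, y) * (w x - w y) * \<phi> x * frac_kernel s (x - y))" for m
      by (rule integrable_truncated_weak_form[where B = ?B and c = "c m", OF s _ _ _ _ Bfin \<phi>abs \<phi>(4) lip])
         (use c[of m] borel_closed[OF closed_S[of m]] in auto)
    show "- (32 / 2 * (\<integral>h. kern_maj s h \<partial>(lborel :: 'a measure))) \<le>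
       (\<integral>y. indicator {(x, y). c m \<le> norm (x - y)} (x, y) * (w x - w y) * frac_kernel s (x - y) \<partial>lborel)" if "0 < \<phi> x" for m x
    proof -
      have x: "x \<in> ?B" using that \<phi>(4)[of x] by (cases "x \<in> ?B") auto
      have "\<bar>bump z y\<bar> \<le> 1" for y using bump_range[of z y] by simp
      from semiconvex_cutoff_ge[OF s bump_measurable this c[of m] _ bump_semiconvex[OF s x]]
      have "- (32 / 2 * (\<integral>h. kern_maj s h \<partial>(lborel :: 'a measure))) \<le>
        (\<integral>y. indicator {(x, y). c m \<le> norm (x - y)} (x, y) * (bump z y - bump z x) * frac_kernel s (x - y) \<partial>lborel)" by simp
      then show ?thesis by (simp add: w_def)
    qed
  qed auto
  then show "(\<integral>(x, y). (bump z x - bump z y) * (\<phi> x - \<phi> y) * frac_kernel s (x - y) \<partial>(lborel \<Otimes>\<^sub>M lborel))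
      \<le> 32 * (\<integral>h. kern_maj s h \<partial>(lborel :: 'a measure)) * (\<integral>x. \<phi> x \<partial>lborel)"
    unfolding minus by simp
qed

section \<open>Comparison with the barrier\<close>

text \<open>A nonempty open set is not negligible. This is how statements that hold only almost
  everywhere are confronted with strict inequalities between continuous functions.\<close>

lemma AE_lebesgue_open_ex:
  fixes U :: "'a::euclidean_space set"
  assumes "AE x in lebesgue. P x" "open U" "U \<noteq> {}"
  shows "\<exists>x\<in>U. P x"
proof (rule ccontr)
  assume "\<not> (\<exists>x\<in>U. P x)"
  then have sub: "U \<subseteq> {x. \<not> P x}" by auto
  obtain N where "\<And>x. x \<in> space lebesgue - N \<Longrightarrow> P x" "N \<in> null_sets lebesgue"
    using AE_E3[OF assms(1)] by blast
  then have N: "N \<in> null_sets lebesgue" "{x. \<not> P x} \<subseteq> N" by auto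
  have "negligible U"
    by (rule negligible_subset[of N]) (use N sub in \<open>auto simp: negligible_iff_null_sets\<close>)
  then show False using open_not_negligible assms by blast
qed

lemma frac_kernel_tail_pos:
  fixes e :: "'a::euclidean_space"
  assumes "e \<noteq> 0" "0 < r"
  shows "0 < frac_kernel_tail s e r"
proof (rule ccontr)
  assume "\<not> 0 < frac_kernel_tail s e r"
  then have "frac_kernel_tail s e r = 0" by simp
  then have "AE h in lborel. ennreal (frac_kernel s h) * indicator {r<..} (e \<bullet> h) = 0"
    unfolding frac_kernel_tail_def by (subst (asm) nn_integral_0_iff_AE) auto
  then have ae: "AE h in lebesgue. ennreal (frac_kernel s h) * indicator {r<..} (e \<bullet> h) = 0"
    by (rule AE_completion)
  have "open {h. r < e \<bullet> h}" by (intro open_Collect_less continuous_intros)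
  moreover have "(2 * r / (e \<bullet> e)) *\<^sub>R e \<in> {h. r < e \<bullet> h}" using assms by simp
  ultimately obtain h where h: "r < e \<bullet> h" "ennreal (frac_kernel s h) * indicator {r<..} (e \<bullet> h) = 0"
    using AE_lebesgue_open_ex[OF ae] by blast
  have "h \<noteq> 0" using h(1) assms by auto
  then have "0 < frac_kernel s h" by (simp add: frac_kernel_def)
  then show False using h by simp
qed

lemma gagliardo_eq_kernel:
  fixes f :: "real ^ 'n \<Rightarrow> real"
  assumes [measurable]: "f \<in> borel_measurable borel" and D: "D \<in> sets borel"
  shows "gagliardo s D f = (\<integral>\<^sup>+ z. ennreal (indicator D z * (case z of (x, y) \<Rightarrow> (f x - f y)\<^sup>2 * frac_kernel s (x - y)))
      \<partial>(lborel \<Otimes>\<^sub>M lborel))"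
proof -
  have D' [measurable]: "D \<in> sets (borel \<Otimes>\<^sub>M borel)" using D unfolding borel_prod .
  have "(\<lambda>z. indicator D z * ((f (fst z) - f (snd z))\<^sup>2 * frac_kernel s (fst z - snd z))) \<in> borel_measurable (borel \<Otimes>\<^sub>M borel)"
    by (intro borel_measurable_times borel_measurable_indicator D') measurable
  then have m: "(\<lambda>z. ennreal (indicator D z * (case z of (x, y) \<Rightarrow> (f x - f y)\<^sup>2 * frac_kernel s (x - y)))) \<in> borel_measurable (borel \<Otimes>\<^sub>M borel)"
    by (intro measurable_compose[OF _ measurable_ennreal]) (simp add: case_prod_beta)
  have "gagliardo s D f = (\<integral>\<^sup>+ z. ennreal (indicator D z * (case z of (x, y) \<Rightarrow> (f x - f y)\<^sup>2 * frac_kernel s (x - y)))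
      \<partial>(lebesgue \<Otimes>\<^sub>M lebesgue))"
    unfolding gagliardo_def
    by (intro nn_integral_cong) (auto simp: indicator_def frac_kernel_def)
  also have "\<dots> = (\<integral>\<^sup>+ z. ennreal (indicator D z * (case z of (x, y) \<Rightarrow> (f x - f y)\<^sup>2 * frac_kernel s (x - y)))
      \<partial>(lborel \<Otimes>\<^sub>M lborel))"
    by (rule nn_integral_lebesgue_pair[OF m])
  finally show ?thesis .
qed

section \<open>Truncation of \<open>u\<close> at \<open>g\<close>\<close>

text \<open>Positive parts are 1-Lipschitz, so near the diagonal the increments of
  \<open>\<phi>\<close> are bounded by those of \<open>u\<close>, whose energy on \<open>D\<close>
  is finite, and those of \<open>g\<close>, which is Lipschitz as seen from \<open>B\<close>; at
  distance 1/4 and beyond the bound \<open>\<Phi>\<close> takes over.\<close>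

lemma truncation_energy_integrable:
  fixes u g :: "'a::euclidean_space \<Rightarrow> real"
  assumes s: "0 < s" "s < 1"
    and [measurable]: "u \<in> borel_measurable borel" "\<phi> \<in> borel_measurable borel" "B \<in> sets borel"
    and B: "emeasure lborel B < \<infinity>"
    and \<phi>: "\<And>x. \<phi> x = max 0 (u x - g x)" "\<And>x. \<phi> x \<le> \<Phi>" "\<And>x. x \<notin> B \<Longrightarrow> \<phi> x = 0"
    and g: "\<And>x y. x \<in> B \<Longrightarrow> \<bar>g x - g y\<bar> \<le> L * min (norm (x - y)) (norm (x - y) powr s)"
    and D: "\<And>x y. x \<in> B \<or> y \<in> B \<Longrightarrow> (x, y) \<in> D"
    and energy: "integrable (lborel \<Otimes>\<^sub>M lborel) (\<lambda>z. indicator D z * (case z of (x, y) \<Rightarrow> (u x - u y)\<^sup>2 * frac_kernel s (x - y)))"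
  shows "integrable (lborel \<Otimes>\<^sub>M lborel) (\<lambda>(x, y). (\<phi> x - \<phi> y)\<^sup>2 * frac_kernel s (x - y))"
proof (rule Bochner_Integration.integrable_bound)
  let ?C = "2 * L\<^sup>2 + 16 * \<Phi>\<^sup>2"
  let ?Fu = "\<lambda>z. indicator D z * (case z of (x, y) \<Rightarrow> (u x - u y)\<^sup>2 * frac_kernel s (x - y))"
  have iB: "integrable lborel (indicator B :: 'a \<Rightarrow> real)" using B by simp
  have b1: "integrable (lborel \<Otimes>\<^sub>M lborel) (\<lambda>(x, y). indicator B x * kern_maj s (x - y) :: real)"
    by (rule integrable_pair_times_diff[OF iB integrable_kern_maj[OF s]])
  have b2: "integrable (lborel \<Otimes>\<^sub>M lborel) (\<lambda>(x, y). indicator B y * kern_maj s (y - x) :: real)"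
    using lborel_pair.integrable_product_swap[OF b1] by simp
  show "integrable (lborel \<Otimes>\<^sub>M lborel) (\<lambda>z. ?C * (case z of (x, y) \<Rightarrow> indicator B x * kern_maj s (x - y))
      + ?C * (case z of (x, y) \<Rightarrow> indicator B y * kern_maj s (y - x)) + 2 * ?Fu z)"
    using b1 b2 energy by simp
  have \<phi>0: "0 \<le> \<phi> x" for x by (simp add: \<phi>(1))
  have key: "(\<phi> x - \<phi> y)\<^sup>2 * frac_kernel s (x - y) \<le> ?C * kern_maj s (x - y) + 2 * ((u x - u y)\<^sup>2 * frac_kernel s (x - y))"
    if x: "x \<in> B" for x y
  proof -
    define r where "r = norm (x - y)"
    define \<mu> where "\<mu> = min (r\<^sup>2) (r powr s)"
    have r0: "0 \<le> r" by (simp add: r_def)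
    have \<mu>0: "0 \<le> \<mu>" by (simp add: \<mu>_def)
    have "(\<phi> x - \<phi> y)\<^sup>2 \<le> ?C * \<mu> + 2 * (u x - u y)\<^sup>2"
    proof (cases "r < 1 / 4")
      case True
      have "r\<^sup>2 \<le> r powr s" using True s powr_mono'[of s 2 r] r0 by (simp add: powr_numeral)
      then have \<mu>: "\<mu> = r\<^sup>2" by (simp add: \<mu>_def)
      have "\<bar>g x - g y\<bar> \<le> \<bar>L\<bar> * r"
        using g[OF x, of y] unfolding r_def[symmetric]
        by (rule order_trans) (intro mult_mono, auto simp: r0)
      then have "\<bar>g x - g y\<bar>\<^sup>2 \<le> (\<bar>L\<bar> * r)\<^sup>2" by (rule power_mono) simp
      then have G: "(g x - g y)\<^sup>2 \<le> L\<^sup>2 * \<mu>" by (simp add: \<mu> power_mult_distrib)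
      have "\<bar>\<phi> x - \<phi> y\<bar> \<le> \<bar>(u x - u y) - (g x - g y)\<bar>" unfolding \<phi>(1) by linarith
      then have "(\<phi> x - \<phi> y)\<^sup>2 \<le> ((u x - u y) - (g x - g y))\<^sup>2" by (simp add: abs_le_square_iff)
      also have "\<dots> \<le> 2 * (u x - u y)\<^sup>2 + 2 * (g x - g y)\<^sup>2"
        using zero_le_power2[of "(u x - u y) + (g x - g y)"] by (simp add: power2_eq_square algebra_simps)
      finally have "(\<phi> x - \<phi> y)\<^sup>2 \<le> 2 * (u x - u y)\<^sup>2 + 2 * (L\<^sup>2 * \<mu>)" using G by linarith
      moreover have "0 \<le> 16 * \<Phi>\<^sup>2 * \<mu>" using \<mu>0 by simp
      ultimately show ?thesis unfolding distrib_right by linarith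
    next
      case False
      have "1 / 4 \<le> r powr s"
      proof -
        have "(1 / 4 :: real) = (1 / 4) powr 1" by simp
        also have "\<dots> \<le> (1 / 4) powr s" using s by (intro powr_mono') auto
        also have "\<dots> \<le> r powr s" using False s by (intro powr_mono2) auto
        finally show ?thesis .
      qed
      moreover have "(1 / 4)\<^sup>2 \<le> r\<^sup>2" using False by (intro power_mono) auto
      ultimately have \<mu>: "1 \<le> 16 * \<mu>" unfolding \<mu>_def by (simp add: min_def power2_eq_square)
      have "\<bar>\<phi> x - \<phi> y\<bar> \<le> \<bar>\<Phi>\<bar>" using \<phi>0[of x] \<phi>0[of y] \<phi>(2)[of x] \<phi>(2)[of y] by linarith
      then have "(\<phi> x - \<phi> y)\<^sup>2 \<le> \<Phi>\<^sup>2 * 1" by (simp add: abs_le_square_iff)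
      also have "\<dots> \<le> \<Phi>\<^sup>2 * (16 * \<mu>)" using \<mu> by (intro mult_left_mono) auto
      finally have "(\<phi> x - \<phi> y)\<^sup>2 \<le> 16 * \<Phi>\<^sup>2 * \<mu>" by simp
      moreover have "0 \<le> 2 * L\<^sup>2 * \<mu>" using \<mu>0 by simp
      moreover have "0 \<le> (u x - u y)\<^sup>2" by simp
      ultimately show ?thesis unfolding distrib_right by linarith
    qed
    from mult_right_mono[OF this frac_kernel_nonneg[of s "x - y"]]
    show ?thesis by (simp add: kern_maj_def \<mu>_def r_def distrib_right mult.assoc)
  qed
  show "AE z in lborel \<Otimes>\<^sub>M lborel. norm (case z of (x, y) \<Rightarrow> (\<phi> x - \<phi> y)\<^sup>2 * frac_kernel s (x - y))
    \<le> norm (?C * (case z of (x, y) \<Rightarrow> indicator B x * kern_maj s (x - y))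
      + ?C * (case z of (x, y) \<Rightarrow> indicator B y * kern_maj s (y - x)) + 2 * ?Fu z)"
  proof (rule AE_I2)
    fix z :: "'a \<times> 'a"
    obtain x y where z: "z = (x, y)" by (cases z)
    let ?lhs = "(\<phi> x - \<phi> y)\<^sup>2 * frac_kernel s (x - y)"
    have nn: "0 \<le> ?C * (indicator B x * kern_maj s (x - y))" "0 \<le> ?C * (indicator B y * kern_maj s (y - x))"
      "0 \<le> ?Fu (x, y)" "0 \<le> ?lhs"
      by (auto intro!: mult_nonneg_nonneg add_nonneg_nonneg simp: kern_maj_nonneg frac_kernel_nonneg)
    have sym: "?lhs = (\<phi> y - \<phi> x)\<^sup>2 * frac_kernel s (y - x)"
      "(u x - u y)\<^sup>2 * frac_kernel s (x - y) = (u y - u x)\<^sup>2 * frac_kernel s (y - x)"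
      by (simp_all add: frac_kernel_commute[of s x y] power2_commute)
    have "?lhs \<le> ?C * (indicator B x * kern_maj s (x - y)) + ?C * (indicator B y * kern_maj s (y - x)) + 2 * ?Fu (x, y)"
    proof -
      consider "x \<in> B" | "y \<in> B" | "x \<notin> B" "y \<notin> B" by blast
      then show ?thesis
      proof cases
        case 1 then show ?thesis using key[OF 1, of y] nn D[of x y] by simp
      next
        case 2
        then have "?Fu (x, y) = (u y - u x)\<^sup>2 * frac_kernel s (y - x)" using D[of x y] sym(2) by simp
        then show ?thesis using 2 key[OF 2, of x] nn(1) unfolding sym(1) by simp
      next
        case 3
        then have "?lhs = 0" using \<phi>(3) by simp
        then show ?thesis using nn by linarith
      qed
    qed
    then show "norm (case z of (x, y) \<Rightarrow> (\<phi> x - \<phi> y)\<^sup>2 * frac_kernel s (x - y))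
    \<le> norm (?C * (case z of (x, y) \<Rightarrow> indicator B x * kern_maj s (x - y))
      + ?C * (case z of (x, y) \<Rightarrow> indicator B y * kern_maj s (y - x)) + 2 * ?Fu z)"
      using nn unfolding z by simp
  qed
qed measurable

text \<open>With \<open>f = u - g\<close>, the map from \<open>f\<close> to its positive part
  \<open>p\<close> is monotone and 1-Lipschitz, so the squared increment of \<open>p\<close> is at
  most the product of the increments of \<open>f\<close> and \<open>p\<close>. Expanding the square
  leaves the cross term with \<open>g\<close>; after integration, the energy of
  \<open>min u g\<close> lies below that of \<open>u\<close> by at least twice the form of
  \<open>g\<close> against \<open>p\<close>.\<close>

lemma truncation_energy_gain:
  fixes u u' g g' :: real
  defines "p \<equiv> max 0 (u - g)" and "p' \<equiv> max 0 (u' - g')"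
  shows "((u - p) - (u' - p'))\<^sup>2 \<le> (u - u')\<^sup>2 - 2 * ((g - g') * (p - p'))"
proof -
  define f f' where "f = u - g" and "f' = u' - g'"
  have p: "p = max 0 f" "p' = max 0 f'" by (simp_all add: p_def p'_def f_def f'_def)
  have "0 \<le> (p - p') * (2 * (f - f') - (p - p'))"
  proof -
    consider "p = p'" | "p < p'" "p - p' \<ge> f - f'" | "p > p'" "p - p' \<le> f - f'"
      unfolding p by linarith
    then show ?thesis
      by cases (auto intro!: mult_nonneg_nonneg mult_nonpos_nonpos)
  qed
  then show ?thesis unfolding f_def f'_def by (simp add: power2_eq_square algebra_simps)
qed

text \<open>This is the weighted arithmetic-geometric mean of \<open>t powr s\<close> and 1.
  Equality at \<open>t = 1\<close> is what allows the barrier almost to touch \<open>u\<close> at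
  height one.\<close>

lemma powr_le_affine:
  fixes t \<beta> s :: real
  assumes "0 \<le> \<beta>" "\<beta> < s" "0 < t"
  shows "t powr \<beta> \<le> (1 - \<beta> / s) + \<beta> / s * t powr s"
proof -
  have "(t powr s) powr (\<beta> / s) * 1 powr (1 - \<beta> / s) \<le> \<beta> / s * t powr s + (1 - \<beta> / s) * 1"
    using assms by (intro Youngs_inequality_0) auto
  then show ?thesis using assms by (simp add: powr_powr add.commute)
qed

lemma in_Hs_bounded_support:
  fixes \<phi> :: "real ^ 'n \<Rightarrow> real"
  assumes [measurable]: "\<phi> \<in> borel_measurable borel" "B \<in> sets borel"
    and B: "emeasure lborel B < \<infinity>" and \<phi>: "\<And>x. \<bar>\<phi> x\<bar> \<le> \<Phi>" "\<And>x. x \<notin> B \<Longrightarrow> \<phi> x = 0"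
    and energy: "integrable (lborel \<Otimes>\<^sub>M lborel) (\<lambda>(x, y). (\<phi> x - \<phi> y)\<^sup>2 * frac_kernel s (x - y))"
  shows "in_Hs s UNIV \<phi>"
  unfolding in_Hs_def
proof (intro conjI)
  show "\<phi> \<in> borel_measurable (lebesgue_on UNIV)"
    unfolding lebesgue_on_UNIV_eq by (rule measurable_completion) auto
  have "(\<integral>\<^sup>+ x \<in> UNIV. ennreal (\<bar>\<phi> x\<bar>\<^sup>2) \<partial>lebesgue) = (\<integral>\<^sup>+ x. ennreal (\<bar>\<phi> x\<bar>\<^sup>2) \<partial>lborel)"
    by (simp add: nn_integral_completion)
  also have "\<dots> \<le> (\<integral>\<^sup>+ x. ennreal (\<Phi>\<^sup>2) * indicator B x \<partial>lborel)"
  proof (rule nn_integral_mono)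
    fix x
    have "\<bar>\<phi> x\<bar>\<^sup>2 \<le> \<Phi>\<^sup>2" by (intro power_mono \<phi>(1)) simp
    then show "ennreal (\<bar>\<phi> x\<bar>\<^sup>2) \<le> ennreal (\<Phi>\<^sup>2) * indicator B x"
      using \<phi>(2)[of x] by (cases "x \<in> B") (auto intro: ennreal_leI)
  qed
  also have "\<dots> = ennreal (\<Phi>\<^sup>2) * emeasure lborel B" by (simp add: nn_integral_cmult_indicator)
  also have "\<dots> < \<infinity>" using B by (simp add: ennreal_mult_less_top)
  finally show "(\<integral>\<^sup>+ x \<in> UNIV. ennreal (\<bar>\<phi> x\<bar>\<^sup>2) \<partial>lebesgue) < \<infinity>" .
  have "gagliardo s (UNIV \<times> UNIV) \<phi> = (\<integral>\<^sup>+ z. ennreal (case z of (x, y) \<Rightarrow> (\<phi> x - \<phi> y)\<^sup>2 * frac_kernel s (x - y)) \<partial>(lborel \<Otimes>\<^sub>M lborel))"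
    by (subst gagliardo_eq_kernel) auto
  also have "\<dots> = ennreal (\<integral>z. (case z of (x, y) \<Rightarrow> (\<phi> x - \<phi> y)\<^sup>2 * frac_kernel s (x - y)) \<partial>(lborel \<Otimes>\<^sub>M lborel))"
    by (rule nn_integral_eq_integral[OF energy]) (auto simp: frac_kernel_nonneg)
  also have "\<dots> < \<infinity>" by simp
  finally show "gagliardo s (UNIV \<times> UNIV) \<phi> < \<infinity>" .
qed

section \<open>The contradiction with minimality\<close>

text \<open>Minimality is assumed only for the Gagliardo term and only for downward truncations that
  do not cross zero, so that the statement mentions neither the set nor the perimeter and serves
  \<open>u\<close> and \<open>- u\<close> alike.\<close>

lemma nonpos_of_minimal_under_truncation:
  fixes u :: "real ^ 'n \<Rightarrow> real"
  assumes s: "0 < s" "s < 1" and \<beta>: "0 \<le> \<beta>" "\<beta> < s" and cont: "continuous_on UNIV u" and e: "norm e = 1"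
    and homog: "\<And>t x. 0 < t \<Longrightarrow> u (t *\<^sub>R x) = t powr \<beta> * u x"
    and neg: "\<And>x. e \<bullet> x \<le> 0 \<Longrightarrow> u x \<le> 0"
    and bdd: "\<And>x. e \<bullet> x = 1 \<Longrightarrow> u x \<le> C"
    and fin: "\<And>R. 0 < R \<Longrightarrow> gagliardo s (UNIV - (- ball 0 R) \<times> (- ball 0 R)) u < \<infinity>"
    and min: "\<And>R \<phi>. 0 < R \<Longrightarrow> \<phi> \<in> borel_measurable borel \<Longrightarrow> in_Hs s UNIV \<phi> \<Longrightarrow> (\<And>x. 0 \<le> \<phi> x)
        \<Longrightarrow> (\<And>x. \<phi> x \<noteq> 0 \<Longrightarrow> \<phi> x \<le> u x) \<Longrightarrow> (\<And>x. x \<notin> ball 0 R \<Longrightarrow> \<phi> x = 0)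
        \<Longrightarrow> gagliardo s (UNIV - (- ball 0 R) \<times> (- ball 0 R)) u
          \<le> gagliardo s (UNIV - (- ball 0 R) \<times> (- ball 0 R)) (\<lambda>x. u x - \<phi> x)"
  shows "u x \<le> 0"
proof (rule ccontr)
  assume "\<not> u x \<le> 0"
  then have ux: "0 < u x" "0 < e \<bullet> x" using neg[of x] by (auto simp: not_le[symmetric])
  have um [measurable]: "u \<in> borel_measurable borel" using cont by (rule borel_measurable_continuous_onI)
  define M where "M = (SUP y\<in>{y. e \<bullet> y = 1}. u y)"
  have bdd': "bdd_above (u ` {y. e \<bullet> y = 1})" using bdd by (intro bdd_aboveI2[of _ _ C]) auto
  have uM: "u y \<le> M" if "e \<bullet> y = 1" for y
    unfolding M_def using that bdd' by (intro cSUP_upper) auto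
  have x1: "e \<bullet> ((1 / (e \<bullet> x)) *\<^sub>R x) = 1" using ux by simp
  have M: "0 < M"
  proof -
    have "0 < u ((1 / (e \<bullet> x)) *\<^sub>R x)" using ux by (subst homog) auto
    then show ?thesis using uM[OF x1] by linarith
  qed
  \<comment> \<open>The weights sum to one, so the barrier equals 1 on
    \<open>e \<bullet> y = 1\<close>, and \<open>\<beta> < s\<close> makes \<open>a\<close>
    positive.\<close>
  define a b where "a = 1 - \<beta> / s" and "b = \<beta> / s"
  have ab: "0 < a" "0 \<le> b" using \<beta> s by (auto simp: a_def b_def)
  define w where "w = half_space_barrier e a b s"
  have [measurable]: "w \<in> borel_measurable borel" unfolding w_def by measurable
  have w_pos: "a \<le> w y" if "0 < e \<bullet> y" for y using that ab by (simp add: w_def half_space_barrier_def)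
  have u_le: "u y \<le> M * w y" for y
  proof (cases "0 < e \<bullet> y")
    case True
    have "u y = u ((e \<bullet> y) *\<^sub>R ((1 / (e \<bullet> y)) *\<^sub>R y))" using True by simp
    also have "\<dots> = (e \<bullet> y) powr \<beta> * u ((1 / (e \<bullet> y)) *\<^sub>R y)" using True by (intro homog)
    also have "\<dots> \<le> (e \<bullet> y) powr \<beta> * M" using True by (intro mult_left_mono uM) auto
    also have "\<dots> \<le> (a + b * (e \<bullet> y) powr s) * M"
      unfolding a_def b_def using powr_le_affine[OF \<beta> True] M by (intro mult_right_mono) auto
    finally show ?thesis using True by (simp add: w_def half_space_barrier_def mult.commute)
  next
    case False then show ?thesis using neg[of y] by (simp add: w_def half_space_barrier_def)
  qed
  define T where "T = enn2real (frac_kernel_tail s e 2)"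
  have "e \<noteq> 0" using e by auto
  then have T: "0 < T"
    unfolding T_def using frac_kernel_tail_pos[of e 2 s] frac_kernel_tail_finite[OF s, of 2 e] e
    by (subst enn2real_positive_iff) auto
  define \<kappa> where "\<kappa> = (\<integral>h. kern_maj s h \<partial>(lborel :: (real ^ 'n) measure))"
  have \<kappa>: "0 \<le> \<kappa>" unfolding \<kappa>_def by (intro Bochner_Integration.integral_nonneg kern_maj_nonneg)
  \<comment> \<open>The first bound keeps \<open>g\<close> positive on the support of the bump. The
    second makes the cost \<open>32 * \<kappa> * \<delta>\<close> of the bump smaller than the gain
    \<open>2 * M * a * T\<close> of the barrier; the added 1 keeps the denominator positive.\<close>
  define \<delta> where "\<delta> = min (M * a / 2) (M * a * T / (32 * \<kappa> + 1))"
  have \<delta>: "0 < \<delta>" unfolding \<delta>_def using M ab T \<kappa> by simp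
  have \<delta>1: "\<delta> < M * a" unfolding \<delta>_def using M ab by (simp add: min_less_iff_disj)
  have \<delta>2: "\<delta> * (32 * \<kappa>) < 2 * (M * (a * T))"
  proof -
    have "\<delta> \<le> M * a * T / (32 * \<kappa> + 1)" by (simp add: \<delta>_def)
    then have "\<delta> * (32 * \<kappa> + 1) \<le> M * a * T" using \<kappa> by (simp add: field_simps)
    moreover have "0 < M * (a * T)" using M ab T by simp
    ultimately show ?thesis using \<delta> by (simp add: algebra_simps)
  qed
  \<comment> \<open>The supremum is only approached within the height \<open>\<delta>\<close> of the
    bump, which is enough for \<open>g z = M - \<delta> < u z\<close>.\<close>
  obtain z where z: "e \<bullet> z = 1" "M - \<delta> < u z"
  proof -
    have "{y. e \<bullet> y = 1} \<noteq> {}" using x1 by blast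
    from less_cSUP_iff[OF this bdd', of "M - \<delta>"] have "\<exists>y\<in>{y. e \<bullet> y = 1}. M - \<delta> < u y"
      using \<delta> unfolding M_def[symmetric] by simp
    then show thesis using that by auto
  qed
  let ?B = "ball z (1 / 4)"
  define g where "g = (\<lambda>y. M * w y - \<delta> * bump z y)"
  define \<phi> where "\<phi> = (\<lambda>y. max 0 (u y - g y))"
  have gm [measurable]: "g \<in> borel_measurable borel" unfolding g_def by measurable
  have \<phi>m [measurable]: "\<phi> \<in> borel_measurable borel" unfolding \<phi>_def by measurable
  have \<phi>0: "0 \<le> \<phi> y" for y by (simp add: \<phi>_def)
  have \<phi>B: "\<phi> y = 0" if "y \<notin> ?B" for y
    using u_le[of y] bump_outside[OF that] by (simp add: \<phi>_def g_def)
  have \<tau>: "3 / 4 \<le> e \<bullet> y \<and> e \<bullet> y \<le> 5 / 4" if "y \<in> ?B" for y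
  proof -
    have "\<bar>e \<bullet> y - 1\<bar> \<le> norm (y - z)"
      using Cauchy_Schwarz_ineq2[of e "y - z"] e z by (simp add: inner_diff_right)
    moreover have "norm (y - z) < 1 / 4" using that by (simp add: dist_norm norm_minus_commute)
    ultimately show ?thesis by (simp add: abs_le_iff)
  qed
  have g_pos: "0 < g y" if "y \<in> ?B" for y
  proof -
    have "M * a \<le> M * w y" using w_pos[of y] \<tau>[OF that] M by (intro mult_left_mono) auto
    moreover have "\<delta> * bump z y \<le> \<delta> * 1" using \<delta> bump_range[of z y] by (intro mult_left_mono) auto
    ultimately show ?thesis using \<delta>1 by (simp add: g_def)
  qed
  \<comment> \<open>Truncation acts only where \<open>g\<close> is positive, so the competitor is
    positive wherever it differs from \<open>u\<close>; this keeps the sign constraint with the same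
    set.\<close>
  have \<phi>u: "\<phi> y \<le> u y" if "\<phi> y \<noteq> 0" for y
  proof -
    have "y \<in> ?B" using that \<phi>B[of y] by (cases "y \<in> ?B") auto
    then show ?thesis using g_pos[of y] that by (auto simp: \<phi>_def max_def split: if_splits)
  qed
  define \<Phi> where "\<Phi> = \<delta>"
  have \<phi>\<Phi>: "\<phi> y \<le> \<Phi>" for y
  proof -
    have "\<delta> * bump z y \<le> \<delta> * 1" using \<delta> bump_range[of z y] by (intro mult_left_mono) auto
    then have "u y - g y \<le> \<delta>" using u_le[of y] unfolding g_def by linarith
    then show ?thesis using \<delta> by (simp add: \<phi>_def \<Phi>_def)
  qed
  have Bfin: "emeasure lborel ?B < \<infinity>" by (rule emeasure_lborel_ball_finite)
  have \<phi>abs: "\<bar>\<phi> y\<bar> \<le> \<Phi>" for y using \<phi>0[of y] \<phi>\<Phi>[of y] by simp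
  have \<phi>int: "integrable lborel \<phi>"
  proof (rule Bochner_Integration.integrable_bound)
    show "integrable lborel (\<lambda>y. \<Phi> * indicator ?B y)" using Bfin by simp
    show "AE y in lborel. norm (\<phi> y) \<le> norm (\<Phi> * indicator ?B y)"
      using \<phi>abs \<phi>B by (intro AE_I2) (auto simp: indicator_def intro: order_trans[OF _ abs_ge_self])
  qed measurable
  define L where "L = M * (100 * (a + b)) + 16 * \<delta>"
  have glip: "\<bar>g x - g y\<bar> \<le> L * min (norm (x - y)) (norm (x - y) powr s)" if x: "x \<in> ?B" for x y
  proof -
    let ?m = "min (norm (x - y)) (norm (x - y) powr s)"
    have "g x - g y = M * (w x - w y) - \<delta> * (bump z x - bump z y)" by (simp add: g_def algebra_simps)
    then have "\<bar>g x - g y\<bar> \<le> M * \<bar>w x - w y\<bar> + \<delta> * \<bar>bump z x - bump z y\<bar>"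
      using M \<delta> abs_triangle_ineq4[of "M * (w x - w y)" "\<delta> * (bump z x - bump z y)"] by (simp add: abs_mult)
    also have "\<dots> \<le> M * (100 * (a + b) * ?m) + \<delta> * (16 * ?m)"
      using M \<delta> half_space_barrier_lipschitz[OF s e _ ab(2), of a x y] ab \<tau>[OF x] bump_lipschitz[OF s x, of y]
      unfolding w_def by (intro add_mono mult_left_mono) auto
    finally show ?thesis by (simp add: L_def algebra_simps)
  qed
  \<comment> \<open>Minimality is used in a single ball, chosen to contain the support of the bump;
    every pair that the truncation affects then lies in \<open>D\<close>.\<close>
  define R where "R = norm z + 1"
  have R: "0 < R" by (simp add: R_def add_nonneg_pos)
  have BR: "?B \<subseteq> ball 0 R"
  proof
    fix y assume "y \<in> ?B"
    then have "norm (y - z) < 1 / 4" by (simp add: dist_norm norm_minus_commute)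
    then show "y \<in> ball 0 R" using norm_triangle_sub[of y z] by (simp add: R_def)
  qed
  define D where "D = UNIV - (- ball (0::real ^ 'n) R) \<times> (- ball (0::real ^ 'n) R)"
  have "closed ((- ball (0::real ^ 'n) R) \<times> (- ball (0::real ^ 'n) R))"
    by (intro closed_Times) (auto simp: closed_Compl)
  then have D: "D \<in> sets borel" unfolding D_def by (intro borel_open open_Diff) auto
  have DB: "(x, y) \<in> D" if "x \<in> ?B \<or> y \<in> ?B" for x y using that BR by (auto simp: D_def)
  define Fu where "Fu = (\<lambda>z. indicator D z * (case z of (x, y) \<Rightarrow> (u x - u y)\<^sup>2 * frac_kernel s (x - y)))"
  have Fu0: "0 \<le> Fu z" for z by (auto simp: Fu_def indicator_def frac_kernel_nonneg split: prod.splits)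
  have gag_u: "gagliardo s D u = (\<integral>\<^sup>+ z. ennreal (Fu z) \<partial>(lborel \<Otimes>\<^sub>M lborel))"
    unfolding Fu_def by (rule gagliardo_eq_kernel[OF um D])
  have D' [measurable]: "D \<in> sets (lborel \<Otimes>\<^sub>M lborel)" using D unfolding lborel_prod by simp
  have Fum: "Fu \<in> borel_measurable (lborel \<Otimes>\<^sub>M lborel)"
    unfolding Fu_def by (intro borel_measurable_times borel_measurable_indicator D') measurable
  have Fu: "integrable (lborel \<Otimes>\<^sub>M lborel) Fu"
    by (rule integrableI_nonneg[OF Fum]) (use fin[OF R] Fu0 in \<open>auto simp: gag_u[symmetric] D_def\<close>)
  have energy: "integrable (lborel \<Otimes>\<^sub>M lborel) (\<lambda>(x, y). (\<phi> x - \<phi> y)\<^sup>2 * frac_kernel s (x - y))"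
    by (rule truncation_energy_integrable[where B = ?B and u = u and g = g and D = D, OF s _ _ _ Bfin _ \<phi>\<Phi> \<phi>B glip DB Fu[unfolded Fu_def]])
       (auto simp: \<phi>_def)
  have Hs: "in_Hs s UNIV \<phi>"
    by (rule in_Hs_bounded_support[OF \<phi>m _ Bfin \<phi>abs \<phi>B energy]) auto
  have le: "gagliardo s D u \<le> gagliardo s D (\<lambda>x. u x - \<phi> x)"
    unfolding D_def by (rule min[OF R \<phi>m Hs \<phi>0 \<phi>u]) (use \<phi>B BR in blast)+
  note X0 = half_space_barrier_weak_form_ge[OF s e less_imp_le[OF ab(1)] ab(2) z(1) \<phi>m \<phi>int \<phi>0 \<phi>\<Phi> \<phi>B energy, folded w_def T_def]
  note X1 = bump_weak_form_le[OF s \<phi>m \<phi>int \<phi>0 \<phi>\<Phi> \<phi>B energy, folded \<kappa>_def]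
  define X where "X = (\<lambda>(x, y). (g x - g y) * (\<phi> x - \<phi> y) * frac_kernel s (x - y))"
  let ?X0 = "\<lambda>(x, y). (w x - w y) * (\<phi> x - \<phi> y) * frac_kernel s (x - y)"
  let ?X1 = "\<lambda>(x, y). (bump z x - bump z y) * (\<phi> x - \<phi> y) * frac_kernel s (x - y)"
  have Xeq: "X p = M * ?X0 p - \<delta> * ?X1 p" for p
    unfolding X_def g_def by (cases p) (simp add: algebra_simps)
  have X: "integrable (lborel \<Otimes>\<^sub>M lborel) X"
    unfolding Xeq[abs_def] using X0(1) X1(1) by simp
  have intX: "(\<integral>p. X p \<partial>(lborel \<Otimes>\<^sub>M lborel)) = M * (\<integral>p. ?X0 p \<partial>(lborel \<Otimes>\<^sub>M lborel)) - \<delta> * (\<integral>p. ?X1 p \<partial>(lborel \<Otimes>\<^sub>M lborel))"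
    unfolding Xeq[abs_def] using X0(1) X1(1) by simp
  have \<phi>pos: "0 < (\<integral>y. \<phi> y \<partial>lborel)"
  proof -
    \<comment> \<open>The test function must have positive integral. Inserting \<open>max 0\<close>
      makes the power continuous on the whole space, so that \<open>U\<close> is open, and
      \<open>\<phi>\<close> is positive on it.\<close>
    define U where "U = {y. 0 < e \<bullet> y} \<inter> {y. 0 < u y - (M * (a + b * (max 0 (e \<bullet> y)) powr s) - \<delta> * bump z y)}"
    have "continuous_on UNIV (bump z)" unfolding bump_def by (intro continuous_intros)
    then have "open U"
      unfolding U_def using cont s
      by (intro open_Int open_Collect_less continuous_intros continuous_on_powr') auto
    have Upos: "0 < \<phi> y" if "y \<in> U" for y
      using that by (auto simp: U_def \<phi>_def g_def w_def half_space_barrier_def max_def)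
    have "z \<in> U"
    proof -
      have "bump z z = 1" by (simp add: bump_def)
      moreover have "a + b = 1" by (simp add: a_def b_def)
      ultimately show ?thesis using z by (simp add: U_def)
    qed
    have "(\<integral>y. \<phi> y \<partial>lborel) \<noteq> 0"
    proof
      assume "(\<integral>y. \<phi> y \<partial>lborel) = 0"
      then have "AE y in lborel. \<phi> y = 0"
        using \<phi>int \<phi>0 by (subst (asm) integral_nonneg_eq_0_iff_AE) auto
      then have "AE y in lebesgue. \<phi> y = 0" by (rule AE_completion)
      then obtain y where "y \<in> U" "\<phi> y = 0"
        using AE_lebesgue_open_ex[of _ U] \<open>open U\<close> \<open>z \<in> U\<close> by blast
      then show False using Upos[of y] by simp
    qed
    moreover have "0 \<le> (\<integral>y. \<phi> y \<partial>lborel)" using \<phi>0 by (intro Bochner_Integration.integral_nonneg)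
    ultimately show ?thesis by simp
  qed
  \<comment> \<open>The strict supersolution property of \<open>g\<close> in weak form: by the
    second bound on \<open>\<delta>\<close>, the gain of the barrier outweighs the cost of the
    bump.\<close>
  have Xpos: "0 < (\<integral>p. X p \<partial>(lborel \<Otimes>\<^sub>M lborel))"
  proof -
    define I where "I = (\<integral>y. \<phi> y \<partial>lborel)"
    have "M * (2 * (a * T) * I) \<le> M * (\<integral>p. ?X0 p \<partial>(lborel \<Otimes>\<^sub>M lborel))"
      using X0(2) M by (intro mult_left_mono) (auto simp: I_def)
    moreover have "\<delta> * (\<integral>p. ?X1 p \<partial>(lborel \<Otimes>\<^sub>M lborel)) \<le> \<delta> * (32 * \<kappa> * I)"
      using X1(2) \<delta> by (intro mult_left_mono) (auto simp: I_def)
    moreover have "\<delta> * (32 * \<kappa>) * I < 2 * (M * (a * T)) * I"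
      using \<delta>2 \<phi>pos by (intro mult_strict_right_mono) (auto simp: I_def)
    ultimately show ?thesis unfolding intX by (simp add: mult_ac)
  qed
  \<comment> \<open>Off \<open>D\<close> both values of \<open>\<phi>\<close> vanish, so the
    pointwise gain holds with the full form \<open>X\<close> although the energies only see
    \<open>D\<close>. Integrated, it makes the competitor cheaper by at least twice a positive
    number.\<close>
  have pt: "indicator D p * (case p of (x, y) \<Rightarrow> ((u x - \<phi> x) - (u y - \<phi> y))\<^sup>2 * frac_kernel s (x - y)) \<le> Fu p - 2 * X p" for p
  proof (cases p)
    case (Pair x y)
    show ?thesis
    proof (cases "p \<in> D")
      case True
      have "((u x - \<phi> x) - (u y - \<phi> y))\<^sup>2 \<le> (u x - u y)\<^sup>2 - 2 * ((g x - g y) * (\<phi> x - \<phi> y))"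
        unfolding \<phi>_def by (rule truncation_energy_gain)
      from mult_right_mono[OF this frac_kernel_nonneg[of s "x - y"]]
      show ?thesis using True by (simp add: Pair Fu_def X_def left_diff_distrib mult.assoc)
    next
      case False
      then have "\<phi> x = 0" "\<phi> y = 0" using DB[of x y] \<phi>B Pair by blast+
      then show ?thesis using False by (simp add: Pair Fu_def X_def)
    qed
  qed
  have pos: "0 \<le> Fu p - 2 * X p" for p
  proof -
    have "0 \<le> indicator D p * (case p of (x, y) \<Rightarrow> ((u x - \<phi> x) - (u y - \<phi> y))\<^sup>2 * frac_kernel s (x - y))"
      by (auto simp: indicator_def frac_kernel_nonneg split: prod.splits)
    then show ?thesis using pt[of p] by linarith
  qed
  have "gagliardo s D (\<lambda>x. u x - \<phi> x) =
     (\<integral>\<^sup>+ p. ennreal (indicator D p * (case p of (x, y) \<Rightarrow> ((u x - \<phi> x) - (u y - \<phi> y))\<^sup>2 * frac_kernel s (x - y))) \<partial>(lborel \<Otimes>\<^sub>M lborel))"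
    by (rule gagliardo_eq_kernel[OF _ D]) measurable
  also have "\<dots> \<le> (\<integral>\<^sup>+ p. ennreal (Fu p - 2 * X p) \<partial>(lborel \<Otimes>\<^sub>M lborel))"
    by (intro nn_integral_mono ennreal_leI pt)
  also have "\<dots> = ennreal (\<integral>p. Fu p - 2 * X p \<partial>(lborel \<Otimes>\<^sub>M lborel))"
  proof (rule nn_integral_eq_integral)
    show "integrable (lborel \<Otimes>\<^sub>M lborel) (\<lambda>p. Fu p - 2 * X p)" using Fu X by simp
    show "AE p in lborel \<Otimes>\<^sub>M lborel. 0 \<le> Fu p - 2 * X p" using pos by (rule AE_I2)
  qed
  finally have "gagliardo s D u \<le> ennreal (\<integral>p. Fu p - 2 * X p \<partial>(lborel \<Otimes>\<^sub>M lborel))" using le by simp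
  moreover have "gagliardo s D u = ennreal (\<integral>p. Fu p \<partial>(lborel \<Otimes>\<^sub>M lborel))"
    unfolding gag_u by (rule nn_integral_eq_integral[OF Fu]) (use Fu0 in auto)
  moreover have "(\<integral>p. Fu p - 2 * X p \<partial>(lborel \<Otimes>\<^sub>M lborel)) < (\<integral>p. Fu p \<partial>(lborel \<Otimes>\<^sub>M lborel))"
    using Fu X Xpos by simp
  moreover have "0 \<le> (\<integral>p. Fu p - 2 * X p \<partial>(lborel \<Otimes>\<^sub>M lborel))" using pos by (intro Bochner_Integration.integral_nonneg)
  ultimately show False by (simp add: ennreal_le_iff)
qed

section \<open>Minimizing cones\<close>

text \<open>This is applied to \<open>u\<close> minus the exterior datum, which need not be Borel;
  therefore the argument stays on the product of the Lebesgue measures instead of passing through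
  \<open>gagliardo_eq_kernel\<close>.\<close>

lemma in_Hs_diff:
  fixes f g :: "real ^ 'n \<Rightarrow> real"
  assumes "in_Hs s UNIV f" "in_Hs s UNIV g"
  shows "in_Hs s UNIV (\<lambda>x. f x - g x)"
proof -
  let ?L = "lebesgue :: (real ^ 'n) measure"
  have [measurable]: "f \<in> borel_measurable ?L" "g \<in> borel_measurable ?L"
    using assms unfolding in_Hs_def lebesgue_on_UNIV_eq by auto
  have sq: "(p - q)\<^sup>2 \<le> 2 * p\<^sup>2 + 2 * q\<^sup>2" for p q :: real
    using zero_le_power2[of "p + q"] by (simp add: power2_eq_square algebra_simps)
  have "(\<integral>\<^sup>+ x \<in> UNIV. ennreal (\<bar>f x - g x\<bar>\<^sup>2) \<partial>?L) \<le> (\<integral>\<^sup>+ x. 2 * ennreal (\<bar>f x\<bar>\<^sup>2) + 2 * ennreal (\<bar>g x\<bar>\<^sup>2) \<partial>?L)"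
  proof (rule nn_integral_mono)
    fix x
    have "ennreal ((f x - g x)\<^sup>2) \<le> ennreal (2 * (f x)\<^sup>2 + 2 * (g x)\<^sup>2)" by (rule ennreal_leI[OF sq])
    then show "ennreal (\<bar>f x - g x\<bar>\<^sup>2) * indicator UNIV x \<le> 2 * ennreal (\<bar>f x\<bar>\<^sup>2) + 2 * ennreal (\<bar>g x\<bar>\<^sup>2)"
      by (simp add: ennreal_mult)
  qed
  also have "\<dots> = 2 * (\<integral>\<^sup>+ x. ennreal (\<bar>f x\<bar>\<^sup>2) \<partial>?L) + 2 * (\<integral>\<^sup>+ x. ennreal (\<bar>g x\<bar>\<^sup>2) \<partial>?L)"
    by (subst nn_integral_add) (auto simp: nn_integral_cmult)
  also have "\<dots> < \<infinity>" using assms unfolding in_Hs_def by (simp add: ennreal_mult_less_top)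
  finally have L2: "(\<integral>\<^sup>+ x \<in> UNIV. ennreal (\<bar>f x - g x\<bar>\<^sup>2) \<partial>?L) < \<infinity>" .
  define G where "G = (\<lambda>(h :: real ^ 'n \<Rightarrow> real) z. ennreal (\<bar>h (fst z) - h (snd z)\<bar>\<^sup>2 / norm (fst z - snd z) powr (real CARD('n) + 2 * s)) :: ennreal)"
  have gag: "gagliardo s (UNIV \<times> UNIV) h = (\<integral>\<^sup>+ z. G h z \<partial>(?L \<Otimes>\<^sub>M ?L))" for h :: "real ^ 'n \<Rightarrow> real"
    unfolding gagliardo_def G_def by (intro nn_integral_cong) auto
  have "(\<lambda>z. fst z - snd z) \<in> borel_measurable (?L \<Otimes>\<^sub>M ?L)"
    by (intro borel_measurable_diff measurable_compose[OF measurable_fst measurable_id_lebesgue_borel]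
        measurable_compose[OF measurable_snd measurable_id_lebesgue_borel])
  from measurable_compose[OF this, of "\<lambda>h. norm h powr (real CARD('n) + 2 * s)" borel]
  have N: "(\<lambda>z. norm (fst z - snd z) powr (real CARD('n) + 2 * s)) \<in> borel_measurable (?L \<Otimes>\<^sub>M ?L)"
    by measurable
  have Gm: "G h \<in> borel_measurable (?L \<Otimes>\<^sub>M ?L)" if [measurable]: "h \<in> borel_measurable ?L" for h
  proof -
    have "(\<lambda>z. h (fst z)) \<in> borel_measurable (?L \<Otimes>\<^sub>M ?L)" "(\<lambda>z. h (snd z)) \<in> borel_measurable (?L \<Otimes>\<^sub>M ?L)"
      by measurable
    then show ?thesis
      unfolding G_def using N
      by (intro measurable_compose[OF _ measurable_ennreal] borel_measurable_divide borel_measurable_power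
          borel_measurable_abs borel_measurable_diff)
  qed
  have "gagliardo s (UNIV \<times> UNIV) (\<lambda>x. f x - g x) \<le> (\<integral>\<^sup>+ z. 2 * G f z + 2 * G g z \<partial>(?L \<Otimes>\<^sub>M ?L))"
    unfolding gag
  proof (rule nn_integral_mono)
    fix z :: "(real ^ 'n) \<times> (real ^ 'n)"
    define N where "N = norm (fst z - snd z) powr (real CARD('n) + 2 * s)"
    have N: "0 \<le> N" by (simp add: N_def)
    let ?p = "f (fst z) - f (snd z)" and ?q = "g (fst z) - g (snd z)"
    have "(?p - ?q)\<^sup>2 / N \<le> (2 * ?p\<^sup>2 + 2 * ?q\<^sup>2) / N" by (rule divide_right_mono[OF sq N])
    also have "\<dots> = 2 * (?p\<^sup>2 / N) + 2 * (?q\<^sup>2 / N)" by (simp add: add_divide_distrib)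
    finally have "ennreal ((?p - ?q)\<^sup>2 / N) \<le> ennreal (2 * (?p\<^sup>2 / N) + 2 * (?q\<^sup>2 / N))"
      by (rule ennreal_leI)
    also have "\<dots> = ennreal (2 * (?p\<^sup>2 / N)) + ennreal (2 * (?q\<^sup>2 / N))" using N by (intro ennreal_plus) auto
    also have "\<dots> = 2 * ennreal (?p\<^sup>2 / N) + 2 * ennreal (?q\<^sup>2 / N)"
      using N by (simp only: ennreal_mult' ennreal_numeral zero_le_numeral)
    finally have "ennreal ((?p - ?q)\<^sup>2 / N) \<le> 2 * ennreal (?p\<^sup>2 / N) + 2 * ennreal (?q\<^sup>2 / N)" .
    moreover have "f (fst z) - g (fst z) - (f (snd z) - g (snd z)) = ?p - ?q" by simp
    ultimately show "G (\<lambda>x. f x - g x) z \<le> 2 * G f z + 2 * G g z"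
      unfolding G_def N_def[symmetric] power2_abs by (simp only:)
  qed
  also have "\<dots> = 2 * gagliardo s (UNIV \<times> UNIV) f + 2 * gagliardo s (UNIV \<times> UNIV) g"
  proof -
    have [measurable]: "G f \<in> borel_measurable (?L \<Otimes>\<^sub>M ?L)" "G g \<in> borel_measurable (?L \<Otimes>\<^sub>M ?L)"
      by (rule Gm, measurable)+
    show ?thesis unfolding gag by (simp add: nn_integral_add nn_integral_cmult)
  qed
  also have "\<dots> < \<infinity>" using assms unfolding in_Hs_def by (simp add: ennreal_mult_less_top)
  finally show ?thesis using L2 unfolding in_Hs_def lebesgue_on_UNIV_eq by auto
qed

lemma gagliardo_uminus: "gagliardo s D (\<lambda>x. - f x) = gagliardo s D f"
  by (simp add: gagliardo_def abs_minus_commute)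

lemma in_Hs_uminus:
  assumes "in_Hs s A f" shows "in_Hs s A (\<lambda>x. - f x)"
  using assms unfolding in_Hs_def gagliardo_uminus by auto

lemma minimizing_pair_energy_finite:
  assumes "minimizing_pair s \<sigma> \<Omega> u E"
  shows "energy s \<sigma> \<Omega> u E < \<infinity>"
  using assms unfolding minimizing_pair_def by (meson order_le_less_trans)

lemma minimizing_pair_gagliardo_finite:
  assumes "minimizing_pair s \<sigma> \<Omega> u E"
  shows "gagliardo s (UNIV - (- \<Omega>) \<times> (- \<Omega>)) u < \<infinity>"
  using minimizing_pair_energy_finite[OF assms] unfolding energy_def by auto

text \<open>Competitors \<open>(u - \<phi>, E)\<close> that keep \<open>E\<close> have the same perimeter, which therefore cancels.\<close>

lemma minimizing_pair_gagliardo_le: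
  assumes min: "minimizing_pair s \<sigma> \<Omega> u E" and \<phi>: "in_Hs s UNIV \<phi>" "\<And>x. x \<notin> \<Omega> \<Longrightarrow> \<phi> x = 0"
    and sign: "\<And>x. 0 \<le> u x \<Longrightarrow> \<phi> x \<le> u x" "\<And>x. u x \<le> 0 \<Longrightarrow> u x \<le> \<phi> x"
  shows "gagliardo s (UNIV - (- \<Omega>) \<times> (- \<Omega>)) u \<le> gagliardo s (UNIV - (- \<Omega>) \<times> (- \<Omega>)) (\<lambda>x. u x - \<phi> x)"
proof -
  obtain \<phi>0 E0 where adm: "admissible s \<Omega> \<phi>0 E0 u E"
    and le: "\<And>v F. admissible s \<Omega> \<phi>0 E0 v F \<Longrightarrow> energy s \<sigma> \<Omega> u E \<le> energy s \<sigma> \<Omega> v F"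
    using min unfolding minimizing_pair_def by blast
  have "in_Hs s UNIV (\<lambda>x. u x - \<phi>0 x)" using adm unfolding admissible_def by blast
  from in_Hs_diff[OF this \<phi>(1)] have "in_Hs s UNIV (\<lambda>x. (u x - \<phi> x) - \<phi>0 x)" by (simp add: algebra_simps)
  moreover have "AE x in lebesgue. x \<in> - \<Omega> \<longrightarrow> u x - \<phi> x = \<phi>0 x"
    using adm \<phi>(2) unfolding admissible_def by auto
  moreover have "AE x in lebesgue. x \<in> E \<inter> \<Omega> \<longrightarrow> 0 \<le> u x - \<phi> x"
  proof -
    have "AE x in lebesgue. x \<in> E \<inter> \<Omega> \<longrightarrow> 0 \<le> u x" using adm unfolding admissible_def by auto
    then show ?thesis by eventually_elim (use sign in auto)
  qed
  moreover have "AE x in lebesgue. x \<in> - E \<inter> \<Omega> \<longrightarrow> u x - \<phi> x \<le> 0"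
  proof -
    have "AE x in lebesgue. x \<in> - E \<inter> \<Omega> \<longrightarrow> u x \<le> 0" using adm unfolding admissible_def by auto
    then show ?thesis by eventually_elim (use sign in auto)
  qed
  ultimately have "admissible s \<Omega> \<phi>0 E0 (\<lambda>x. u x - \<phi> x) E"
    using adm unfolding admissible_def by auto
  from le[OF this] have "frac_Per \<sigma> E \<Omega> + gagliardo s (UNIV - (- \<Omega>) \<times> (- \<Omega>)) u
     \<le> frac_Per \<sigma> E \<Omega> + gagliardo s (UNIV - (- \<Omega>) \<times> (- \<Omega>)) (\<lambda>x. u x - \<phi> x)"
    unfolding energy_def by (simp add: add.commute)
  moreover have "frac_Per \<sigma> E \<Omega> \<noteq> \<infinity>"
    using minimizing_pair_energy_finite[OF min] unfolding energy_def by auto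
  ultimately show ?thesis by (simp add: ennreal_add_left_cancel_le)
qed

lemma minimizing_pair_sign:
  assumes "minimizing_pair s \<sigma> \<Omega> u E"
  shows "AE x in lebesgue. x \<in> \<Omega> \<longrightarrow> (x \<in> E \<longrightarrow> 0 \<le> u x) \<and> (x \<notin> E \<longrightarrow> u x \<le> 0)"
proof -
  obtain \<phi>0 E0 where "admissible s \<Omega> \<phi>0 E0 u E" using assms unfolding minimizing_pair_def by blast
  then have "AE x in lebesgue. x \<in> E \<inter> \<Omega> \<longrightarrow> 0 \<le> u x" "AE x in lebesgue. x \<in> - E \<inter> \<Omega> \<longrightarrow> u x \<le> 0"
    unfolding admissible_def by auto
  then show ?thesis by eventually_elim auto
qed

lemma holder_seminorm_bound:
  assumes "holder_seminorm \<gamma> u < \<infinity>"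
  obtains C where "\<And>x y. \<bar>u x - u y\<bar> \<le> C * norm (x - y) powr \<gamma>"
proof
  fix x y
  show "\<bar>u x - u y\<bar> \<le> enn2real (holder_seminorm \<gamma> u) * norm (x - y) powr \<gamma>"
  proof (cases "x = y")
    case False
    have "ennreal (\<bar>u x - u y\<bar> / norm (x - y) powr \<gamma>) \<le> holder_seminorm \<gamma> u"
      unfolding holder_seminorm_def using False by (intro SUP_upper2[of "(x, y)"]) auto
    then have "\<bar>u x - u y\<bar> / norm (x - y) powr \<gamma> \<le> enn2real (holder_seminorm \<gamma> u)"
      using enn2real_mono[of _ "holder_seminorm \<gamma> u"] assms by fastforce
    then show ?thesis using False by (simp add: field_simps)
  qed simp
qed

section \<open>From cones to the comparison argument\<close>

text \<open>A point with positive \<open>a \<bullet> x\<close> can be scaled until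
  \<open>a \<bullet> x\<close> exceeds any given \<open>b\<close>. So the boundary of the half-space
  may be moved to the origin, where scaling preserves it.\<close>

lemma cone_in_half_space:
  fixes A :: "'a::euclidean_space set"
  assumes cone: "\<And>t x. 0 < t \<Longrightarrow> t *\<^sub>R x \<in> A \<longleftrightarrow> x \<in> A" and sub: "\<And>x. x \<in> A \<Longrightarrow> a \<bullet> x \<le> b" and x: "x \<in> A"
  shows "a \<bullet> x \<le> 0"
proof (rule ccontr)
  assume "\<not> a \<bullet> x \<le> 0"
  then have p: "0 < a \<bullet> x" by simp
  define t where "t = (\<bar>b\<bar> + 1) / (a \<bullet> x)"
  have "0 < t" using p by (simp add: t_def add_nonneg_pos)
  then have "a \<bullet> (t *\<^sub>R x) \<le> b" using cone x sub by blast
  moreover have "a \<bullet> (t *\<^sub>R x) = \<bar>b\<bar> + 1" using p by (simp add: t_def)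
  ultimately show False by linarith
qed

text \<open>Homogeneity forces \<open>u 0 = 0\<close>, but a positive value would not decrease along
  the ray towards the origin. Only one sign is treated, since the other follows by passing to
  \<open>- u\<close>.\<close>

lemma homogeneous_negative_degree:
  fixes u :: "'a::euclidean_space \<Rightarrow> real"
  assumes "continuous_on UNIV u" "\<beta> < 0" and homog: "\<And>t x. 0 < t \<Longrightarrow> u (t *\<^sub>R x) = t powr \<beta> * u x"
  shows "u x \<le> 0"
proof (rule ccontr)
  assume "\<not> u x \<le> 0"
  then have ux: "0 < u x" by simp
  have "u 0 = 2 powr \<beta> * u 0" using homog[of 2 0] by simp
  moreover have "2 powr \<beta> < 1" using assms(2) powr_less_mono[of \<beta> 0 2] by simp
  ultimately have u0: "u 0 = 0" by auto
  have "(\<lambda>n. u ((1 / (real n + 1)) *\<^sub>R x)) \<longlonglongrightarrow> u 0"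
  proof (rule continuous_on_tendsto_compose[OF assms(1)])
    have "(\<lambda>n. 1 / (real n + 1)) \<longlonglongrightarrow> 0" by real_asymp
    then have "(\<lambda>n. (1 / (real n + 1)) *\<^sub>R x) \<longlonglongrightarrow> 0 *\<^sub>R x" by (intro tendsto_intros)
    then show "(\<lambda>n. (1 / (real n + 1)) *\<^sub>R x) \<longlonglongrightarrow> 0" by simp
  qed auto
  moreover have "u x \<le> u ((1 / (real n + 1)) *\<^sub>R x)" for n
  proof -
    have "1 powr \<beta> \<le> (1 / (real n + 1)) powr \<beta>" using assms(2) by (intro powr_mono2') auto
    then show ?thesis using ux by (subst homog) (auto simp: mult_le_cancel_right1)
  qed
  ultimately have "u x \<le> u 0" by (intro LIMSEQ_le_const) auto
  then show False using ux u0 by simp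
qed

text \<open>This turns the geometry of the cone into the analytic hypotheses of
  \<open>nonpos_of_minimal_under_truncation\<close>. The set \<open>A\<close> stands for
  \<open>E\<close> or for its complement, and minimality appears only through perturbations that
  keep the sign of \<open>u\<close>.\<close>

lemma nonpos_of_positivity_in_half_space:
  fixes u :: "real ^ 'n \<Rightarrow> real" and A :: "(real ^ 'n) set"
  assumes s: "0 < s" "s < 1" and \<beta>: "\<beta> < s" and cont: "continuous_on UNIV u"
    and homog: "\<And>t x. 0 < t \<Longrightarrow> u (t *\<^sub>R x) = t powr \<beta> * u x"
    and cone: "\<And>t x. 0 < t \<Longrightarrow> t *\<^sub>R x \<in> A \<longleftrightarrow> x \<in> A"
    and H: "halfspace H" "A \<subseteq> H"
    and sign: "\<And>R. 0 < R \<Longrightarrow> AE x in lebesgue. x \<in> ball 0 R \<longrightarrow> x \<notin> A \<longrightarrow> u x \<le> 0"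
    and hol: "\<And>x y. \<bar>u x - u y\<bar> \<le> C * norm (x - y) powr \<gamma>"
    and fin: "\<And>R. 0 < R \<Longrightarrow> gagliardo s (UNIV - (- ball 0 R) \<times> (- ball 0 R)) u < \<infinity>"
    and min: "\<And>R \<phi>. 0 < R \<Longrightarrow> in_Hs s UNIV \<phi> \<Longrightarrow> (\<And>x. 0 \<le> u x \<Longrightarrow> \<phi> x \<le> u x) \<Longrightarrow> (\<And>x. u x \<le> 0 \<Longrightarrow> u x \<le> \<phi> x)
        \<Longrightarrow> (\<And>x. x \<notin> ball 0 R \<Longrightarrow> \<phi> x = 0)
        \<Longrightarrow> gagliardo s (UNIV - (- ball 0 R) \<times> (- ball 0 R)) u
          \<le> gagliardo s (UNIV - (- ball 0 R) \<times> (- ball 0 R)) (\<lambda>x. u x - \<phi> x)"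
  shows "u x \<le> 0"
proof (cases "\<beta> < 0")
  case True
  then show ?thesis using homogeneous_negative_degree[OF cont True homog] by blast
next
  case False
  obtain a b where a: "a \<noteq> 0" "H = {x. a \<bullet> x \<le> b} \<or> H = {x. a \<bullet> x < b}"
    using H(1) unfolding halfspace_def by blast
  have "a \<bullet> x \<le> b" if "x \<in> A" for x using a(2) H(2) that by auto
  then have aA: "a \<bullet> x \<le> 0" if "x \<in> A" for x
    using cone_in_half_space[where A = A and a = a and b = b and x = x] cone that by blast
  \<comment> \<open>The unit normal pointing into the half-space that contains
    \<open>A\<close>.\<close>
  define e where "e = (- 1 / norm a) *\<^sub>R a"
  have e: "norm e = 1" using a(1) by (simp add: e_def)
  have notA: "y \<notin> A" if "e \<bullet> y < 0" for y
  proof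
    assume "y \<in> A"
    then have "0 \<le> e \<bullet> y" using aA[of y] by (simp add: e_def divide_nonpos_nonneg)
    then show False using that by simp
  qed
  have neg1: "u y \<le> 0" if y: "e \<bullet> y < 0" for y
  proof (rule ccontr)
    assume "\<not> u y \<le> 0"
    \<comment> \<open>The sign is known only almost everywhere and on one ball at a time. Were
      \<open>u y\<close> positive, this open set would contain \<open>y\<close> and so meet the
      points where the sign holds.\<close>
    define U where "U = {y. e \<bullet> y < 0} \<inter> {y. 0 < u y} \<inter> ball 0 (norm y + 1)"
    have "open U" unfolding U_def using cont
      by (intro open_Int open_Collect_less open_ball continuous_intros) auto
    moreover have "y \<in> U" using y \<open>\<not> u y \<le> 0\<close> by (simp add: U_def)
    ultimately obtain y' where "y' \<in> U" "y' \<in> ball 0 (norm y + 1) \<longrightarrow> y' \<notin> A \<longrightarrow> u y' \<le> 0"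
      using AE_lebesgue_open_ex[OF sign[of "norm y + 1"], of U] by (auto simp: add_nonneg_pos)
    then show False using notA[of y'] by (auto simp: U_def)
  qed
  \<comment> \<open>The set \<open>A\<close> may have points on the hyperplane itself, so the sign
    there is obtained from the open side by continuity.\<close>
  have neg: "u y \<le> 0" if y: "e \<bullet> y \<le> 0" for y
  proof -
    have "(\<lambda>n. u (y - (1 / (real n + 1)) *\<^sub>R e)) \<longlonglongrightarrow> u y"
    proof (rule continuous_on_tendsto_compose[OF cont])
      have "(\<lambda>n. 1 / (real n + 1)) \<longlonglongrightarrow> 0" by real_asymp
      then have "(\<lambda>n. y - (1 / (real n + 1)) *\<^sub>R e) \<longlonglongrightarrow> y - 0 *\<^sub>R e" by (intro tendsto_intros)
      then show "(\<lambda>n. y - (1 / (real n + 1)) *\<^sub>R e) \<longlonglongrightarrow> y" by simp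
    qed auto
    moreover have "u (y - (1 / (real n + 1)) *\<^sub>R e) \<le> 0" for n
    proof (rule neg1)
      have "e \<bullet> e = 1" using e by (simp add: norm_eq_1)
      moreover have "0 < 1 / (real n + 1)" by simp
      moreover have "e \<bullet> (y - (1 / (real n + 1)) *\<^sub>R e) = e \<bullet> y - 1 / (real n + 1) * (e \<bullet> e)"
        unfolding inner_diff_right inner_scaleR_right ..
      ultimately show "e \<bullet> (y - (1 / (real n + 1)) *\<^sub>R e) < 0" using y by (simp only: mult_1_right)
    qed
    ultimately show ?thesis by (intro LIMSEQ_le_const2) auto
  qed
  \<comment> \<open>The Hoelder bound is used here: \<open>y - e\<close> lies on the boundary
    hyperplane at distance one from \<open>y\<close>, so the exponent disappears and
    \<open>C\<close> bounds \<open>u\<close> on the whole noncompact slice.\<close>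
  have bdd: "u y \<le> C" if y: "e \<bullet> y = 1" for y
  proof -
    have "e \<bullet> e = 1" using e by (simp add: norm_eq_1)
    then have "u (y - e) \<le> 0" using y by (intro neg) (simp add: inner_diff_right)
    moreover have "\<bar>u y - u (y - e)\<bar> \<le> C" using hol[of y "y - e"] e by simp
    ultimately show ?thesis by linarith
  qed
  show ?thesis
  proof (rule nonpos_of_minimal_under_truncation[OF s _ \<beta> cont e homog neg bdd fin])
    fix R :: real and \<phi> :: "real ^ 'n \<Rightarrow> real"
    assume \<phi>: "0 < R" "in_Hs s UNIV \<phi>" "\<And>x. 0 \<le> \<phi> x" "\<And>x. \<phi> x \<noteq> 0 \<Longrightarrow> \<phi> x \<le> u x" "\<And>x. x \<notin> ball 0 R \<Longrightarrow> \<phi> x = 0"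
    show "gagliardo s (UNIV - (- ball 0 R) \<times> (- ball 0 R)) u
          \<le> gagliardo s (UNIV - (- ball 0 R) \<times> (- ball 0 R)) (\<lambda>x. u x - \<phi> x)"
    proof (rule min[OF \<phi>(1,2) _ _ \<phi>(5)])
      show "\<phi> y \<le> u y" if "0 \<le> u y" for y using \<phi>(4)[of y] that by (cases "\<phi> y = 0") auto
      show "u y \<le> \<phi> y" if "u y \<le> 0" for y using \<phi>(3)[of y] that by linarith
    qed
  qed (use False in auto)
qed

lemma halfspace_Compl: "halfspace E \<Longrightarrow> halfspace (- E)"
proof -
  assume "halfspace E"
  then obtain a b where a: "a \<noteq> 0" "E = {x. a \<bullet> x \<le> b} \<or> E = {x. a \<bullet> x < b}"
    unfolding halfspace_def by blast
  have "- {x. a \<bullet> x \<le> b} = {x. (- a) \<bullet> x < - b}" "- {x. a \<bullet> x < b} = {x. (- a) \<bullet> x \<le> - b}"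
    by auto
  then show ?thesis unfolding halfspace_def using a by (intro exI[of _ "- a"] exI[of _ "- b"]) auto
qed

theorem theorem2p3:
  fixes s \<sigma> \<gamma> :: real and u :: "real ^ 'n \<Rightarrow> real" and E :: "(real ^ 'n) set"
  assumes "0 < s" "s < 1" "0 < \<sigma>" "\<sigma> < 1"
    and "minimizing_cone s \<sigma> u E"
    and "continuous_on UNIV u"
    and "0 < \<gamma>" "\<gamma> \<le> 1" "holder_seminorm \<gamma> u < \<infinity>"
  shows "((\<exists>H. halfspace H \<and> E \<subseteq> H) \<longrightarrow> (\<forall>x. u x \<le> 0)) \<and>
         ((\<exists>H. halfspace H \<and> - E \<subseteq> H) \<longrightarrow> (\<forall>x. 0 \<le> u x)) \<and>
         (halfspace E \<longrightarrow> (\<forall>x. u x = 0))"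
proof -
  define \<beta> where "\<beta> = s - \<sigma> / 2"
  have \<beta>: "\<beta> < s" using \<open>0 < \<sigma>\<close> by (simp add: \<beta>_def)
  have min: "\<And>R. 0 < R \<Longrightarrow> minimizing_pair s \<sigma> (ball 0 R) u E"
    and homog: "\<And>t x. 0 < t \<Longrightarrow> u (t *\<^sub>R x) = t powr \<beta> * u x"
    and cone: "\<And>t x. 0 < t \<Longrightarrow> t *\<^sub>R x \<in> E \<longleftrightarrow> x \<in> E"
    using assms(5) unfolding minimizing_cone_def \<beta>_def by auto
  obtain C where hol: "\<And>x y. \<bar>u x - u y\<bar> \<le> C * norm (x - y) powr \<gamma>"
    using holder_seminorm_bound[OF assms(9)] by blast
  have hol': "\<bar>- u x - - u y\<bar> \<le> C * norm (x - y) powr \<gamma>" for x y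
    using hol[of x y] by (simp add: abs_minus_commute)
  have nonpos: "u x \<le> 0" if H: "halfspace H" "E \<subseteq> H" for H x
  proof (rule nonpos_of_positivity_in_half_space[OF assms(1,2) \<beta> assms(6) homog cone H _ hol])
    fix R :: real assume R: "0 < R"
    show "AE x in lebesgue. x \<in> ball 0 R \<longrightarrow> x \<notin> E \<longrightarrow> u x \<le> 0"
      using minimizing_pair_sign[OF min[OF R]] by eventually_elim auto
    show "gagliardo s (UNIV - (- ball 0 R) \<times> (- ball 0 R)) u < \<infinity>"
      by (rule minimizing_pair_gagliardo_finite[OF min[OF R]])
    fix \<phi> :: "real ^ 'n \<Rightarrow> real"
    assume "in_Hs s UNIV \<phi>" "\<And>x. 0 \<le> u x \<Longrightarrow> \<phi> x \<le> u x" "\<And>x. u x \<le> 0 \<Longrightarrow> u x \<le> \<phi> x" "\<And>x. x \<notin> ball 0 R \<Longrightarrow> \<phi> x = 0"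
    then show "gagliardo s (UNIV - (- ball 0 R) \<times> (- ball 0 R)) u
          \<le> gagliardo s (UNIV - (- ball 0 R) \<times> (- ball 0 R)) (\<lambda>x. u x - \<phi> x)"
      by (intro minimizing_pair_gagliardo_le[OF min[OF R]])
  qed
  have nonneg: "0 \<le> u x" if H: "halfspace H" "- E \<subseteq> H" for H x
  proof -
    \<comment> \<open>The roles of \<open>E\<close> and its complement are exchanged. The Gagliardo
      term is even in \<open>u\<close>, so lowering \<open>- u\<close> by \<open>\<phi>\<close>
      costs the same as perturbing \<open>u\<close> by \<open>- \<phi>\<close>, and minimality of
      the original pair suffices.\<close>
    have "- u x \<le> 0"
    proof (rule nonpos_of_positivity_in_half_space[where u = "\<lambda>x. - u x", OF assms(1,2) \<beta> _ _ _ H _ hol'])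
      show "continuous_on UNIV (\<lambda>x. - u x)" using assms(6) by (intro continuous_intros)
      show "- u (t *\<^sub>R x) = t powr \<beta> * - u x" if "0 < t" for t x using homog[OF that] by simp
      show "t *\<^sub>R x \<in> - E \<longleftrightarrow> x \<in> - E" if "0 < t" for t x using cone[OF that] by simp
      fix R :: real assume R: "0 < R"
      show "AE x in lebesgue. x \<in> ball 0 R \<longrightarrow> x \<notin> - E \<longrightarrow> - u x \<le> 0"
        using minimizing_pair_sign[OF min[OF R]] by eventually_elim auto
      show "gagliardo s (UNIV - (- ball 0 R) \<times> (- ball 0 R)) (\<lambda>x. - u x) < \<infinity>"
        unfolding gagliardo_uminus by (rule minimizing_pair_gagliardo_finite[OF min[OF R]])
      fix \<phi> :: "real ^ 'n \<Rightarrow> real"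
      assume \<phi>: "in_Hs s UNIV \<phi>" "\<And>x. 0 \<le> - u x \<Longrightarrow> \<phi> x \<le> - u x" "\<And>x. - u x \<le> 0 \<Longrightarrow> - u x \<le> \<phi> x"
        "\<And>x. x \<notin> ball 0 R \<Longrightarrow> \<phi> x = 0"
      have "gagliardo s (UNIV - (- ball 0 R) \<times> (- ball 0 R)) u
          \<le> gagliardo s (UNIV - (- ball 0 R) \<times> (- ball 0 R)) (\<lambda>x. u x - (- \<phi> x))"
      proof (rule minimizing_pair_gagliardo_le[OF min[OF R] in_Hs_uminus[OF \<phi>(1)]])
        show "- \<phi> x \<le> u x" if "0 \<le> u x" for x using \<phi>(3)[of x] that by simp
        show "u x \<le> - \<phi> x" if "u x \<le> 0" for x using \<phi>(2)[of x] that by simp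
      qed (use \<phi>(4) in auto)
      also have "(\<lambda>x. u x - (- \<phi> x)) = (\<lambda>x. - (- u x - \<phi> x))" by (simp add: add.commute)
      finally show "gagliardo s (UNIV - (- ball 0 R) \<times> (- ball 0 R)) (\<lambda>x. - u x)
          \<le> gagliardo s (UNIV - (- ball 0 R) \<times> (- ball 0 R)) (\<lambda>x. - u x - \<phi> x)"
        unfolding gagliardo_uminus .
    qed
    then show ?thesis by simp
  qed
  have "u x = 0" if E: "halfspace E" for x
    using nonpos[OF E, of x] nonneg[OF halfspace_Compl[OF E], of x] by simp
  then show ?thesis using nonpos nonneg by blast
qed

end
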